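(* Let $k\{y_1,\ldots,y_l\}$ be a ring of differential polynomials over a differential field $k$ of characteristic zero, with a fixed (arbitrary) ranking. Let $\mathbb{C} = C_1,\ldots,C_p$ be the canonical characteristic set of a characterizable differential ideal $I$. Then $\mathbb{C}$ is uniquely determined by $I$ and, in the ordinary case (one derivation), it satisfies $$\operatorname{ord} C_i \leq \operatorname{ord} I\qquad\text{for all } i,\ 1\leq i\leq p.$$
   Context: $\Delta=\{\delta_1,\ldots,\delta_n\}$ is a finite set of commuting derivations (ordinary case: $n=1$), $\Theta$ the free commutative monoid of derivative operators $\delta_1^{k_1}\cdots\delta_n^{k_n}$. $k\{y_1,\ldots,y_l\}=k\{Y\}$ is the polynomial ring over $k$ in the differential variables $\Theta Y=\{\theta y_j\}$. The order of $\delta_1^{k_1}\cdots\delta_n^{k_n}y_j$ is $k_1+\cdots+k_n$; $\operatorname{ord} f$ is the maximal order of a differential variable appearing effectively in $f$. $[F]$ is the differential ideal generated by $F$. A ranking is a total order on $\Theta Y$ such that $\theta u\geq u$ and ($u\geq v\Rightarrow\theta u\geq\theta v$); it is orderly if $\operatorname{ord}u>\operatorname{ord}v$ implies $u>v$. The leader $u_f$ of $f\notin k$ is the highest differential variable in $f$; if $d=\deg_{u_f}f$, the initial $I_f$ is the coefficient of $u_f^d$, the separant is $S_f=\partial f/\partial u_f$, and the rank is $u_f^d$. Ranks are compared by $u^{d}>v^{e}$ iff $u>v$, or $u=v$ and $d>e$. $f$ is reduced with respect to $g$ if no proper derivative of $u_g$ appears in $f$ and $\deg_{u_g}f<\deg_{u_g}g$.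 A set $\mathbb{A}\subset k\{Y\}\setminus k$ is autoreduced if each element is reduced with respect to all the others; such sets are finite and written in order of increasing rank. $\mathbb{A}=A_1,\ldots,A_r$ has lower rank than $\mathbb{B}=B_1,\ldots,B_s$ if there is $j\le r,s$ with $\operatorname{rank}A_i=\operatorname{rank}B_i$ for $i<j$ and $\operatorname{rank}A_j<\operatorname{rank}B_j$, or if $r>s$ and $\operatorname{rank}A_i=\operatorname{rank}B_i$ for $1\le i\le s$. A characteristic set of an ideal is an autoreduced subset of it of lowest rank. $H_{\mathbb{A}}$ is the product of the initials and separants of the elements of $\mathbb{A}$, and $J:H_{\mathbb{A}}^\infty=\{a : H_{\mathbb{A}}^m a\in J\text{ for some }m\geq0\}$. A differential ideal $I$ is characterizable if $I=[\mathbb{A}]:H_{\mathbb{A}}^\infty$ for some characteristic set $\mathbb{A}$ of $I$; such ideals are radical. For a characteristic set $\mathbb{C}$ let $L$ be its set of leaders and $N=\Theta Y\setminus\Theta L$ its set of non-leaders (all characteristic sets of $I$ have the same $L$). Let $>_{\rm lex}$ be the lexicographic order on power products of differential variables induced by the ranking. A characteristic set $\mathbb{C}=C_1,\ldots,C_p$ of a characterizable ideal $I$ is canonical if (1) $I_{C_i}\in k[N]$ for all $i$; (2) for each $i$, $C_i$ has no factors in $k[N]$ (other than constants of $k$), and the coefficient in $I_{C_i}$ of its leading monomial with respect to $>_{\rm lex}$ equals $1$. Order in the ordinary case: for a prime differential ideal $P$, $\operatorname{ord}P=\sum_i\operatorname{ord}D_i$ where $D_1,\ldots,D_q$ is a characteristic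 set of $P$ with respect to an orderly ranking (independent of choices). For a characterizable differential ideal $I=\bigcap_{i=1}^n P_i$ with $P_i$ its minimal differential prime components, $\operatorname{ord}I=\max_{1\le i\le n}\operatorname{ord}P_i$. *)

theory Defs
  imports Complex_Main "HOL-Library.Cardinality" "HOL-Library.Multiset" "HOL-Library.Poly_Mapping"
begin

text \<open>
  Polynomials in variables of type \<open>'v\<close> are finitely supported maps from power products
  (finitely supported exponent vectors) to coefficients; the ring structure is the convolution
  product of \<open>Poly_Mapping\<close>.
\<close>

type_synonym ('v, 'k) mpoly = "('v \<Rightarrow>\<^sub>0 nat) \<Rightarrow>\<^sub>0 'k"

definition Const :: "'k::zero \<Rightarrow> ('v, 'k) mpoly" where
  "Const c = Poly_Mapping.single 0 c"

definition Var :: "'v \<Rightarrow> ('v, 'k::zero_neq_one) mpoly" where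
  "Var v = Poly_Mapping.single (Poly_Mapping.single v 1) 1"

definition vars :: "('v, 'k::zero) mpoly \<Rightarrow> 'v set" where
  "vars f = (\<Union>m\<in>Poly_Mapping.keys f. Poly_Mapping.keys m)"

text \<open>The subring \<open>k[N]\<close> of polynomials in the variables from \<open>N\<close>.\<close>

definition poly_in :: "'v set \<Rightarrow> ('v, 'k::zero) mpoly set" where
  "poly_in N = {f. vars f \<subseteq> N}"

definition deg_in :: "'v \<Rightarrow> ('v, 'k::zero) mpoly \<Rightarrow> nat" where
  "deg_in v f = Max (insert 0 ((\<lambda>m. Poly_Mapping.lookup m v) ` Poly_Mapping.keys f))"

definition coeff_in :: "'v \<Rightarrow> nat \<Rightarrow> ('v, 'k::comm_monoid_add) mpoly \<Rightarrow> ('v, 'k) mpoly" where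
  "coeff_in v d f =
    (\<Sum>m | m \<in> Poly_Mapping.keys f \<and> Poly_Mapping.lookup m v = d.
       Poly_Mapping.single (m - Poly_Mapping.single v d) (Poly_Mapping.lookup f m))"

text \<open>Formal partial derivative; monomials free of \<open>v\<close> contribute coefficient \<open>0\<close>.\<close>

definition partial :: "'v \<Rightarrow> ('v, 'k::comm_semiring_1) mpoly \<Rightarrow> ('v, 'k) mpoly" where
  "partial v f =
    (\<Sum>m\<in>Poly_Mapping.keys f.
       Poly_Mapping.single (m - Poly_Mapping.single v 1)
         (of_nat (Poly_Mapping.lookup m v) * Poly_Mapping.lookup f m))"

text \<open>
  The derivations are indexed by a finite type \<open>'d\<close> and the differential indeterminates by a
  finite type \<open>'l\<close>.  The free commutative monoid \<open>\<Theta>\<close> of derivative operators is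
  \<open>'d multiset\<close>, and the pair \<open>(\<theta>, j)\<close> is the differential variable \<open>\<theta> y\<^sub>j\<close>.
\<close>

type_synonym ('d, 'l) dvar = "'d multiset \<times> 'l"

type_synonym ('d, 'l, 'k) dpoly = "(('d, 'l) dvar, 'k) mpoly"

definition dapp :: "'d multiset \<Rightarrow> ('d, 'l) dvar \<Rightarrow> ('d, 'l) dvar" where
  "dapp \<theta> u = (\<theta> + fst u, snd u)"

definition dord_var :: "('d, 'l) dvar \<Rightarrow> nat" where
  "dord_var u = size (fst u)"

text \<open>Only used for \<open>f \<notin> k\<close>; elements of \<open>k\<close> get the dummy value \<open>0\<close>.\<close>

definition dord :: "('d, 'l, 'k::zero) dpoly \<Rightarrow> nat" where
  "dord f = Max (insert 0 (dord_var ` vars f))"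

definition commuting_derivations :: "('d \<Rightarrow> 'k::comm_ring_1 \<Rightarrow> 'k) \<Rightarrow> bool" where
  "commuting_derivations D \<longleftrightarrow>
    (\<forall>i a b. D i (a + b) = D i a + D i b) \<and>
    (\<forall>i a b. D i (a * b) = D i a * b + a * D i b) \<and>
    (\<forall>i j a. D i (D j a) = D j (D i a))"

text \<open>
  The extension of the derivation \<open>D i\<close> to differential polynomials, by the chain rule: apply
  \<open>D i\<close> to the coefficients, and add \<open>\<partial>f/\<partial>v \<cdot> \<delta>\<^sub>i v\<close> for every variable \<open>v\<close> of \<open>f\<close>.
\<close>

definition dderiv ::
  "('d \<Rightarrow> 'k::comm_ring_1 \<Rightarrow> 'k) \<Rightarrow> 'd \<Rightarrow> ('d, 'l, 'k) dpoly \<Rightarrow> ('d, 'l, 'k) dpoly" where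
  "dderiv D i f =
    (\<Sum>m\<in>Poly_Mapping.keys f. Poly_Mapping.single m (D i (Poly_Mapping.lookup f m))) +
    (\<Sum>v\<in>vars f. partial v f * Var (dapp {#i#} v))"

definition diff_ideal ::
  "('d \<Rightarrow> 'k::comm_ring_1 \<Rightarrow> 'k) \<Rightarrow> ('d, 'l, 'k) dpoly set \<Rightarrow> bool" where
  "diff_ideal D I \<longleftrightarrow>
    0 \<in> I \<and>
    (\<forall>f\<in>I. \<forall>g\<in>I. f + g \<in> I) \<and>
    (\<forall>f\<in>I. \<forall>g. g * f \<in> I) \<and>
    (\<forall>f\<in>I. \<forall>i. dderiv D i f \<in> I)"

definition diff_ideal_gen ::
  "('d \<Rightarrow> 'k::comm_ring_1 \<Rightarrow> 'k) \<Rightarrow> ('d, 'l, 'k) dpoly set \<Rightarrow> ('d, 'l, 'k) dpoly set" where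
  "diff_ideal_gen D F = \<Inter>{J. diff_ideal D J \<and> F \<subseteq> J}"

definition saturation ::
  "('v, 'k::comm_ring_1) mpoly set \<Rightarrow> ('v, 'k) mpoly \<Rightarrow> ('v, 'k) mpoly set" where
  "saturation J h = {a. \<exists>m::nat. h ^ m * a \<in> J}"

text \<open>A ranking is represented by its reflexive order relation: \<open>le u v\<close> means \<open>u \<le> v\<close>.\<close>

definition ranking :: "(('d, 'l) dvar \<Rightarrow> ('d, 'l) dvar \<Rightarrow> bool) \<Rightarrow> bool" where
  "ranking le \<longleftrightarrow>
    linear_order {(u, v). le u v} \<and>
    (\<forall>\<theta> u. le u (dapp \<theta> u)) \<and>
    (\<forall>\<theta> u v. le v u \<longrightarrow> le (dapp \<theta> v) (dapp \<theta> u))"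

definition orderly :: "(('d, 'l) dvar \<Rightarrow> ('d, 'l) dvar \<Rightarrow> bool) \<Rightarrow> bool" where
  "orderly le \<longleftrightarrow> (\<forall>u v. dord_var v < dord_var u \<longrightarrow> le v u \<and> v \<noteq> u)"

definition leader :: "('v \<Rightarrow> 'v \<Rightarrow> bool) \<Rightarrow> ('v, 'k::zero) mpoly \<Rightarrow> 'v" where
  "leader le f = (THE u. u \<in> vars f \<and> (\<forall>v\<in>vars f. le v u))"

text \<open>The rank \<open>u\<^sup>d\<close> is encoded as the pair \<open>(u, d)\<close>.\<close>

definition rank :: "('v \<Rightarrow> 'v \<Rightarrow> bool) \<Rightarrow> ('v, 'k::zero) mpoly \<Rightarrow> 'v \<times> nat" where
  "rank le f = (leader le f, deg_in (leader le f) f)"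

definition rank_less :: "('v \<Rightarrow> 'v \<Rightarrow> bool) \<Rightarrow> 'v \<times> nat \<Rightarrow> 'v \<times> nat \<Rightarrow> bool" where
  "rank_less le r s \<longleftrightarrow>
    (le (fst r) (fst s) \<and> fst r \<noteq> fst s) \<or> (fst r = fst s \<and> snd r < snd s)"

definition initial ::
  "('v \<Rightarrow> 'v \<Rightarrow> bool) \<Rightarrow> ('v, 'k::comm_monoid_add) mpoly \<Rightarrow> ('v, 'k) mpoly" where
  "initial le f = coeff_in (leader le f) (deg_in (leader le f) f) f"

definition separant ::
  "('v \<Rightarrow> 'v \<Rightarrow> bool) \<Rightarrow> ('v, 'k::comm_semiring_1) mpoly \<Rightarrow> ('v, 'k) mpoly" where
  "separant le f = partial (leader le f) f"

definition reduced ::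
  "(('d, 'l) dvar \<Rightarrow> ('d, 'l) dvar \<Rightarrow> bool) \<Rightarrow>
    ('d, 'l, 'k::zero) dpoly \<Rightarrow> ('d, 'l, 'k) dpoly \<Rightarrow> bool" where
  "reduced le f g \<longleftrightarrow>
    (\<forall>\<theta>. \<theta> \<noteq> {#} \<longrightarrow> dapp \<theta> (leader le g) \<notin> vars f) \<and>
    deg_in (leader le g) f < deg_in (leader le g) g"

text \<open>
  Autoreduced sets are finite and their elements have pairwise distinct ranks, so they are
  represented by the list of their elements in order of increasing rank.
\<close>

definition autoreduced ::
  "(('d, 'l) dvar \<Rightarrow> ('d, 'l) dvar \<Rightarrow> bool) \<Rightarrow> ('d, 'l, 'k::zero) dpoly list \<Rightarrow> bool" where
  "autoreduced le A \<longleftrightarrow>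
    set A \<inter> range Const = {} \<and>
    (\<forall>f\<in>set A. \<forall>g\<in>set A. f \<noteq> g \<longrightarrow> reduced le f g) \<and>
    sorted_wrt (\<lambda>f g. rank_less le (rank le f) (rank le g)) A"

definition lower_rank ::
  "('v \<Rightarrow> 'v \<Rightarrow> bool) \<Rightarrow> ('v, 'k::zero) mpoly list \<Rightarrow> ('v, 'k) mpoly list \<Rightarrow> bool" where
  "lower_rank le A B \<longleftrightarrow>
    (\<exists>j. j < length A \<and> j < length B \<and>
       (\<forall>i<j. rank le (A ! i) = rank le (B ! i)) \<and>
       rank_less le (rank le (A ! j)) (rank le (B ! j))) \<or>
    (length B < length A \<and> (\<forall>i<length B. rank le (A ! i) = rank le (B ! i)))"

definition char_set ::
  "(('d, 'l) dvar \<Rightarrow> ('d, 'l) dvar \<Rightarrow> bool) \<Rightarrow>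
    ('d, 'l, 'k::zero) dpoly set \<Rightarrow> ('d, 'l, 'k) dpoly list \<Rightarrow> bool" where
  "char_set le I A \<longleftrightarrow>
    autoreduced le A \<and> set A \<subseteq> I \<and>
    (\<forall>B. autoreduced le B \<and> set B \<subseteq> I \<longrightarrow> \<not> lower_rank le B A)"

definition H :: "('v \<Rightarrow> 'v \<Rightarrow> bool) \<Rightarrow> ('v, 'k::comm_ring_1) mpoly list \<Rightarrow> ('v, 'k) mpoly" where
  "H le A = prod_list (map (\<lambda>f. initial le f * separant le f) A)"

definition characterizable ::
  "('d \<Rightarrow> 'k::comm_ring_1 \<Rightarrow> 'k) \<Rightarrow> (('d, 'l) dvar \<Rightarrow> ('d, 'l) dvar \<Rightarrow> bool) \<Rightarrow>
    ('d, 'l, 'k) dpoly set \<Rightarrow> bool" where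
  "characterizable D le I \<longleftrightarrow>
    diff_ideal D I \<and>
    (\<exists>A. char_set le I A \<and> I = saturation (diff_ideal_gen D (set A)) (H le A))"

definition nonleaders ::
  "(('d, 'l) dvar \<Rightarrow> ('d, 'l) dvar \<Rightarrow> bool) \<Rightarrow> ('d, 'l, 'k::zero) dpoly list \<Rightarrow> ('d, 'l) dvar set"
  where "nonleaders le A = - {dapp \<theta> (leader le f) | \<theta> f. f \<in> set A}"

text \<open>
  Lexicographic order on power products: the highest variable (with respect to the ranking) in
  which the exponents differ decides.
\<close>

definition lex_less :: "('v \<Rightarrow> 'v \<Rightarrow> bool) \<Rightarrow> ('v \<Rightarrow>\<^sub>0 nat) \<Rightarrow> ('v \<Rightarrow>\<^sub>0 nat) \<Rightarrow> bool" where
  "lex_less le m m' \<longleftrightarrow>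
    (\<exists>u. Poly_Mapping.lookup m u < Poly_Mapping.lookup m' u \<and>
       (\<forall>v. le u v \<and> u \<noteq> v \<longrightarrow> Poly_Mapping.lookup m v = Poly_Mapping.lookup m' v))"

definition lead_monom :: "('v \<Rightarrow> 'v \<Rightarrow> bool) \<Rightarrow> ('v, 'k::zero) mpoly \<Rightarrow> ('v \<Rightarrow>\<^sub>0 nat)" where
  "lead_monom le f =
    (THE m. m \<in> Poly_Mapping.keys f \<and>
       (\<forall>m'\<in>Poly_Mapping.keys f. m' \<noteq> m \<longrightarrow> lex_less le m' m))"

definition canonical_char_set ::
  "(('d, 'l) dvar \<Rightarrow> ('d, 'l) dvar \<Rightarrow> bool) \<Rightarrow>
    ('d, 'l, 'k::comm_ring_1) dpoly set \<Rightarrow> ('d, 'l, 'k) dpoly list \<Rightarrow> bool" where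
  "canonical_char_set le I C \<longleftrightarrow>
    char_set le I C \<and>
    (\<forall>f\<in>set C. initial le f \<in> poly_in (nonleaders le C)) \<and>
    (\<forall>f\<in>set C.
       (\<forall>g\<in>poly_in (nonleaders le C). g dvd f \<longrightarrow> g \<in> range Const) \<and>
       Poly_Mapping.lookup (initial le f) (lead_monom le (initial le f)) = 1)"

definition prime_diff_ideal ::
  "('d \<Rightarrow> 'k::comm_ring_1 \<Rightarrow> 'k) \<Rightarrow> ('d, 'l, 'k) dpoly set \<Rightarrow> bool" where
  "prime_diff_ideal D P \<longleftrightarrow>
    diff_ideal D P \<and> 1 \<notin> P \<and> (\<forall>f g. f * g \<in> P \<longrightarrow> f \<in> P \<or> g \<in> P)"

definition minimal_primes ::
  "('d \<Rightarrow> 'k::comm_ring_1 \<Rightarrow> 'k) \<Rightarrow> ('d, 'l, 'k) dpoly set \<Rightarrow> ('d, 'l, 'k) dpoly set set" where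
  "minimal_primes D I =
    {P. prime_diff_ideal D P \<and> I \<subseteq> P \<and>
       (\<forall>Q. prime_diff_ideal D Q \<and> I \<subseteq> Q \<and> Q \<subseteq> P \<longrightarrow> Q = P)}"

text \<open>
  The value does not depend on the orderly ranking and characteristic set chosen, when there is
  only one derivation and \<open>P\<close> is a prime differential ideal.
\<close>

definition ord_prime :: "('d, 'l, 'k::zero) dpoly set \<Rightarrow> nat" where
  "ord_prime P =
    (SOME s. \<exists>le A. ranking le \<and> orderly le \<and> char_set le P A \<and> s = sum_list (map dord A))"

text \<open>A characterizable differential ideal is radical, hence has finitely many minimal primes.\<close>

definition ord_ideal ::
  "('d \<Rightarrow> 'k::comm_ring_1 \<Rightarrow> 'k) \<Rightarrow> ('d, 'l, 'k) dpoly set \<Rightarrow> nat" where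
  "ord_ideal D I = Max (ord_prime ` minimal_primes D I)"

end

theory Submission
  imports Defs "HOL-Computational_Algebra.Factorial_Ring" "HOL-Library.FuncSet"
begin

text \<open>
  Uniqueness: if \<open>C\<^sub>i\<close> and \<open>C'\<^sub>i\<close> are corresponding elements of two canonical characteristic sets with
  initials \<open>a\<close> and \<open>a'\<close>, then \<open>a' C\<^sub>i - a C'\<^sub>i\<close> lies in \<open>I\<close> and is reduced, hence zero, and unique
  factorization together with the absence of factors in \<open>k[N]\<close> gives \<open>C\<^sub>i = C'\<^sub>i\<close>.

  Order bound: the elements of \<open>k[N]\<close> and the separants of \<open>C\<close> are regular modulo \<open>I\<close>, so they lie in no
  minimal prime \<open>P\<close> of \<open>I\<close>.  Let \<open>s\<close> be the highest order of a parametric variable (a derivative of an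
  indeterminate none of whose derivatives is a leader) in \<open>C\<close>, and let \<open>z\<close> of order \<open>s\<close> occur in \<open>C\<^sub>i\<close> with \<open>i\<close> least.  As \<open>C\<^sub>i\<close> is
  primitive, \<open>\<partial>C\<^sub>i/\<partial>z \<notin> I\<close>, and as \<open>I\<close> is radical on the relevant polynomials, some minimal prime \<open>P\<close>
  does not contain \<open>\<partial>C\<^sub>i/\<partial>z\<close>.  Modulo \<open>P\<close> the \<open>k\<close>-th derivative of the leader \<open>u\<close> of \<open>C\<^sub>i\<close>
  depends on the \<open>k\<close>-th derivative of \<open>z\<close>.  The variables of order at most \<open>t\<close> have transcendence
  degree \<open>q (t + 1) + ord P\<close> modulo \<open>P\<close> for large \<open>t\<close>; comparing this with the independent set
  \<open>N\<close> yields \<open>e + (s - ord u) \<le> ord P\<close>, where \<open>e \<ge> ord u\<close> is the sum of the orders of the leaders of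
  \<open>C\<close>, and so \<open>s \<le> ord P\<close>.
\<close>

text \<open>The given ranking is arbitrary, whereas ord P is computed with an orderly one, so the
  two can only be compared by counting variables. The summand s - ord u arises in that count as
  follows. If z has larger order than u, then knowing all variables of order at most t includes the
  derivatives of u up to order t, and these determine the derivatives of z up to order t + (s - ord
  u). Every other parametric indeterminate has to be adjoined up to that order, so z saves s - ord u
  generators. Choosing u lowest prevents circularity: the leaders below u then depend only on
  parametric variables of order less than s. A canonical set need not be the set whose
  \<open>H\<close> presents I as a saturation, so the regularity of its initials and separants has
  to be derived from that of the other set. Radicality is not given either; it is proved for
  polynomials without proper derivatives of leaders, which covers the partial derivatives in
  question. The maximum defining ord I is taken over a set whose finiteness comes from a bound on
  ord P that is uniform in P.\<close>

abbreviation "lookup \<equiv> Poly_Mapping.lookup"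
abbreviation "keys \<equiv> Poly_Mapping.keys"
abbreviation "single \<equiv> Poly_Mapping.single"

subsection \<open>Polynomials in arbitrarily many variables\<close>

lemma single_sum_keys:
  fixes f :: "'a \<Rightarrow>\<^sub>0 'b::comm_monoid_add"
  shows "f = (\<Sum>m\<in>keys f. single m (lookup f m))"
proof (rule poly_mapping_eqI)
  fix n
  have "(\<Sum>m\<in>keys f. lookup (single m (lookup f m)) n) =
      (\<Sum>m\<in>keys f. if m = n then lookup f n else 0)"
    by (rule sum.cong) (auto simp: lookup_single when_def)
  also have "\<dots> = lookup f n"
    by (simp add: sum.delta' in_keys_iff)
  finally show "lookup f n = lookup (\<Sum>m\<in>keys f. single m (lookup f m)) n"
    by (simp add: lookup_sum)
qed

lemma poly_mapping_mono_induct [case_names zero single add]: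
  fixes f :: "'a \<Rightarrow>\<^sub>0 'b::comm_monoid_add"
  assumes "P 0" "\<And>m c. P (single m c)" "\<And>f g. P f \<Longrightarrow> P g \<Longrightarrow> P (f + g)"
  shows "P f"
proof -
  have "P (\<Sum>m\<in>X. single m (lookup f m))" if "finite X" for X
    using that by (induction X rule: finite_induct) (auto intro: assms)
  from this[of "keys f"] show ?thesis
    by (simp flip: single_sum_keys)
qed

lemma Const_0 [simp]: "Const 0 = 0"
  and Const_1 [simp]: "Const 1 = (1 :: ('v, 'k::comm_ring_1) mpoly)"
  and Const_add: "Const (a + b) = (Const a + Const b :: ('v, 'k) mpoly)"
  and Const_mult: "Const (a * b) = (Const a * Const b :: ('v, 'k) mpoly)"
  by (simp_all add: Const_def single_add mult_single)

lemma Const_of_nat: "Const (of_nat n) = (of_nat n :: ('v, 'k::comm_ring_1) mpoly)"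
  by (simp add: Const_def)

lemma lookup_Const: "lookup (Const c) m = (if m = 0 then c else 0)"
  by (simp add: Const_def lookup_single when_def)

lemma Const_eq_iff [simp]: "(Const a :: ('v, 'k::zero) mpoly) = Const b \<longleftrightarrow> a = b"
  by (auto simp: Const_def dest: inj_onD[OF inj_single])

lemma Const_eq_0_iff [simp]: "(Const a :: ('v, 'k::zero) mpoly) = 0 \<longleftrightarrow> a = 0"
  by (metis Const_0 Const_eq_iff)

lemma Var_power: "(Var v :: ('v, 'k::comm_ring_1) mpoly) ^ n = single (single v n) 1"
  by (induction n) (simp_all add: Var_def mult_single flip: single_add)

lemma single_conv_Const_mult:
  "single m c = Const c * (single m 1 :: ('v, 'k::comm_ring_1) mpoly)"
  by (simp add: Const_def mult_single)

lemma single_eq_prod_Var: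
  "(single m 1 :: ('v, 'k::comm_ring_1) mpoly) = (\<Prod>v\<in>keys m. Var v ^ lookup m v)"
proof -
  have "(\<Prod>v\<in>X. Var v ^ lookup m v) =
      (single (\<Sum>v\<in>X. single v (lookup m v)) 1 :: ('v, 'k::comm_ring_1) mpoly)"
    if "finite X" for X
    using that by (induction X rule: finite_induct) (simp_all add: Var_power mult_single)
  from this[of "keys m"] show ?thesis
    by (simp flip: single_sum_keys)
qed

text \<open>The \<open>Var\<close> case ranges only over variables occurring in f, so a property of
  f can be deduced from the same property of its own variables; the induction along the ranking in
  \<open>partial_reduction\<close> relies on this.\<close>

lemma mpoly_induct [case_names Const Var add mult]:
  fixes f :: "('v, 'k::comm_ring_1) mpoly"
  assumes "\<And>c. P (Const c)" "\<And>v. v \<in> vars f \<Longrightarrow> P (Var v)"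
    and "\<And>f g. P f \<Longrightarrow> P g \<Longrightarrow> P (f + g)" "\<And>f g. P f \<Longrightarrow> P g \<Longrightarrow> P (f * g)"
  shows "P f"
proof -
  have pow: "P (p ^ n)" if "P p" for p n
    by (induction n) (use that assms(1)[of 1] assms(4) in auto)
  have prd: "P (\<Prod>v\<in>X. p v)" if "finite X" "\<And>v. v \<in> X \<Longrightarrow> P (p v)" for X :: "'v set" and p
    using that by (induction X rule: finite_induct) (use assms(1)[of 1] assms(4) in auto)
  have sm: "P (\<Sum>v\<in>X. p v)" if "finite X" "\<And>v. v \<in> X \<Longrightarrow> P (p v)" for X :: "('v \<Rightarrow>\<^sub>0 nat) set" and p
    using that by (induction X rule: finite_induct) (use assms(1)[of 0] assms(3) in auto)
  have "P (\<Sum>m\<in>keys f. single m (lookup f m))"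
  proof (rule sm)
    fix m assume m: "m \<in> keys f"
    show "P (single m (lookup f m))"
      unfolding single_conv_Const_mult[of m "lookup f m"] single_eq_prod_Var[of m]
      by (rule assms(4)[OF assms(1) prd]) (use m in \<open>auto intro!: pow assms(2) simp: vars_def\<close>)
  qed simp
  then show ?thesis by (simp flip: single_sum_keys)
qed

section \<open>Occurring variables and polynomial subrings\<close>

lemma in_varsI: "m \<in> keys f \<Longrightarrow> v \<in> keys m \<Longrightarrow> v \<in> vars f"
  by (auto simp: vars_def)

lemma finite_vars [simp]: "finite (vars f)"
  by (simp add: vars_def)

lemma vars_0 [simp]: "vars 0 = {}"
  and vars_Const [simp]: "vars (Const c) = {}"
  and vars_1 [simp]: "vars (1 :: ('v, 'k::zero_neq_one) mpoly) = {}"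
  and vars_Var [simp]: "vars (Var v :: ('v, 'k::zero_neq_one) mpoly) = {v}"
  by (auto simp: vars_def Const_def Var_def keys_one)

lemma vars_uminus [simp]: "vars (- f :: ('v, 'k::ab_group_add) mpoly) = vars f"
  by (simp add: vars_def keys_def)

lemma vars_add: "vars (f + g) \<subseteq> vars f \<union> vars g"
  using keys_add[of f g] by (fastforce simp: vars_def)

lemma vars_diff: "vars (f - g :: ('v, 'k::ab_group_add) mpoly) \<subseteq> vars f \<union> vars g"
  using vars_add[of f "- g"] by simp

lemma vars_mult: "vars (f * g :: ('v, 'k::comm_ring_1) mpoly) \<subseteq> vars f \<union> vars g"
proof
  fix v assume "v \<in> vars (f * g)"
  then obtain m where m: "m \<in> keys (f * g)" "v \<in> keys m" by (auto simp: vars_def)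
  from m(1) keys_mult[of f g] obtain a b where "m = a + b" "a \<in> keys f" "b \<in> keys g" by blast
  with m(2) keys_add[of a b] show "v \<in> vars f \<union> vars g" by (auto simp: vars_def)
qed

lemma vars_sum: "vars (\<Sum>x\<in>X. p x) \<subseteq> (\<Union>x\<in>X. vars (p x))"
  by (induction X rule: infinite_finite_induct) (use vars_add in fastforce)+

lemma poly_in_0 [simp]: "0 \<in> poly_in W"
  and poly_in_1 [simp]: "(1 :: ('v, 'k::zero_neq_one) mpoly) \<in> poly_in W"
  and poly_in_Const [simp]: "Const c \<in> poly_in W"
  by (simp_all add: poly_in_def)

lemma poly_in_Var: "v \<in> W \<Longrightarrow> (Var v :: ('v, 'k::zero_neq_one) mpoly) \<in> poly_in W"
  by (simp add: poly_in_def)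

lemma poly_in_add: "f \<in> poly_in W \<Longrightarrow> g \<in> poly_in W \<Longrightarrow> f + g \<in> poly_in W"
  using vars_add[of f g] by (auto simp: poly_in_def)

lemma poly_in_diff:
  "f \<in> poly_in W \<Longrightarrow> g \<in> poly_in W \<Longrightarrow> f - g \<in> poly_in W" for f :: "('v, 'k::ab_group_add) mpoly"
  using vars_diff[of f g] by (auto simp: poly_in_def)

lemma poly_in_uminus: "f \<in> poly_in W \<Longrightarrow> - f \<in> poly_in W" for f :: "('v, 'k::ab_group_add) mpoly"
  by (simp add: poly_in_def)

lemma poly_in_mult:
  "f \<in> poly_in W \<Longrightarrow> g \<in> poly_in W \<Longrightarrow> f * g \<in> poly_in W" for f :: "('v, 'k::comm_ring_1) mpoly"
  using vars_mult[of f g] by (auto simp: poly_in_def)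

lemma poly_in_power:
  "f \<in> poly_in W \<Longrightarrow> f ^ n \<in> poly_in W" for f :: "('v, 'k::comm_ring_1) mpoly"
  by (induction n) (auto intro: poly_in_mult)

lemma poly_in_sum: "(\<And>x. x \<in> X \<Longrightarrow> p x \<in> poly_in W) \<Longrightarrow> (\<Sum>x\<in>X. p x) \<in> poly_in W"
  by (induction X rule: infinite_finite_induct) (auto intro: poly_in_add)

lemma poly_in_mono: "f \<in> poly_in V \<Longrightarrow> V \<subseteq> W \<Longrightarrow> f \<in> poly_in W"
  by (auto simp: poly_in_def)

lemma poly_in_vars: "f \<in> poly_in (vars f)"
  by (simp add: poly_in_def)

lemma vars_empty_iff: "vars f = {} \<longleftrightarrow> f \<in> range Const"
proof
  assume "vars f = {}"
  then have "lookup f m = lookup (Const (lookup f 0)) m" for m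
    by (cases "m = 0") (auto simp: vars_def lookup_Const in_keys_iff)
  then show "f \<in> range Const" by (metis poly_mapping_eqI rangeI)
qed auto

section \<open>Coefficients and degrees with respect to one variable\<close>

lemma lookup_coeff_in:
  "lookup (coeff_in v d f) m = (if lookup m v = 0 then lookup f (m + single v d) else 0)"
proof -
  have eq: "m = n - single v d \<longleftrightarrow> lookup m v = 0 \<and> n = m + single v d" if "lookup n v = d" for n
  proof
    assume *: "m = n - single v d"
    show "lookup m v = 0 \<and> n = m + single v d"
      using that by (auto simp: * lookup_minus intro!: poly_mapping_eqI)
        (auto simp: lookup_add lookup_minus lookup_single when_def)
  qed (use that in \<open>auto simp: lookup_add\<close>)
  have "lookup (coeff_in v d f) m =
      (\<Sum>n | n \<in> keys f \<and> lookup n v = d. if m = n - single v d then lookup f n else 0)"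
    by (simp add: coeff_in_def lookup_sum lookup_single when_def) (rule sum.cong; auto)
  also have "\<dots> = (\<Sum>n | n \<in> keys f \<and> lookup n v = d.
      if n = m + single v d then (if lookup m v = 0 then lookup f n else 0) else 0)"
    by (rule sum.cong[OF refl], subst eq) auto
  also have "\<dots> = (if lookup m v = 0 then lookup f (m + single v d) else 0)"
    by (subst sum.delta) (auto simp: in_keys_iff lookup_add)
  finally show ?thesis .
qed

lemma coeff_in_0 [simp]: "coeff_in v d 0 = 0"
  by (rule poly_mapping_eqI) (simp add: lookup_coeff_in)

lemma coeff_in_add: "coeff_in v d (f + g) = coeff_in v d f + coeff_in v d g"
  by (rule poly_mapping_eqI) (simp add: lookup_coeff_in lookup_add)

lemma coeff_in_diff:
  "coeff_in v d (f - g) = coeff_in v d f - coeff_in v d g" for f :: "('v, 'k::ab_group_add) mpoly"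
  by (rule poly_mapping_eqI) (simp add: lookup_coeff_in lookup_minus)

lemma coeff_in_sum: "coeff_in v d (\<Sum>x\<in>X. p x) = (\<Sum>x\<in>X. coeff_in v d (p x))"
  by (induction X rule: infinite_finite_induct) (auto simp: coeff_in_add)

lemma coeff_in_single:
  "coeff_in v d (single m c) = (if lookup m v = d then single (m - single v d) c else 0)"
proof (cases "c = 0")
  case False
  then show ?thesis by (auto simp: coeff_in_def conj_commute cong: conj_cong)
qed simp

lemma coeff_in_mult:
  fixes f g :: "('v, 'k::comm_ring_1) mpoly"
  shows "coeff_in v d (f * g) = (\<Sum>i\<le>d. coeff_in v i f * coeff_in v (d - i) g)"
proof (induction f rule: poly_mapping_mono_induct)
  case (single m c)
  show ?case
  proof (induction g rule: poly_mapping_mono_induct)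
    case (single n b)
    have *: "m + n - single v (lookup m v + lookup n v)
        = m - single v (lookup m v) + (n - single v (lookup n v))"
      by (rule poly_mapping_eqI) (auto simp: lookup_add lookup_minus lookup_single when_def)
    have "(\<Sum>i\<le>d. coeff_in v i (single m c) * coeff_in v (d - i) (single n b)) =
       (\<Sum>i\<le>d. if i = lookup m v then coeff_in v i (single m c) * coeff_in v (d - i) (single n b) else 0)"
      by (rule sum.cong) (auto simp: coeff_in_single)
    also have "\<dots> = coeff_in v d (single m c * single n b)"
      using * by (subst sum.delta) (auto simp: coeff_in_single mult_single lookup_add)
    finally show ?case by simp
  qed (simp_all add: coeff_in_add algebra_simps sum.distrib)
qed (simp_all add: coeff_in_add algebra_simps sum.distrib)

lemma coeff_in_notin: "v \<notin> vars f \<Longrightarrow> d > 0 \<Longrightarrow> coeff_in v d f = 0"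
proof (rule poly_mapping_eqI)
  fix m
  assume "v \<notin> vars f" "d > 0"
  moreover from \<open>d > 0\<close> have "v \<in> keys (m + single v d)"
    by (simp add: in_keys_iff lookup_add)
  ultimately have "m + single v d \<notin> keys f"
    using in_varsI by metis
  then show "lookup (coeff_in v d f) m = lookup 0 m"
    by (auto simp: lookup_coeff_in in_keys_iff)
qed

lemma coeff_in_0_notin:
  assumes "v \<notin> vars f"
  shows "coeff_in v 0 f = f"
proof (rule poly_mapping_eqI)
  fix m
  have "lookup f m = 0" if "lookup m v > 0"
    using assms that in_varsI[of m f v] by (auto simp: in_keys_iff)
  then show "lookup (coeff_in v 0 f) m = lookup f m"
    by (auto simp: lookup_coeff_in)
qed

lemma vars_coeff_in: "vars (coeff_in v d f) \<subseteq> vars f - {v}"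
proof -
  have "keys m \<subseteq> vars f - {v}" if "m \<in> keys (coeff_in v d f)" for m
  proof -
    from that have *: "lookup m v = 0" "m + single v d \<in> keys f"
      by (auto simp: in_keys_iff lookup_coeff_in split: if_splits)
    have "keys m \<subseteq> keys (m + single v d)"
      by (auto simp: in_keys_iff lookup_add)
    with * show ?thesis by (auto simp: vars_def in_keys_iff)
  qed
  then show ?thesis by (auto simp: vars_def)
qed

lemma notin_vars_coeff_in [simp]: "v \<notin> vars (coeff_in v d f)"
  using vars_coeff_in[of v d f] by auto

lemma poly_in_coeff_in: "f \<in> poly_in W \<Longrightarrow> coeff_in v d f \<in> poly_in (W - {v})"
  using vars_coeff_in[of v d f] by (auto simp: poly_in_def)

text \<open>Rephrasing a degree bound as the vanishing of all higher coefficients reduces bounds for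
  sums, differences and products to identities between coefficients.\<close>

lemma deg_in_le_iff: "deg_in v f \<le> n \<longleftrightarrow> (\<forall>d>n. coeff_in v d f = 0)"
proof
  assume le: "deg_in v f \<le> n"
  show "\<forall>d>n. coeff_in v d f = 0"
  proof (intro allI impI, rule poly_mapping_eqI)
    fix d m assume "d > n"
    have "m + single v d \<notin> keys f" if "lookup m v = 0"
    proof
      assume "m + single v d \<in> keys f"
      then have "lookup (m + single v d) v \<le> deg_in v f"
        by (auto simp: deg_in_def intro!: Max_ge)
      with that le \<open>d > n\<close> show False by (simp add: lookup_add)
    qed
    then show "lookup (coeff_in v d f) m = lookup 0 m"
      by (auto simp: lookup_coeff_in in_keys_iff)
  qed
next
  assume *: "\<forall>d>n. coeff_in v d f = 0"
  have "lookup m v \<le> n" if m: "m \<in> keys f" for m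
  proof (rule ccontr)
    assume "\<not> lookup m v \<le> n"
    then have "coeff_in v (lookup m v) f = 0" by (intro *[rule_format]) simp
    moreover have "m - single v (lookup m v) + single v (lookup m v) = m"
      by (rule poly_mapping_eqI) (auto simp: lookup_add lookup_minus lookup_single when_def)
    ultimately have "lookup f m = 0"
      using lookup_coeff_in[of v "lookup m v" f "m - single v (lookup m v)"]
      by (simp add: lookup_minus)
    with m show False by (simp add: in_keys_iff)
  qed
  then show "deg_in v f \<le> n" by (auto simp: deg_in_def)
qed

lemma coeff_in_above_deg: "deg_in v f < d \<Longrightarrow> coeff_in v d f = 0"
  by (rule deg_in_le_iff[THEN iffD1, rule_format, OF order_refl])

lemma lead_coeff_in_nonzero:
  assumes "f \<noteq> 0"
  shows "coeff_in v (deg_in v f) f \<noteq> 0"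
proof (cases "deg_in v f = 0")
  case True
  show ?thesis
  proof
    assume 0: "coeff_in v (deg_in v f) f = 0"
    have "lookup f m = 0" for m
    proof (cases "lookup m v = 0")
      case t: True
      then show ?thesis using arg_cong[OF 0, of "\<lambda>p. lookup p m"]
        by (simp add: lookup_coeff_in True)
    next
      case False
      have "lookup m v \<le> deg_in v f" if "m \<in> keys f"
        using that by (auto simp: deg_in_def intro!: Max_ge)
      with False True show ?thesis by (auto simp: in_keys_iff)
    qed
    then have "f = 0" by (intro poly_mapping_eqI) simp
    with assms show False by contradiction
  qed
next
  case False
  show ?thesis
  proof
    assume 0: "coeff_in v (deg_in v f) f = 0"
    have "deg_in v f \<le> deg_in v f - 1"
      unfolding deg_in_le_iff[of v f "deg_in v f - 1"]
    proof (intro allI impI)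
      fix d assume "deg_in v f - 1 < d"
      then show "coeff_in v d f = 0" by (cases "d = deg_in v f") (auto simp: 0 coeff_in_above_deg)
    qed
    with False show False by simp
  qed
qed

lemma le_deg_in: "coeff_in v d f \<noteq> 0 \<Longrightarrow> d \<le> deg_in v f"
  by (rule ccontr) (simp add: coeff_in_above_deg)

lemma deg_in_0 [simp]: "deg_in v 0 = 0"
  by (simp add: deg_in_def)

lemma deg_in_notin: "v \<notin> vars f \<Longrightarrow> deg_in v f = 0"
proof -
  assume v: "v \<notin> vars f"
  have "lookup m v = 0" if "m \<in> keys f" for m
    using v in_varsI[OF that, of v] by (auto simp: in_keys_iff)
  then have "(\<lambda>m. lookup m v) ` keys f \<subseteq> {0}" by auto
  then have "insert 0 ((\<lambda>m. lookup m v) ` keys f) = {0}" by auto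
  then show ?thesis unfolding deg_in_def by (simp only: Max_singleton)
qed

lemma deg_in_pos_iff: "0 < deg_in v f \<longleftrightarrow> v \<in> vars f"
proof
  assume "v \<in> vars f"
  then obtain m where m: "m \<in> keys f" "lookup m v > 0" by (auto simp: vars_def in_keys_iff)
  then have "lookup m v \<le> deg_in v f" by (auto simp: deg_in_def intro!: Max_ge)
  with m show "0 < deg_in v f" by simp
next
  assume "0 < deg_in v f"
  then show "v \<in> vars f" by (rule contrapos_pp) (simp add: deg_in_notin)
qed

lemma deg_in_Const [simp]: "deg_in v (Const c) = 0"
  and deg_in_1 [simp]: "deg_in v (1 :: ('v, 'k::zero_neq_one) mpoly) = 0"
  by (simp_all add: deg_in_notin)

lemma coeff_in_Var_power:
  "coeff_in v d (Var v ^ n :: ('v, 'k::comm_ring_1) mpoly) = (if d = n then 1 else 0)"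
  by (auto simp: Var_power coeff_in_single)

lemma coeff_in_mult_Var_power:
  fixes f :: "('v, 'k::comm_ring_1) mpoly"
  shows "coeff_in v d (f * Var v ^ n) = (if n \<le> d then coeff_in v (d - n) f else 0)"
proof -
  have "coeff_in v d (f * Var v ^ n) = (\<Sum>i\<le>d. if i = d - n \<and> n \<le> d then coeff_in v i f else 0)"
    unfolding coeff_in_mult by (rule sum.cong) (auto simp: coeff_in_Var_power)
  also have "\<dots> = (if n \<le> d then coeff_in v (d - n) f else 0)"
    by (auto simp: sum.delta)
  finally show ?thesis .
qed

lemma coeff_in_mult_notin:
  fixes f g :: "('v, 'k::comm_ring_1) mpoly"
  assumes "v \<notin> vars f"
  shows "coeff_in v d (f * g) = f * coeff_in v d g"
proof -
  have "coeff_in v d (f * g) = (\<Sum>i\<le>d. if i = 0 then f * coeff_in v d g else 0)"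
    unfolding coeff_in_mult
    by (rule sum.cong) (use assms in \<open>auto simp: coeff_in_notin coeff_in_0_notin\<close>)
  then show ?thesis by simp
qed

lemma coeff_in_ext:
  fixes f g :: "('v, 'k::comm_monoid_add) mpoly"
  assumes "\<And>d. coeff_in v d f = coeff_in v d g"
  shows "f = g"
proof (rule poly_mapping_eqI)
  fix m :: "'v \<Rightarrow>\<^sub>0 nat"
  have "m - single v (lookup m v) + single v (lookup m v) = m"
    by (rule poly_mapping_eqI) (auto simp: lookup_add lookup_minus lookup_single when_def)
  with arg_cong[OF assms[of "lookup m v"], of "\<lambda>p. lookup p (m - single v (lookup m v))"]
  show "lookup f m = lookup g m" by (simp add: lookup_coeff_in lookup_minus)
qed

lemma coeff_in_expand:
  fixes f :: "('v, 'k::comm_ring_1) mpoly"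
  assumes "deg_in v f \<le> n"
  shows "f = (\<Sum>d\<le>n. coeff_in v d f * Var v ^ d)"
proof (rule coeff_in_ext[of v])
  fix i
  have "coeff_in v i (\<Sum>d\<le>n. coeff_in v d f * Var v ^ d) = (\<Sum>d\<le>n. if d = i then coeff_in v i f else 0)"
    unfolding coeff_in_sum
    by (rule sum.cong) (auto simp: coeff_in_mult_notin coeff_in_Var_power)
  also have "\<dots> = coeff_in v i f"
    using assms coeff_in_above_deg[of v f i] by (auto simp: sum.delta')
  finally show "coeff_in v i f = coeff_in v i (\<Sum>d\<le>n. coeff_in v d f * Var v ^ d)" ..
qed

lemma coeff_in_mult_top:
  fixes f g :: "('v, 'k::comm_ring_1) mpoly"
  assumes "deg_in v f \<le> a" "deg_in v g \<le> b"
  shows "coeff_in v (a + b) (f * g) = coeff_in v a f * coeff_in v b g"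
proof -
  have "coeff_in v (a + b) (f * g) = (\<Sum>i\<le>a + b. if i = a then coeff_in v a f * coeff_in v b g else 0)"
    unfolding coeff_in_mult
  proof (rule sum.cong[OF refl])
    fix i assume i: "i \<in> {..a + b}"
    consider "i < a" | "i = a" | "i > a" by linarith
    then show "coeff_in v i f * coeff_in v (a + b - i) g =
        (if i = a then coeff_in v a f * coeff_in v b g else 0)"
    proof cases
      case 1
      then have "deg_in v g < a + b - i" using assms by linarith
      with 1 show ?thesis by (simp add: coeff_in_above_deg)
    next
      case 3
      then have "deg_in v f < i" using assms by linarith
      with 3 show ?thesis by (simp add: coeff_in_above_deg)
    qed auto
  qed
  then show ?thesis by simp
qed

lemma deg_in_mult_le:
  "deg_in v (f * g) \<le> deg_in v f + deg_in v g" for f g :: "('v, 'k::comm_ring_1) mpoly"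
  unfolding deg_in_le_iff[of v "f * g"]
proof (intro allI impI)
  fix d assume d: "deg_in v f + deg_in v g < d"
  show "coeff_in v d (f * g) = 0"
    unfolding coeff_in_mult
  proof (rule sum.neutral, rule ballI)
    fix i assume "i \<in> {..d}"
    with d have "deg_in v f < i \<or> deg_in v g < d - i" by auto
    then show "coeff_in v i f * coeff_in v (d - i) g = 0" by (auto simp: coeff_in_above_deg)
  qed
qed

lemma deg_in_add_le:
  "deg_in v f \<le> n \<Longrightarrow> deg_in v g \<le> n \<Longrightarrow> deg_in v (f + g) \<le> n"
  for f :: "('v, 'k::comm_monoid_add) mpoly"
  by (auto simp: deg_in_le_iff coeff_in_add)

lemma deg_in_diff_le:
  "deg_in v f \<le> n \<Longrightarrow> deg_in v g \<le> n \<Longrightarrow> deg_in v (f - g) \<le> n" for f :: "('v, 'k::ab_group_add) mpoly"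
  by (auto simp: deg_in_le_iff coeff_in_diff)

lemma deg_in_sum_le: "(\<And>x. x \<in> X \<Longrightarrow> deg_in v (p x) \<le> n) \<Longrightarrow> deg_in v (\<Sum>x\<in>X. p x) \<le> n"
  by (induction X rule: infinite_finite_induct) (auto intro: deg_in_add_le)

lemma lookup_Const_mult: "lookup (Const c * f) m = c * lookup f m"
  for f :: "('v, 'k::comm_ring_1) mpoly"
  by (simp add: Const_def map.rep_eq when_def flip: mult_map_scale_conv_mult)

lemma coeff_in_Var:
  "coeff_in v d (Var v :: ('v, 'k::comm_ring_1) mpoly) = (if d = 1 then 1 else 0)"
  using coeff_in_Var_power[of v d 1, where 'k = 'k] by simp

lemma deg_in_less_if_coeff_0:
  assumes "deg_in v f \<le> d" "coeff_in v d f = 0" "0 < d"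
  shows "deg_in v f < d"
proof -
  have "deg_in v f \<le> d - 1"
    unfolding deg_in_le_iff
  proof (intro allI impI)
    fix e assume "d - 1 < e"
    with assms show "coeff_in v e f = 0" by (cases "e = d") (simp_all add: coeff_in_above_deg)
  qed
  with assms(3) show ?thesis by simp
qed

lemma lookup_le_deg_in: "m \<in> keys f \<Longrightarrow> lookup m v \<le> deg_in v f"
  by (auto simp: deg_in_def intro!: Max_ge)

lemma deg_in_coeff_in_le: "deg_in u (coeff_in v d f) \<le> deg_in u f"
proof (cases "u = v")
  case False
  have "coeff_in u e (coeff_in v d f) = coeff_in v d (coeff_in u e f)" for e
    using False
    by (intro poly_mapping_eqI) (auto simp: lookup_coeff_in lookup_add lookup_single when_def ac_simps)
  then show ?thesis by (simp add: deg_in_le_iff coeff_in_above_deg)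
qed (simp add: deg_in_notin)

text \<open>There is no order on the variables that would single out a leading monomial. Instead the
  induction runs over a finite set containing the variables of both factors: the leading
  coefficients in one variable lie in the remaining ones, and their product is the top coefficient
  of the zero product.\<close>

lemma mpoly_no_zero_divisors:
  fixes f g :: "('v, 'k::idom) mpoly"
  assumes "f * g = 0"
  shows "f = 0 \<or> g = 0"
proof -
  have "f = 0 \<or> g = 0" if "finite W" "f \<in> poly_in W" "g \<in> poly_in W" "f * g = 0" for W
    and f g :: "('v, 'k) mpoly"
    using that
  proof (induction W arbitrary: f g rule: finite_induct)
    case empty
    then obtain a b where "f = Const a" "g = Const b"
      by (auto simp: poly_in_def vars_empty_iff)
    with empty show ?case by (auto simp flip: Const_mult)
  next
    case (insert v W)
    show ?case
    proof (rule ccontr)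
      assume *: "\<not> (f = 0 \<or> g = 0)"
      let ?a = "coeff_in v (deg_in v f) f" and ?b = "coeff_in v (deg_in v g) g"
      have "?a * ?b = coeff_in v (deg_in v f + deg_in v g) (f * g)"
        by (rule coeff_in_mult_top[symmetric]) auto
      also have "\<dots> = 0" using insert.prems by simp
      finally have "?a * ?b = 0" .
      moreover have "?a \<in> poly_in W" "?b \<in> poly_in W"
        using poly_in_coeff_in[of _ "insert v W" v] insert.prems insert.hyps by auto
      ultimately have "?a = 0 \<or> ?b = 0" using insert.IH by blast
      then show False using * lead_coeff_in_nonzero[of f v] lead_coeff_in_nonzero[of g v] by simp
    qed
  qed
  from this[of "vars f \<union> vars g" f g] assms show ?thesis by (auto simp: poly_in_def)
qed

lemma mpoly_mult_eq_0_iff [simp]: "f * g = 0 \<longleftrightarrow> f = 0 \<or> g = 0"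
  for f g :: "('v, 'k::idom) mpoly"
  using mpoly_no_zero_divisors by auto

lemma mpoly_power_eq_0_iff [simp]: "f ^ n = 0 \<longleftrightarrow> f = 0 \<and> n > 0" for f :: "('v, 'k::idom) mpoly"
  by (induction n) auto

lemma mpoly_mult_left_cancel:
  "h \<noteq> 0 \<Longrightarrow> h * f = h * g \<longleftrightarrow> f = g" for f g h :: "('v, 'k::idom) mpoly"
  using mpoly_mult_eq_0_iff[of h "f - g"] by (auto simp: right_diff_distrib)

lemma deg_in_mult:
  fixes f g :: "('v, 'k::idom) mpoly"
  assumes "f \<noteq> 0" "g \<noteq> 0"
  shows "deg_in v (f * g) = deg_in v f + deg_in v g"
proof (rule antisym[OF deg_in_mult_le le_deg_in])
  show "coeff_in v (deg_in v f + deg_in v g) (f * g) \<noteq> 0"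
    using assms by (subst coeff_in_mult_top) (simp_all add: lead_coeff_in_nonzero)
qed

lemma vars_mult_eq:
  fixes f g :: "('v, 'k::idom) mpoly"
  assumes "f \<noteq> 0" "g \<noteq> 0"
  shows "vars (f * g) = vars f \<union> vars g"
  using deg_in_mult[OF assms] by (auto simp flip: deg_in_pos_iff)

lemma dvd_poly_in:
  fixes f g :: "('v, 'k::idom) mpoly"
  assumes "g dvd f" "f \<noteq> 0" "f \<in> poly_in W"
  shows "g \<in> poly_in W"
proof -
  from assms obtain h where "f = g * h" by (elim dvdE)
  with assms vars_mult_eq[of g h] show ?thesis by (auto simp: poly_in_def)
qed

lemma mpoly_dvd_1_iff:
  fixes f :: "('v, 'k::field) mpoly"
  shows "f dvd 1 \<longleftrightarrow> f \<noteq> 0 \<and> vars f = {}"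
proof
  assume "f dvd 1"
  then have "f \<in> poly_in {}" by (rule dvd_poly_in) auto
  with \<open>f dvd 1\<close> show "f \<noteq> 0 \<and> vars f = {}" by (auto simp: poly_in_def)
next
  assume *: "f \<noteq> 0 \<and> vars f = {}"
  then obtain c where c: "f = Const c" by (auto simp: vars_empty_iff)
  with * have "f * Const (1 / c) = 1" by (simp flip: Const_mult)
  then show "f dvd 1" by (metis dvd_triv_left)
qed

text \<open>At degree \<open>e + Suc n\<close> both products have the same coefficient, so they
  cancel there. The step is kept apart from the division because \<open>reduce_bounded\<close>
  repeats it while tracking exponents.\<close>

lemma pseudo_division_step:
  fixes f g :: "('v, 'k::comm_ring_1) mpoly"
  assumes g: "deg_in v g = Suc e" and f: "deg_in v f \<le> e + Suc n"
  shows "deg_in v (coeff_in v (Suc e) g * f - coeff_in v (e + Suc n) f * Var v ^ n * g) \<le> e + n"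
  unfolding deg_in_le_iff
proof (intro allI impI)
  fix d assume d: "e + n < d"
  let ?a = "coeff_in v (Suc e) g" and ?b = "coeff_in v (e + Suc n) f"
  have "coeff_in v d (?a * f - ?b * Var v ^ n * g) =
      ?a * coeff_in v d f - ?b * coeff_in v d (g * Var v ^ n)"
    by (simp add: coeff_in_diff coeff_in_mult_notin mult.assoc mult.commute[of "Var v ^ n"])
  also have "\<dots> = 0"
  proof (cases "d = e + Suc n")
    case True
    then show ?thesis by (simp add: coeff_in_mult_Var_power mult.commute)
  next
    case False
    with d f g show ?thesis by (auto simp: coeff_in_mult_Var_power coeff_in_above_deg)
  qed
  finally show "coeff_in v d (?a * f - ?b * Var v ^ n * g) = 0" .
qed

text \<open>The exponent n comes from any bound on the degree of f, not from f itself, so several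
  polynomials can be divided with one common power of the leading coefficient.\<close>

lemma pseudo_division:
  fixes f g :: "('v, 'k::comm_ring_1) mpoly"
  assumes g: "deg_in v g = Suc e" and W: "f \<in> poly_in W" "g \<in> poly_in W" "v \<in> W"
    and deg: "deg_in v f \<le> e + n"
  shows "\<exists>q r. coeff_in v (Suc e) g ^ n * f = q * g + r \<and> deg_in v r \<le> e \<and>
    q \<in> poly_in W \<and> r \<in> poly_in W"
  using W(1) deg
proof (induction n arbitrary: f)
  case 0
  then show ?case by (intro exI[of _ 0] exI[of _ f]) auto
next
  case (Suc n)
  define a where "a = coeff_in v (Suc e) g"
  define b where "b = coeff_in v (e + Suc n) f"
  define f' where "f' = a * f - b * Var v ^ n * g"
  have aW: "a \<in> poly_in W" and bW: "b \<in> poly_in W"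
    unfolding a_def b_def
    by (rule poly_in_mono[OF poly_in_coeff_in Diff_subset], fact W Suc.prems)+
  have f'W: "f' \<in> poly_in W"
    unfolding f'_def using aW bW W Suc.prems
    by (auto intro!: poly_in_diff poly_in_mult poly_in_power poly_in_Var)
  have "deg_in v f' \<le> e + n"
    unfolding f'_def a_def b_def by (rule pseudo_division_step[OF g Suc.prems(2)])
  from Suc.IH[OF f'W this] obtain q r where qr: "a ^ n * f' = q * g + r" "deg_in v r \<le> e"
    "q \<in> poly_in W" "r \<in> poly_in W" unfolding a_def by blast
  have "a ^ Suc n * f = a ^ n * f' + a ^ n * b * Var v ^ n * g"
    by (simp add: f'_def algebra_simps)
  also have "\<dots> = (q + a ^ n * b * Var v ^ n) * g + r"
    unfolding qr(1) by (simp add: algebra_simps)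
  finally show ?case
    using qr aW bW W unfolding a_def[symmetric]
    by (intro exI[of _ "q + a ^ n * b * Var v ^ n"] exI[of _ r])
      (auto intro!: poly_in_add poly_in_mult poly_in_power poly_in_Var)
qed

subsection \<open>Unique factorization\<close>

text \<open>The sum of the degrees in the separate variables rather than the total degree. It is
  additive on nonzero products, vanishes exactly on constants, and bounds every exponent, which
  serves both for induction on factorizations and for counting monomials.\<close>

definition mdeg :: "('v, 'k::zero) mpoly \<Rightarrow> nat" where
  "mdeg f = (\<Sum>v\<in>vars f. deg_in v f)"

lemma mdeg_mult:
  fixes f g :: "('v, 'k::idom) mpoly"
  assumes "f \<noteq> 0" "g \<noteq> 0"
  shows "mdeg (f * g) = mdeg f + mdeg g"
proof -
  have *: "mdeg h = (\<Sum>v\<in>vars f \<union> vars g. deg_in v h)" if "vars h \<subseteq> vars f \<union> vars g"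
    for h :: "('v, 'k) mpoly"
    unfolding mdeg_def by (rule sum.mono_neutral_left) (use that in \<open>auto simp: deg_in_notin\<close>)
  show ?thesis
    using assms by (simp add: * vars_mult_eq deg_in_mult sum.distrib)
qed

lemma mdeg_eq_0_iff: "mdeg f = 0 \<longleftrightarrow> vars f = {}"
  unfolding mdeg_def by (auto simp flip: deg_in_pos_iff)

lemma irreducible_factor_exists:
  fixes f :: "('v, 'k::field) mpoly"
  assumes "f \<noteq> 0" "vars f \<noteq> {}"
  shows "\<exists>p. irreducible p \<and> p dvd f"
  using assms
proof (induction "mdeg f" arbitrary: f rule: less_induct)
  case less
  show ?case
  proof (cases "irreducible f")
    case False
    with less.prems obtain a b where ab: "f = a * b" "\<not> a dvd 1" "\<not> b dvd 1"
      by (auto simp: irreducible_def mpoly_dvd_1_iff)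
    with less.prems have nz: "a \<noteq> 0" "b \<noteq> 0" by auto
    with ab have v: "vars a \<noteq> {}" "vars b \<noteq> {}" by (auto simp: mpoly_dvd_1_iff)
    then have "mdeg a < mdeg f"
      using nz by (auto simp: ab(1) mdeg_mult mdeg_eq_0_iff[symmetric])
    from less.hyps[OF this nz(1) v(1)] obtain p where "irreducible p" "p dvd a" by blast
    with ab(1) show ?thesis by (intro exI[of _ p]) auto
  qed auto
qed

text \<open>Irreducible factors are peeled off c one at a time, each going to q or to r. Primality
  of these factors is a hypothesis because the lemma is used inside the induction that establishes
  primality, at a moment when it is known only for factors in fewer variables.\<close>

lemma split_dvd_mult:
  fixes c q r :: "('v, 'k::field) mpoly"
  assumes prime: "\<And>p g h. irreducible p \<Longrightarrow> p dvd c \<Longrightarrow> g \<in> poly_in X \<Longrightarrow> h \<in> poly_in X \<Longrightarrow>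
      p dvd g * h \<Longrightarrow> p dvd g \<or> p dvd h"
    and "c \<noteq> 0" "q \<in> poly_in X" "r \<in> poly_in X" "c dvd q * r"
  shows "\<exists>c1 c2. c = c1 * c2 \<and> c1 dvd q \<and> c2 dvd r"
  using assms
proof (induction "mdeg c" arbitrary: c q r rule: less_induct)
  case less
  consider "q = 0" | "r = 0" | "vars c = {}" | "q \<noteq> 0" "r \<noteq> 0" "vars c \<noteq> {}" by blast
  then show ?case
  proof cases
    case 1
    then show ?thesis by (intro exI[of _ c] exI[of _ 1]) auto
  next
    case 2
    then show ?thesis by (intro exI[of _ 1] exI[of _ c]) auto
  next
    case 3
    then have "c dvd q" using less.prems(2) by (metis dvd_mult_left mpoly_dvd_1_iff dvd_trans one_dvd)
    then show ?thesis by (intro exI[of _ c] exI[of _ 1]) auto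
  next
    case 4
    from irreducible_factor_exists[OF less.prems(2) 4(3)] obtain p c' where
      p: "irreducible p" and c: "c = p * c'" by (auto elim!: dvdE)
    from c less.prems(2) have nz: "p \<noteq> 0" "c' \<noteq> 0" by auto
    have "\<not> p dvd 1" using p by (simp add: irreducible_def)
    with nz have "mdeg p \<noteq> 0" by (simp add: mdeg_eq_0_iff mpoly_dvd_1_iff)
    with nz have "mdeg c' < mdeg c" by (simp add: c mdeg_mult)
    note IH = less.hyps[OF this _ nz(2)]
    have pr: "\<And>p' g h. irreducible p' \<Longrightarrow> p' dvd c' \<Longrightarrow> g \<in> poly_in X \<Longrightarrow> h \<in> poly_in X \<Longrightarrow>
      p' dvd g * h \<Longrightarrow> p' dvd g \<or> p' dvd h"
      using less.prems(1) unfolding c by (meson dvd_mult)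
    have "p dvd q \<or> p dvd r"
      using less.prems(1)[OF p _ less.prems(3,4)] less.prems(5) unfolding c
      by (meson dvd_mult_left dvd_triv_left)
    then show ?thesis
    proof
      assume "p dvd q"
      then obtain q' where q: "q = p * q'" by (elim dvdE)
      with less.prems(3) 4(1) have "q' \<in> poly_in X" by (metis dvd_poly_in dvd_triv_right)
      moreover have "c' dvd q' * r"
        using less.prems(5) nz unfolding c q
        by (auto simp: dvd_def mult.assoc mpoly_mult_left_cancel)
      ultimately obtain c1 c2 where "c' = c1 * c2" "c1 dvd q'" "c2 dvd r"
        using IH[OF pr _ less.prems(4)] by blast
      then show ?thesis
        by (intro exI[of _ "p * c1"] exI[of _ c2]) (auto simp: c q mult.assoc mult_dvd_mono)
    next
      assume "p dvd r"
      then obtain r' where r: "r = p * r'" by (elim dvdE)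
      with less.prems(4) 4(2) have "r' \<in> poly_in X" by (metis dvd_poly_in dvd_triv_right)
      moreover have "c' dvd q * r'"
        using less.prems(5) nz unfolding c r
        by (auto simp: dvd_def mult.assoc mult.left_commute[of q p] mpoly_mult_left_cancel)
      ultimately obtain c1 c2 where "c' = c1 * c2" "c1 dvd q" "c2 dvd r'"
        using IH[OF pr less.prems(3)] by blast
      then show ?thesis
        by (intro exI[of _ c1] exI[of _ "p * c2"]) (auto simp: c r mult.left_commute mult_dvd_mono)
    qed
  qed
qed

lemma dvd_iff_dvd_coeff_in:
  fixes p f :: "('v, 'k::comm_ring_1) mpoly"
  assumes "v \<notin> vars p"
  shows "p dvd f \<longleftrightarrow> (\<forall>d. p dvd coeff_in v d f)"
proof
  assume "p dvd f"
  then show "\<forall>d. p dvd coeff_in v d f"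
    using assms by (auto simp: coeff_in_mult_notin)
next
  assume *: "\<forall>d. p dvd coeff_in v d f"
  show "p dvd f"
    by (subst coeff_in_expand[OF order_refl, of f v]) (use * in \<open>auto intro!: dvd_sum dvd_mult2\<close>)
qed

lemma irreducible_dvd_notin:
  fixes f c :: "('v, 'k::field) mpoly"
  assumes "irreducible f" "v \<in> vars f" "c dvd f" "v \<notin> vars c"
  shows "c dvd 1"
proof -
  from assms(3) obtain u where u: "f = c * u" by (elim dvdE)
  have "u dvd 1 \<Longrightarrow> v \<notin> vars f"
    using assms(1,4) vars_mult[of c u] u by (auto simp: mpoly_dvd_1_iff)
  with irreducibleD[OF assms(1) u] assms(2) show ?thesis by blast
qed

text \<open>
  Gauss: an irreducible polynomial of positive degree in \<open>v\<close> divides, up to factors free of \<open>v\<close>,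
  a combination \<open>a f + b g\<close> of least degree in \<open>v\<close>; those factors are handled by the induction
  hypothesis.
\<close>

lemma irreducible_prime_poly_in:
  fixes p :: "('v, 'k::field) mpoly"
  assumes "finite W" "irreducible p" "p \<in> poly_in W" "g \<in> poly_in W" "h \<in> poly_in W" "p dvd g * h"
  shows "p dvd g \<or> p dvd h"
  using assms
proof (induction W arbitrary: p g h rule: finite_induct)
  case empty
  then have "p dvd 1" by (auto simp: poly_in_def mpoly_dvd_1_iff irreducible_def)
  with empty show ?case by (simp add: irreducible_def)
next
  case (insert v W)
  let ?R = "poly_in (insert v W) :: ('v, 'k) mpoly set"
  have inR: "f \<in> ?R" if "f \<in> poly_in W" for f using poly_in_mono[OF that] by blast
  have coW: "coeff_in v d f \<in> poly_in W" if "f \<in> ?R" for d f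
    using poly_in_coeff_in[OF that, of v d] insert.hyps(2) by simp
  have inW: "f \<in> poly_in W" if "f \<in> ?R" "v \<notin> vars f" for f
    using that by (auto simp: poly_in_def)
  have notin: "v \<notin> vars f" if "f \<in> poly_in W" for f :: "('v, 'k) mpoly"
    using that insert.hyps(2) by (auto simp: poly_in_def)
  \<comment> \<open>For p free of v: take the least i and j at which p fails to divide the
    coefficients of g and h. In the coefficient of the product at \<open>i + j\<close> every other
    term is divisible by p, so p divides the product of these two, against the induction
    hypothesis.\<close>
  have gauss: "p dvd g \<or> p dvd h"
    if p: "irreducible p" "p \<in> poly_in W" and gh: "g \<in> ?R" "h \<in> ?R" "p dvd g * h" for p g h
  proof (rule ccontr)
    note pv = notin[OF p(2)]
    assume "\<not> (p dvd g \<or> p dvd h)"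
    then have ex: "\<exists>i. \<not> p dvd coeff_in v i g" "\<exists>j. \<not> p dvd coeff_in v j h"
      using dvd_iff_dvd_coeff_in[OF pv] by blast+
    define i where "i = (LEAST i. \<not> p dvd coeff_in v i g)"
    define j where "j = (LEAST j. \<not> p dvd coeff_in v j h)"
    have i: "\<not> p dvd coeff_in v i g" "\<And>i'. i' < i \<Longrightarrow> p dvd coeff_in v i' g"
      unfolding i_def using LeastI_ex[OF ex(1)] not_less_Least by blast+
    have j: "\<not> p dvd coeff_in v j h" "\<And>j'. j' < j \<Longrightarrow> p dvd coeff_in v j' h"
      unfolding j_def using LeastI_ex[OF ex(2)] not_less_Least by blast+
    have "p dvd coeff_in v (i + j) (g * h)"
      using gh(3) dvd_iff_dvd_coeff_in[OF pv] by blast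
    also have "coeff_in v (i + j) (g * h) = coeff_in v i g * coeff_in v j h +
        (\<Sum>k\<in>{..i + j} - {i}. coeff_in v k g * coeff_in v (i + j - k) h)"
      unfolding coeff_in_mult by (subst sum.remove[of _ i]) auto
    finally have "p dvd coeff_in v i g * coeff_in v j h"
    proof (rule dvd_add_left_iff[THEN iffD1, rotated])
      show "p dvd (\<Sum>k\<in>{..i + j} - {i}. coeff_in v k g * coeff_in v (i + j - k) h)"
      proof (rule dvd_sum)
        fix k assume k: "k \<in> {..i + j} - {i}"
        then have "k < i \<or> i + j - k < j" by auto
        then show "p dvd coeff_in v k g * coeff_in v (i + j - k) h"
          using i(2) j(2) by (auto intro: dvd_mult dvd_mult2)
      qed
    qed
    with insert.IH[OF p coW[OF gh(1)] coW[OF gh(2)]] i(1) j(1) show False by blast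
  qed
  have split: "\<exists>c1 c2. c = c1 * c2 \<and> c1 dvd q \<and> c2 dvd r"
    if c: "c \<noteq> 0" "c \<in> poly_in W" and qr: "q \<in> ?R" "r \<in> ?R" "c dvd q * r" for c q r
    by (rule split_dvd_mult[OF _ c(1) qr]) (use gauss dvd_poly_in[OF _ c] in blast)
  show ?case
  proof (cases "v \<in> vars p")
    case False
    with gauss inW insert.prems show ?thesis by blast
  next
    case True
    have pz: "p \<noteq> 0" using insert.prems(1) by auto
    \<comment> \<open>A factor c free of v can be cancelled: c splits between p and the cofactor y,
      and the part dividing the irreducible p is a unit because p involves v.\<close>
    have canc: "p dvd x" if c: "c \<noteq> 0" "c \<in> poly_in W" and x: "x \<in> ?R" "p dvd c * x" for c x
    proof (cases "x = 0")
      case False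
      from x(2) obtain y where y: "c * x = p * y" by (elim dvdE)
      have "c * x \<in> ?R" using poly_in_mult[OF inR[OF c(2)] x(1)] .
      moreover have "c * x \<noteq> 0" using False c(1) by simp
      ultimately have "y \<in> ?R" by (intro dvd_poly_in[of y "c * x"]) (simp_all add: y)
      moreover have "c dvd p * y" by (simp flip: y)
      ultimately obtain c1 c2 where c12: "c = c1 * c2" "c1 dvd p" "c2 dvd y"
        using split[OF c insert.prems(2)] by blast
      have "c1 \<in> poly_in W" using dvd_poly_in[OF _ c, of c1] c12 by simp
      with irreducible_dvd_notin[OF insert.prems(1) True c12(2)] notin have "c1 dvd 1" by blast
      then have "c dvd y" using c12 by (metis dvd_trans mult_dvd_mono mult_1_left)
      then obtain z where "y = c * z" by (elim dvdE)
      with y c(1) have "x = p * z"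
        using mpoly_mult_left_cancel[OF c(1), of x "p * z"] by (simp add: ac_simps)
      then show ?thesis by simp
    qed simp
    have "p dvd h" if ng: "\<not> p dvd g"
    proof -
      \<comment> \<open>The nonzero elements of the ideal generated by p and g; one of least degree
        in v plays the role of a greatest common divisor up to factors free of v.\<close>
      define S where "S = {r. r \<noteq> 0 \<and> (\<exists>a\<in>?R. \<exists>b\<in>?R. r = a * p + b * g)}"
      have "p = 1 * p + 0 * g" by simp
      then have "p \<in> S" unfolding S_def using pz poly_in_0 poly_in_1 by blast
      then obtain r where r: "r \<in> S" "\<And>s. s \<in> S \<Longrightarrow> deg_in v r \<le> deg_in v s"
        using ex_has_least_nat[of "\<lambda>r. r \<in> S" p "deg_in v"] by blast
      then obtain a b where ab: "a \<in> ?R" "b \<in> ?R" "r = a * p + b * g" "r \<noteq> 0" by (auto simp: S_def)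
      have rR: "r \<in> ?R" using ab insert.prems by (auto intro!: poly_in_add poly_in_mult)
      show ?thesis
      proof (cases "v \<in> vars r")
        case False
        have "r * h = p * (a * h) + b * (g * h)" by (simp add: ab(3) algebra_simps)
        then have "p dvd r * h" using insert.prems(5) by (auto intro!: dvd_add dvd_mult)
        then show ?thesis
          by (rule canc[OF ab(4) inW[OF rR False] insert.prems(4)])
      next
        case rv: True
        then obtain e where e: "deg_in v r = Suc e" using deg_in_pos_iff[of v r] gr0_implies_Suc by blast
        define l where "l = coeff_in v (Suc e) r"
        have l: "l \<noteq> 0" "l \<in> poly_in W"
          using lead_coeff_in_nonzero[OF ab(4), of v] coW[OF rR] by (simp_all add: l_def e)
        \<comment> \<open>The pseudo-remainder of a combination of p and g by r is again such a
          combination and has smaller degree, so minimality of r makes it zero.\<close>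
        have div: "\<exists>q\<in>?R. l ^ deg_in v x * x = q * r"
          if "x \<in> ?R" "a' \<in> ?R" "b' \<in> ?R" "x = a' * p + b' * g" for x a' b'
        proof -
          from pseudo_division[OF e that(1) rR, of "deg_in v x"] obtain q s where
            qs: "l ^ deg_in v x * x = q * r + s" "deg_in v s \<le> e" "q \<in> ?R" "s \<in> ?R"
            by (auto simp: l_def)
          have "s = l ^ deg_in v x * x - q * r" by (simp add: qs(1))
          also have "\<dots> = (l ^ deg_in v x * a' - q * a) * p + (l ^ deg_in v x * b' - q * b) * g"
            unfolding that(4) ab(3) by (simp add: algebra_simps)
          finally have s: "s = (l ^ deg_in v x * a' - q * a) * p + (l ^ deg_in v x * b' - q * b) * g" .
          have "s = 0"
          proof (rule ccontr)
            assume "s \<noteq> 0"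
            moreover have "l ^ deg_in v x * a' - q * a \<in> ?R" "l ^ deg_in v x * b' - q * b \<in> ?R"
              using that ab qs inR[OF l(2)] by (auto intro!: poly_in_diff poly_in_mult poly_in_power)
            ultimately have "s \<in> S" unfolding S_def using s by blast
            with r(2) qs(2) e show False by fastforce
          qed
          with qs show ?thesis by auto
        qed
        obtain q where q: "q \<in> ?R" "l ^ deg_in v p * p = q * r"
          using div[of p 1 0] insert.prems(2) by auto
        obtain q' where q': "l ^ deg_in v g * g = q' * r"
          using div[of g 0 1] insert.prems(3) by auto
        obtain c1 c2 where c: "l ^ deg_in v p = c1 * c2" "c1 dvd q" "c2 dvd r"
          using split[of "l ^ deg_in v p" q r] l q rR by (metis dvd_triv_left mpoly_power_eq_0_iff poly_in_power)
        then obtain q1 r1 where qr1: "q = c1 * q1" "r = c2 * r1" by (auto elim!: dvdE)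
        have c0: "c1 * c2 \<noteq> 0" using l by (simp flip: c(1))
        have "c1 * c2 * p = c1 * c2 * (q1 * r1)" using q(2) by (simp add: c(1) qr1 ac_simps)
        then have pqr: "p = q1 * r1" using mpoly_mult_left_cancel[OF c0] by blast
        \<comment> \<open>Since r involves v and \<open>c2\<close> does not, \<open>r1\<close> is
          not a unit; in the factorization \<open>p = q1 * r1\<close> the unit must be
          \<open>q1\<close>.\<close>
        have "p dvd r1"
        proof -
          have "\<not> r1 dvd 1"
          proof
            assume "r1 dvd 1"
            moreover have "c2 \<in> poly_in W"
              using dvd_poly_in[of c2 "c1 * c2" W] c0 poly_in_power[OF l(2), of "deg_in v p"]
              by (simp add: c(1))
            ultimately have "v \<notin> vars r"
              using notin vars_mult[of c2 r1] by (auto simp: qr1 mpoly_dvd_1_iff)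
            with rv show False by blast
          qed
          with irreducibleD[OF insert.prems(1) pqr] have "q1 dvd 1" by blast
          then obtain t where t: "1 = q1 * t" by (elim dvdE)
          have "p * t = (q1 * t) * r1" by (simp add: pqr ac_simps)
          then have "r1 = p * t" by (simp flip: t)
          then show ?thesis by simp
        qed
        then have "p dvd l ^ deg_in v g * g" unfolding q' qr1 by (intro dvd_mult)
        then have "p dvd g"
          using canc[of "l ^ deg_in v g" g] l insert.prems(3) by (auto intro: poly_in_power)
        with ng show ?thesis by blast
      qed
    qed
    then show ?thesis by blast
  qed
qed

text \<open>The form in which unique factorization enters. It is applied with c the initial of an
  element of a canonical set, whose factor dividing that element is then constant by
  canonicity.\<close>

lemma dvd_mult_split:
  fixes c q r :: "('v, 'k::field) mpoly"
  assumes "c \<noteq> 0" "c dvd q * r"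
  shows "\<exists>c1 c2. c = c1 * c2 \<and> c1 dvd q \<and> c2 dvd r"
proof (rule split_dvd_mult[OF _ assms(1) poly_in_mono[OF poly_in_vars subset_UNIV]
    poly_in_mono[OF poly_in_vars subset_UNIV] assms(2)])
  fix p g h :: "('v, 'k) mpoly"
  assume "irreducible p" "p dvd g * h"
  then show "p dvd g \<or> p dvd h"
    using irreducible_prime_poly_in[of "vars p \<union> vars g \<union> vars h" p g h]
    by (auto simp: poly_in_def)
qed

subsection \<open>Derivations and differential ideals\<close>

lemma lookup_partial:
  "lookup (partial v f) m = of_nat (Suc (lookup m v)) * lookup f (m + single v 1)"
proof -
  have eq: "(m = n - single v 1 \<and> lookup n v > 0) \<longleftrightarrow> n = m + single v 1" for n
  proof
    assume *: "m = n - single v 1 \<and> lookup n v > 0"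
    show "n = m + single v 1"
      by (rule poly_mapping_eqI) (use * in \<open>auto simp: lookup_add lookup_minus lookup_single when_def\<close>)
  qed (auto simp: lookup_add)
  have "lookup (partial v f) m =
      (\<Sum>n\<in>keys f. if n = m + single v 1 then of_nat (lookup n v) * lookup f n else 0)"
    unfolding partial_def lookup_sum
  proof (rule sum.cong[OF refl])
    fix n
    show "lookup (single (n - single v 1) (of_nat (lookup n v) * lookup f n)) m =
        (if n = m + single v 1 then of_nat (lookup n v) * lookup f n else 0)"
      using eq[of n] by (cases "lookup n v = 0") (auto simp: lookup_single when_def)
  qed
  also have "\<dots> = of_nat (Suc (lookup m v)) * lookup f (m + single v 1)"
    by (subst sum.delta) (auto simp: in_keys_iff lookup_add)
  finally show ?thesis .
qed

lemma partial_0 [simp]: "partial v 0 = 0"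
  by (rule poly_mapping_eqI) (simp add: lookup_partial)

lemma partial_add: "partial v (f + g) = partial v f + partial v g"
  by (rule poly_mapping_eqI) (simp add: lookup_partial lookup_add algebra_simps)

lemma partial_diff: "partial v (f - g) = partial v f - partial v g"
  for f g :: "('v, 'k::comm_ring_1) mpoly"
  by (rule poly_mapping_eqI) (simp add: lookup_partial lookup_minus algebra_simps)

lemma partial_single:
  "partial v (single m c) = single (m - single v 1) (of_nat (lookup m v) * c)"
  by (cases "c = 0") (simp_all add: partial_def)

lemma partial_mult:
  fixes f g :: "('v, 'k::comm_ring_1) mpoly"
  shows "partial v (f * g) = partial v f * g + f * partial v g"
proof (induction f rule: poly_mapping_mono_induct)
  case (single m a)
  show ?case
  proof (induction g rule: poly_mapping_mono_induct)
    case (single n b)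
    have 1: "m - single v 1 + n = m + n - single v 1" if "lookup m v > 0"
      by (rule poly_mapping_eqI) (use that in \<open>auto simp: lookup_add lookup_minus lookup_single when_def\<close>)
    have 2: "m + (n - single v 1) = m + n - single v 1" if "lookup n v > 0"
      by (rule poly_mapping_eqI) (use that in \<open>auto simp: lookup_add lookup_minus lookup_single when_def\<close>)
    have "partial v (single m a * single n b) =
        single (m + n - single v 1) (of_nat (lookup m v) * a * b) +
        single (m + n - single v 1) (a * (of_nat (lookup n v) * b))"
      by (simp add: mult_single partial_single lookup_add algebra_simps flip: single_add)
    also have "single (m + n - single v 1) (of_nat (lookup m v) * a * b) =
        partial v (single m a) * single n b"
      using 1 by (cases "lookup m v = 0") (simp_all add: partial_single mult_single)
    also have "single (m + n - single v 1) (a * (of_nat (lookup n v) * b)) =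
        single m a * partial v (single n b)"
      using 2 by (cases "lookup n v = 0") (simp_all add: partial_single mult_single)
    finally show ?case .
  qed (simp_all add: partial_add algebra_simps)
qed (simp_all add: partial_add algebra_simps)

lemma partial_notin: "v \<notin> vars f \<Longrightarrow> partial v f = 0"
  for f :: "('v, 'k::comm_semiring_1) mpoly"
proof (rule poly_mapping_eqI)
  fix m :: "'v \<Rightarrow>\<^sub>0 nat" assume "v \<notin> vars f"
  moreover have "v \<in> keys (m + single v 1)" by (simp add: in_keys_iff lookup_add)
  ultimately have "m + single v 1 \<notin> keys f" using in_varsI by metis
  then show "lookup (partial v f) m = lookup 0 m" by (simp add: lookup_partial in_keys_iff)
qed

lemma partial_Const [simp]: "partial v (Const c) = 0"
  and partial_1 [simp]: "partial v (1 :: ('v, 'k::comm_ring_1) mpoly) = 0"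
  by (simp_all add: partial_notin)

lemma partial_Var: "partial v (Var w :: ('v, 'k::comm_ring_1) mpoly) = (if w = v then 1 else 0)"
proof (cases "w = v")
  case True
  then show ?thesis by (simp add: Var_def partial_single)
qed (simp add: partial_notin)

lemma vars_partial: "vars (partial v f) \<subseteq> vars f"
proof -
  have "keys m \<subseteq> vars f" if "m \<in> keys (partial v f)" for m
  proof -
    from that have "m + single v 1 \<in> keys f"
      by (auto simp: in_keys_iff lookup_partial)
    moreover have "keys m \<subseteq> keys (m + single v 1)" by (auto simp: in_keys_iff lookup_add)
    ultimately show ?thesis using in_varsI by fast
  qed
  then show ?thesis by (auto simp: vars_def)
qed

lemma poly_in_partial: "f \<in> poly_in W \<Longrightarrow> partial v f \<in> poly_in W"
  using vars_partial[of v f] by (auto simp: poly_in_def)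

lemma partial_nonzero:
  fixes f :: "('v, 'k::field_char_0) mpoly"
  assumes "v \<in> vars f"
  shows "partial v f \<noteq> 0"
proof
  from assms obtain m where m: "m \<in> keys f" "lookup m v > 0" by (auto simp: vars_def in_keys_iff)
  have eq: "m - single v 1 + single v 1 = m"
    by (rule poly_mapping_eqI) (use m(2) in \<open>auto simp: lookup_add lookup_minus lookup_single when_def\<close>)
  assume "partial v f = 0"
  then have "lookup (partial v f) (m - single v 1) = 0" by simp
  then have "of_nat (Suc (lookup (m - single v 1) v)) * lookup f m = 0"
    by (simp only: lookup_partial eq)
  then have "lookup f m = 0" by (simp del: of_nat_Suc)
  with m(1) show False by (simp add: in_keys_iff)
qed

lemma lookup_of_nat_mult: "lookup (of_nat n * f) m = of_nat n * lookup f m"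
  for f :: "('v, 'k::comm_ring_1) mpoly"
  by (induction n) (simp_all add: lookup_add algebra_simps)

lemma coeff_in_partial:
  "coeff_in v d (partial v f) = of_nat (Suc d) * coeff_in v (Suc d) f"
  for f :: "('v, 'k::comm_ring_1) mpoly"
  by (rule poly_mapping_eqI)
    (simp add: lookup_of_nat_mult lookup_coeff_in lookup_partial lookup_add add.assoc
      del: of_nat_Suc flip: single_add)

lemma deg_in_partial_same: "0 < deg_in v f \<Longrightarrow> deg_in v (partial v f) < deg_in v f"
  for f :: "('v, 'k::comm_ring_1) mpoly"
  using deg_in_le_iff[of v "partial v f" "deg_in v f - 1"]
  by (auto simp: coeff_in_partial coeff_in_above_deg)

lemma coeff_in_partial_other:
  "u \<noteq> v \<Longrightarrow> coeff_in u d (partial v f) = partial v (coeff_in u d f)"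
  for f :: "('v, 'k::comm_ring_1) mpoly"
  by (rule poly_mapping_eqI)
    (auto simp: lookup_coeff_in lookup_partial lookup_add lookup_single when_def ac_simps)

lemma deg_in_partial_other: "u \<noteq> v \<Longrightarrow> deg_in u (partial v f) \<le> deg_in u f"
  for f :: "('v, 'k::comm_ring_1) mpoly"
  by (simp add: deg_in_le_iff coeff_in_partial_other coeff_in_above_deg)

lemma deg_in_partial_le: "deg_in u (partial v f) \<le> deg_in u f"
  for f :: "('v, 'k::comm_ring_1) mpoly"
  using deg_in_partial_same[of v f] deg_in_partial_other[of u v f] deg_in_pos_iff[of v f]
    partial_notin[of v f] by (cases "u = v"; cases "v \<in> vars f") auto

section \<open>Extension of the derivations to differential polynomials\<close>

locale differential_ring =
  fixes D :: "'d \<Rightarrow> 'k::field_char_0 \<Rightarrow> 'k"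
  assumes commuting: "commuting_derivations D"
begin

lemma D_add: "D i (a + b) = D i a + D i b"
  and D_mult: "D i (a * b) = D i a * b + a * D i b"
  and D_comm: "D i (D j a) = D j (D i a)"
  using commuting unfolding commuting_derivations_def by blast+

lemma D_0 [simp]: "D i 0 = 0"
  using D_add[of i 0 0] by simp

lemma D_1 [simp]: "D i 1 = 0"
  using D_mult[of i 1 1] by simp

text \<open>Enlarging both sums to common finite index sets lets the derivatives of f, g and
  \<open>f + g\<close> be compared term by term.\<close>

lemma dderiv_alt:
  assumes "finite V" "vars f \<subseteq> V" "finite K" "keys f \<subseteq> K"
  shows "dderiv D i f =
    (\<Sum>m\<in>K. single m (D i (lookup f m))) + (\<Sum>v\<in>V. partial v f * Var (dapp {#i#} v))"
proof -
  have "(\<Sum>m\<in>keys f. single m (D i (lookup f m))) = (\<Sum>m\<in>K. single m (D i (lookup f m)))"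
    by (rule sum.mono_neutral_left) (use assms in \<open>auto simp: in_keys_iff\<close>)
  moreover have "(\<Sum>v\<in>vars f. partial v f * Var (dapp {#i#} v)) =
      (\<Sum>v\<in>V. partial v f * (Var (dapp {#i#} v) :: ('d, 'a, 'k) dpoly))"
    by (rule sum.mono_neutral_left) (use assms in \<open>auto simp: partial_notin\<close>)
  ultimately show ?thesis by (simp add: dderiv_def)
qed

lemma dderiv_0 [simp]: "dderiv D i 0 = 0"
  by (simp add: dderiv_def)

lemma dderiv_add: "dderiv D i (f + g) = dderiv D i f + dderiv D i g"
proof -
  let ?V = "vars f \<union> vars g" and ?K = "keys f \<union> keys g"
  have "vars (f + g) \<subseteq> ?V" "keys (f + g) \<subseteq> ?K" by (fact vars_add keys_add)+
  then have "dderiv D i (f + g) = (\<Sum>m\<in>?K. single m (D i (lookup (f + g) m))) +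
      (\<Sum>v\<in>?V. partial v (f + g) * Var (dapp {#i#} v))"
    by (intro dderiv_alt) auto
  moreover have "dderiv D i f = (\<Sum>m\<in>?K. single m (D i (lookup f m))) +
      (\<Sum>v\<in>?V. partial v f * Var (dapp {#i#} v))"
    by (intro dderiv_alt) auto
  moreover have "dderiv D i g = (\<Sum>m\<in>?K. single m (D i (lookup g m))) +
      (\<Sum>v\<in>?V. partial v g * Var (dapp {#i#} v))"
    by (intro dderiv_alt) auto
  ultimately show ?thesis
    by (simp add: lookup_add D_add partial_add single_add sum.distrib algebra_simps)
qed

lemma dderiv_single:
  "dderiv D i (single m c) =
    single m (D i c) + (\<Sum>v\<in>keys m. partial v (single m c) * Var (dapp {#i#} v))"
proof -
  have "dderiv D i (single m c) = (\<Sum>n\<in>{m}. single n (D i (lookup (single m c) n))) +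
    (\<Sum>v\<in>keys m. partial v (single m c) * Var (dapp {#i#} v))"
    by (rule dderiv_alt) (auto simp: vars_def)
  then show ?thesis by simp
qed

lemma dderiv_mult: "dderiv D i (f * g) = dderiv D i f * g + f * dderiv D i g"
proof (induction f rule: poly_mapping_mono_induct)
  case (single m a)
  show ?case
  proof (induction g rule: poly_mapping_mono_induct)
    case (single n b)
    let ?V = "keys m \<union> keys n"
    let ?d = "\<lambda>f. \<Sum>v\<in>?V. partial v f * (Var (dapp {#i#} v) :: ('d, 'a, 'k) dpoly)"
    have *: "dderiv D i (single l c) = single l (D i c) + ?d (single l c)"
      if "keys l \<subseteq> ?V" for l c
    proof -
      have "dderiv D i (single l c) = (\<Sum>n\<in>{l}. single n (D i (lookup (single l c) n))) + ?d (single l c)"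
        by (rule dderiv_alt) (use that in \<open>auto simp: vars_def\<close>)
      then show ?thesis by simp
    qed
    have "dderiv D i (single m a * single n b) =
        single (m + n) (D i (a * b)) + ?d (single m a * single n b)"
      unfolding mult_single by (rule *) (rule keys_add)
    also have "?d (single m a * single n b) = ?d (single m a) * single n b + single m a * ?d (single n b)"
      by (simp add: partial_mult sum.distrib sum_distrib_left sum_distrib_right algebra_simps)
    also have "single (m + n) (D i (a * b)) =
        single m (D i a) * single n b + single m a * single n (D i b)"
      by (simp add: D_mult mult_single single_add)
    finally show ?case
      by (simp add: * algebra_simps)
  qed (simp_all add: dderiv_add algebra_simps)
qed (simp_all add: dderiv_add algebra_simps)

lemma dderiv_Const: "dderiv D i (Const c) = Const (D i c)"
  using dderiv_single[of i 0 c] by (simp add: Const_def)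

lemma dderiv_1 [simp]: "dderiv D i 1 = 0"
  using dderiv_Const[of i 1] by simp

lemma dderiv_Var: "dderiv D i (Var v) = Var (dapp {#i#} v)"
  using dderiv_single[of i "single v 1" 1] by (simp add: Var_def partial_single)

lemma dderiv_power: "dderiv D i (f ^ n) = of_nat n * f ^ (n - 1) * dderiv D i f"
proof (induction n)
  case (Suc n)
  then show ?case by (cases n) (simp_all add: dderiv_mult algebra_simps)
qed simp

lemma vars_dderiv: "vars (dderiv D i f) \<subseteq> vars f \<union> dapp {#i#} ` vars f"
proof -
  have "vars (\<Sum>m\<in>keys f. single m (D i (lookup f m))) \<subseteq> vars f"
    using vars_sum[of "\<lambda>m. single m (D i (lookup f m))" "keys f"] by (fastforce simp: vars_def split: if_splits)
  moreover have "vars (\<Sum>v\<in>vars f. partial v f * (Var (dapp {#i#} v) :: ('d, 'a, 'k) dpoly)) \<subseteq>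
      vars f \<union> dapp {#i#} ` vars f"
    by (rule order_trans[OF vars_sum] UN_least order_trans[OF vars_mult])+
      (use vars_partial in \<open>fastforce\<close>)
  ultimately show ?thesis
    unfolding dderiv_def by (intro order_trans[OF vars_add]) auto
qed

lemma diff_idealD:
  assumes "diff_ideal D J"
  shows "0 \<in> J" "f \<in> J \<Longrightarrow> g \<in> J \<Longrightarrow> f + g \<in> J" "f \<in> J \<Longrightarrow> g * f \<in> J" "f \<in> J \<Longrightarrow> f * g \<in> J"
    "f \<in> J \<Longrightarrow> dderiv D i f \<in> J"
  using assms unfolding diff_ideal_def by (auto simp: mult.commute[of f g])

lemma diff_ideal_uminus: "diff_ideal D J \<Longrightarrow> f \<in> J \<Longrightarrow> - f \<in> J"
  using diff_idealD(3)[of J f "- 1"] by simp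

lemma diff_ideal_diff: "diff_ideal D J \<Longrightarrow> f \<in> J \<Longrightarrow> g \<in> J \<Longrightarrow> f - g \<in> J"
  using diff_idealD(2)[of J f "- g"] diff_ideal_uminus[of J g] by simp

lemma diff_ideal_sum: "diff_ideal D J \<Longrightarrow> (\<And>x. x \<in> X \<Longrightarrow> p x \<in> J) \<Longrightarrow> (\<Sum>x\<in>X. p x) \<in> J"
  by (induction X rule: infinite_finite_induct) (auto intro: diff_idealD)

lemma diff_ideal_mod_iff: "diff_ideal D J \<Longrightarrow> f - g \<in> J \<Longrightarrow> f \<in> J \<longleftrightarrow> g \<in> J"
  using diff_ideal_diff[of J f "f - g"] diff_idealD(2)[of J "f - g" g] by auto

lemma diff_ideal_Const:
  assumes "diff_ideal D J" "Const c \<in> J" "c \<noteq> 0"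
  shows "1 \<in> J"
  using diff_idealD(3)[OF assms(1,2), of "Const (1 / c)"] assms(3) by (simp flip: Const_mult)

text \<open>Differentiating \<open>f ^ Suc a * f' ^ b\<close> and multiplying by f' trades one
  factor f for two factors f', up to a multiple of the original element. After n trades only
  \<open>2 * n\<close> factors f' remain. Removing the factor \<open>Suc a\<close> uses
  characteristic zero.\<close>

lemma radical_dderiv:
  assumes J: "diff_ideal D J" and "f ^ n \<in> J"
  shows "dderiv D i f ^ (2 * n) \<in> J"
proof -
  let ?f' = "dderiv D i f"
  have step: "f ^ a * ?f' ^ (b + 2) \<in> J" if "f ^ Suc a * ?f' ^ b \<in> J" for a b
  proof -
    have "?f' * dderiv D i (f ^ Suc a * ?f' ^ b) \<in> J"
      using diff_idealD(3)[OF J diff_idealD(5)[OF J that]] .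
    moreover have "?f' * dderiv D i (f ^ Suc a * ?f' ^ b) =
        of_nat (Suc a) * (f ^ a * ?f' ^ (b + 2)) + f ^ Suc a * (of_nat b * (?f' * ?f' ^ (b - 1))) * dderiv D i ?f'"
      unfolding dderiv_mult dderiv_power[of i f "Suc a"] dderiv_power[of i ?f'] diff_Suc_1
      by (simp add: algebra_simps del: of_nat_Suc)
    moreover have "of_nat b * (?f' * ?f' ^ (b - 1)) = of_nat b * ?f' ^ b"
      by (cases b) simp_all
    moreover have "f ^ Suc a * (of_nat b * ?f' ^ b) * dderiv D i ?f' \<in> J"
      using diff_idealD(4)[OF J that, of "of_nat b * dderiv D i ?f'"] by (simp add: ac_simps)
    ultimately have "of_nat (Suc a) * (f ^ a * ?f' ^ (b + 2)) \<in> J"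
      using diff_ideal_mod_iff[OF J, of "?f' * dderiv D i (f ^ Suc a * ?f' ^ b)"
          "of_nat (Suc a) * (f ^ a * ?f' ^ (b + 2))"] by simp
    then have "Const (1 / of_nat (Suc a)) * (of_nat (Suc a) * (f ^ a * ?f' ^ (b + 2))) \<in> J"
      by (rule diff_idealD(3)[OF J])
    moreover have "Const (1 / of_nat (Suc a)) * of_nat (Suc a) = (1 :: ('d, 'a, 'k) dpoly)"
      by (simp flip: Const_of_nat Const_mult del: of_nat_Suc)
    ultimately show ?thesis by (simp only: mult.assoc[symmetric] mult_1_left)
  qed
  have "f ^ (n - k) * ?f' ^ (2 * k) \<in> J" if "k \<le> n" for k
    using that
  proof (induction k)
    case (Suc k)
    then show ?case using step[of "n - Suc k" "2 * k"] by (simp add: Suc_diff_Suc)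
  qed (use assms(2) in simp)
  from this[of n] show ?thesis by simp
qed

lemma diff_ideal_radical:
  assumes J: "diff_ideal D J"
  shows "diff_ideal D {f. \<exists>n. f ^ n \<in> J}"
proof -
  have mono: "f ^ m \<in> J" if "f ^ n \<in> J" "n \<le> m" for f m n
    using diff_idealD(3)[OF J that(1), of "f ^ (m - n)"] that(2) by (simp flip: power_add)
  show ?thesis
    unfolding diff_ideal_def
  proof (intro conjI ballI allI; unfold mem_Collect_eq; (elim exE)?)
    show "\<exists>n. 0 ^ n \<in> J" using diff_idealD(1)[OF J] by (intro exI[of _ 1]) simp
  next
    fix f g n m assume fg: "f ^ n \<in> J" "g ^ m \<in> J"
    have "(f + g) ^ (n + m) \<in> J"
      unfolding binomial_ring
    proof (rule diff_ideal_sum[OF J])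
      fix k assume k: "k \<in> {..n + m}"
      consider "n \<le> k" | "m \<le> n + m - k" by linarith
      then have "f ^ k * g ^ (n + m - k) \<in> J"
        using mono[OF fg(1), of k] mono[OF fg(2), of "n + m - k"] diff_idealD[OF J] by cases blast+
      then show "of_nat (n + m choose k) * f ^ k * g ^ (n + m - k) \<in> J"
        using diff_idealD(3)[OF J, of _ "of_nat (n + m choose k)"] by (metis mult.assoc)
    qed
    then show "\<exists>n. (f + g) ^ n \<in> J" by blast
  next
    fix f n g assume "f ^ n \<in> J"
    then have "(g * f) ^ n \<in> J" using diff_idealD(3)[OF J] by (simp add: power_mult_distrib)
    then show "\<exists>n. (g * f) ^ n \<in> J" by blast
  next
    fix f n i assume "f ^ n \<in> J"
    then show "\<exists>n. dderiv D i f ^ n \<in> J" using radical_dderiv[OF J] by blast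
  qed
qed

section \<open>Prime and minimal prime differential ideals\<close>

lemma prime_diff_idealD:
  assumes "prime_diff_ideal D P"
  shows "diff_ideal D P" "1 \<notin> P" "f * g \<in> P \<Longrightarrow> f \<in> P \<or> g \<in> P" "f ^ n \<in> P \<Longrightarrow> f \<in> P"
proof -
  show 1: "diff_ideal D P" "1 \<notin> P" "f * g \<in> P \<Longrightarrow> f \<in> P \<or> g \<in> P" for f g
    using assms unfolding prime_diff_ideal_def by blast+
  show "f ^ n \<in> P \<Longrightarrow> f \<in> P"
    by (induction n) (use 1 in auto)
qed

text \<open>A differential ideal maximal among those avoiding a multiplicative set is radical, because
  its radical is again differential, and then its colon ideals are differential as well.\<close>

lemma prime_diff_ideal_avoiding:
  assumes I: "diff_ideal D I" and S: "1 \<in> S" "\<And>f g. f \<in> S \<Longrightarrow> g \<in> S \<Longrightarrow> f * g \<in> S"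
    and disj: "I \<inter> S = {}"
  shows "\<exists>Q. prime_diff_ideal D Q \<and> I \<subseteq> Q \<and> Q \<inter> S = {}"
proof -
  let ?A = "{J. diff_ideal D J \<and> I \<subseteq> J \<and> J \<inter> S = {}}"
  have "\<exists>M\<in>?A. \<forall>X\<in>?A. M \<subseteq> X \<longrightarrow> X = M"
  proof (rule subset_Zorn_nonempty)
    show "?A \<noteq> {}" using I disj by blast
  next
    fix C assume C: "C \<noteq> {}" "subset.chain ?A C"
    then have mem: "diff_ideal D J" "I \<subseteq> J" "J \<inter> S = {}" if "J \<in> C" for J
      using that by (auto simp: subset_chain_def)
    have "\<exists>J\<in>C. f \<in> J \<and> g \<in> J" if "f \<in> \<Union>C" "g \<in> \<Union>C" for f g
    proof -
      from that obtain J K where JK: "J \<in> C" "f \<in> J" "K \<in> C" "g \<in> K" by blast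
      with C(2) have "J \<subseteq> K \<or> K \<subseteq> J" by (auto simp: subset_chain_def)
      with JK show ?thesis by blast
    qed
    note two = this
    have "diff_ideal D (\<Union>C)"
      unfolding diff_ideal_def
    proof (intro conjI ballI allI)
      show "0 \<in> \<Union>C" using C(1) diff_idealD(1)[OF mem(1)] by auto
      show "f + g \<in> \<Union>C" if "f \<in> \<Union>C" "g \<in> \<Union>C" for f g
      proof -
        from two[OF that] obtain J where "J \<in> C" "f \<in> J" "g \<in> J" by blast
        then show ?thesis using diff_idealD(2)[OF mem(1)] by blast
      qed
      show "g * f \<in> \<Union>C" if "f \<in> \<Union>C" for f g
        using that diff_idealD(3)[OF mem(1)] by auto
      show "dderiv D i f \<in> \<Union>C" if "f \<in> \<Union>C" for f i
        using that diff_idealD(5)[OF mem(1)] by auto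
    qed
    then show "\<Union>C \<in> ?A" using C(1) mem by blast
  qed
  then obtain M where MA: "M \<in> ?A" and maxA: "\<forall>X\<in>?A. M \<subseteq> X \<longrightarrow> X = M" ..
  from MA have M: "diff_ideal D M" "I \<subseteq> M" "M \<inter> S = {}" by simp_all
  have max: "X = M" if "diff_ideal D X" "M \<subseteq> X" "X \<inter> S = {}" for X
    using maxA that M(2) by simp
  have Spow: "f ^ n \<in> S" if "f \<in> S" for f n by (induction n) (use S that in auto)
  have "{f. \<exists>n. f ^ n \<in> M} = M"
  proof (rule max[OF diff_ideal_radical[OF M(1)]])
    show "M \<subseteq> {f. \<exists>n. f ^ n \<in> M}" by (auto intro: exI[of _ 1])
    show "{f. \<exists>n. f ^ n \<in> M} \<inter> S = {}" using Spow M(3) by blast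
  qed
  then have rad: "f \<in> M" if "f ^ n \<in> M" for f n using that by blast
  define colon where "colon g = {x. x * g \<in> M}" for g
  have colon: "diff_ideal D (colon g)" "M \<subseteq> colon g" for g
  proof -
    have "dderiv D i x * g \<in> M" if x: "x * g \<in> M" for x i
    proof -
      \<comment> \<open>Expanding this product by the Leibniz rule leaves the square of
        \<open>dderiv D i x * g\<close> modulo M, and M is radical.\<close>
      have "dderiv D i x * g * dderiv D i (x * g) \<in> M"
        by (intro diff_idealD(3,5)[OF M(1)] x)
      moreover have "dderiv D i x * g * dderiv D i (x * g) =
          (dderiv D i x * g)\<^sup>2 + (dderiv D i x * dderiv D i g) * (x * g)"
        by (simp add: dderiv_mult algebra_simps power2_eq_square)
      moreover have "(dderiv D i x * dderiv D i g) * (x * g) \<in> M" by (intro diff_idealD(3)[OF M(1)] x)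
      ultimately have "(dderiv D i x * g)\<^sup>2 \<in> M"
        using diff_ideal_mod_iff[OF M(1), of "dderiv D i x * g * dderiv D i (x * g)"
            "(dderiv D i x * g)\<^sup>2"] by simp
      then show ?thesis by (rule rad)
    qed
    then show "diff_ideal D (colon g)"
      using diff_idealD(1-3)[OF M(1)] unfolding diff_ideal_def colon_def
      by (auto simp: distrib_right mult.assoc)
    show "M \<subseteq> colon g" using diff_idealD(4)[OF M(1)] by (auto simp: colon_def)
  qed
  have "f \<in> M \<or> g \<in> M" if fg: "f * g \<in> M" for f g
  proof (rule ccontr)
    assume n: "\<not> (f \<in> M \<or> g \<in> M)"
    from fg have "f \<in> colon g" by (simp add: colon_def)
    with n have "colon g \<noteq> M" by blast
    \<comment> \<open>A strictly larger colon ideal meets S. First \<open>colon g\<close> contains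
      some s of S; then \<open>colon s\<close> contains g, so it is larger than M too and contains
      some t of S. Thus \<open>t * s\<close> lies in both M and S.\<close>
    with max[OF colon[of g]] obtain s where s: "s \<in> S" "s * g \<in> M" by (auto simp: colon_def)
    then have "g \<in> colon s" by (simp add: colon_def mult.commute)
    with n have "colon s \<noteq> M" by blast
    with max[OF colon[of s]] obtain t where "t \<in> S" "t * s \<in> M" by (auto simp: colon_def)
    with s S M(3) show False by blast
  qed
  moreover have "1 \<notin> M" using S(1) M(3) by blast
  ultimately have "prime_diff_ideal D M" using M(1) by (simp add: prime_diff_ideal_def)
  with M show ?thesis by blast
qed

lemma minimal_prime_below:
  assumes Q: "prime_diff_ideal D Q" "I \<subseteq> Q"
  shows "\<exists>P\<in>minimal_primes D I. P \<subseteq> Q"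
proof -
  \<comment> \<open>Complements turn the search for a minimal prime into one for a maximal set:
    unions of chains of complements correspond to intersections of chains of primes.\<close>
  let ?A = "uminus ` {P. prime_diff_ideal D P \<and> I \<subseteq> P \<and> P \<subseteq> Q}"
  have "\<exists>M\<in>?A. \<forall>X\<in>?A. M \<subseteq> X \<longrightarrow> X = M"
  proof (rule subset_Zorn_nonempty)
    show "?A \<noteq> {}" using Q by blast
  next
    fix C assume C: "C \<noteq> {}" "subset.chain ?A C"
    define N where "N = - \<Union>C"
    have mem: "prime_diff_ideal D (- X)" "I \<subseteq> - X" "- X \<subseteq> Q" if "X \<in> C" for X
      using that C(2) by (auto simp: subset_chain_def)
    have N: "f \<in> N \<longleftrightarrow> (\<forall>X\<in>C. f \<in> - X)" for f by (auto simp: N_def)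
    have "diff_ideal D N"
      using diff_idealD(1,2,3,5)[OF prime_diff_idealD(1)[OF mem(1)]] unfolding diff_ideal_def
      by (auto simp: N)
    moreover have "1 \<notin> N" using C(1) prime_diff_idealD(2)[OF mem(1)] unfolding N by blast
    moreover have "f \<in> N \<or> g \<in> N" if fg: "f * g \<in> N" for f g
    proof (rule ccontr)
      assume "\<not> (f \<in> N \<or> g \<in> N)"
      then obtain X Y where XY: "X \<in> C" "f \<notin> - X" "Y \<in> C" "g \<notin> - Y" unfolding N by blast
      then have "X \<subseteq> Y \<or> Y \<subseteq> X" using C(2) by (auto simp: subset_chain_def)
      then obtain Z where "Z \<in> C" "f \<notin> - Z" "g \<notin> - Z" using XY by blast
      with fg prime_diff_idealD(3)[OF mem(1)[of Z]] show False unfolding N by blast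
    qed
    ultimately have "prime_diff_ideal D N" by (simp add: prime_diff_ideal_def)
    moreover have "I \<subseteq> N" unfolding subset_iff N using mem(2) by blast
    moreover have "N \<subseteq> Q"
    proof -
      from C(1) obtain X where "X \<in> C" by blast
      with mem(3)[OF this] show ?thesis by (auto simp: N)
    qed
    ultimately have "- N \<in> ?A" by blast
    then show "\<Union>C \<in> ?A" by (simp add: N_def)
  qed
  then obtain M where MA: "M \<in> ?A" and max: "\<forall>X\<in>?A. M \<subseteq> X \<longrightarrow> X = M" ..
  from MA obtain P where M: "M = - P"
    and P': "P \<in> {P. prime_diff_ideal D P \<and> I \<subseteq> P \<and> P \<subseteq> Q}" by (rule imageE)
  from P' have P: "prime_diff_ideal D P" "I \<subseteq> P" "P \<subseteq> Q" by simp_all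
  have min: "X = P" if "prime_diff_ideal D X" "I \<subseteq> X" "X \<subseteq> P" for X
  proof -
    have "- X \<in> ?A" using that P(3) by blast
    with max that(3) show ?thesis by (auto simp: M)
  qed
  have "P \<in> minimal_primes D I" unfolding minimal_primes_def using P min by simp
  with P(3) show ?thesis ..
qed

text \<open>The products of powers of w with elements outside P form a multiplicative set. It misses
  I because w can be cancelled modulo I and I lies in P. A prime avoiding this set lies inside P,
  hence equals P by minimality, and it does not contain w.\<close>

lemma minimal_prime_regular:
  assumes I: "diff_ideal D I" and P: "P \<in> minimal_primes D I"
    and w: "\<And>f. w * f \<in> I \<Longrightarrow> f \<in> I"
  shows "w \<notin> P"
proof -
  have Pp: "prime_diff_ideal D P" "I \<subseteq> P"
    and min: "\<And>Q. prime_diff_ideal D Q \<Longrightarrow> I \<subseteq> Q \<Longrightarrow> Q \<subseteq> P \<Longrightarrow> Q = P"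
    using P by (auto simp: minimal_primes_def)
  define S where "S = {w ^ n * g | n g. g \<notin> P}"
  have wn: "f \<in> I" if "w ^ n * f \<in> I" for n f
    using that by (induction n) (auto simp: mult.assoc intro: w)
  have in_S: "w ^ n * g \<in> S" if "g \<notin> P" for n g using that by (auto simp: S_def)
  have "\<exists>Q. prime_diff_ideal D Q \<and> I \<subseteq> Q \<and> Q \<inter> S = {}"
  proof (rule prime_diff_ideal_avoiding[OF I])
    show "1 \<in> S" using in_S[of 1 0] prime_diff_idealD(2)[OF Pp(1)] by simp
    show "f * g \<in> S" if "f \<in> S" "g \<in> S" for f g
    proof -
      from that obtain n a m b where "f = w ^ n * a" "g = w ^ m * b" "a \<notin> P" "b \<notin> P"
        by (auto simp: S_def)
      then show ?thesis using in_S[of "a * b" "n + m"] prime_diff_idealD(3)[OF Pp(1), of a b]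
        by (auto simp: power_add ac_simps)
    qed
    show "I \<inter> S = {}" using wn Pp(2) by (auto simp: S_def)
  qed
  then obtain Q where Q: "prime_diff_ideal D Q" "I \<subseteq> Q" "Q \<inter> S = {}" by blast
  have "Q \<subseteq> P" using Q(3) in_S[of _ 0] by auto
  with min Q have "Q = P" by blast
  moreover have "w \<in> S" using in_S[of 1 1] prime_diff_idealD(2)[OF Pp(1)] by simp
  ultimately show ?thesis using Q(3) by blast
qed

end

subsection \<open>Autoreduced and characteristic sets\<close>

lemma dapp_empty [simp]: "dapp {#} v = v"
  and snd_dapp [simp]: "snd (dapp a v) = snd v"
  and dapp_eq_self_iff: "dapp a v = v \<longleftrightarrow> a = {#}"
  by (auto simp: dapp_def prod_eq_iff)

locale ranked =
  fixes le :: "('d, 'l) dvar \<Rightarrow> ('d, 'l) dvar \<Rightarrow> bool"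
  assumes is_ranking: "ranking le"
begin

lemma le_refl [simp]: "le u u"
  and le_antisym: "le u v \<Longrightarrow> le v u \<Longrightarrow> u = v"
  and le_trans: "le u v \<Longrightarrow> le v w \<Longrightarrow> le u w"
  and le_total: "le u v \<or> le v u"
  and le_dapp: "le u (dapp \<theta> u)"
  and dapp_mono: "le v u \<Longrightarrow> le (dapp \<theta> v) (dapp \<theta> u)"
proof -
  have lin: "linear_order {(u, v). le u v}"
    and 1: "\<forall>\<theta> u. le u (dapp \<theta> u)" "\<forall>\<theta> u v. le v u \<longrightarrow> le (dapp \<theta> v) (dapp \<theta> u)"
    using is_ranking by (auto simp: ranking_def)
  have r: "refl {(u, v). le u v}" and t: "trans {(u, v). le u v}"
    and a: "antisym {(u, v). le u v}" and tot: "total {(u, v). le u v}"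
    using lin by (auto simp: linear_order_on_def partial_order_on_def preorder_on_def)
  show refl: "le u u" for u using reflD[OF r, of u] by simp
  have "\<forall>x y. x \<noteq> y \<longrightarrow> le x y \<or> le y x"
    using tot unfolding total_on_def by (simp only: UNIV_I mem_Collect_eq case_prod_conv simp_thms Ball_def)
  then show "le u v \<or> le v u" using refl by (cases "u = v") blast+
  show "le u v \<Longrightarrow> le v u \<Longrightarrow> u = v" using antisymD[OF a, of u v] by simp
  show "le u v \<Longrightarrow> le v w \<Longrightarrow> le u w" using transD[OF t, of u v w] by simp
  show "le u (dapp \<theta> u)" "le v u \<Longrightarrow> le (dapp \<theta> v) (dapp \<theta> u)" using 1 by blast+
qed

lemma leader_eqI: "u \<in> vars f \<Longrightarrow> (\<And>v. v \<in> vars f \<Longrightarrow> le v u) \<Longrightarrow> leader le f = u"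
  unfolding leader_def by (rule the_equality) (auto intro: le_antisym)

lemma leader:
  assumes "f \<notin> range Const"
  shows "leader le f \<in> vars f" "v \<in> vars f \<Longrightarrow> le v (leader le f)"
proof -
  have "\<exists>u\<in>X. \<forall>v\<in>X. le v u" if "finite X" "X \<noteq> {}" for X
    using that
  proof (induction X rule: finite_ne_induct)
    case (insert x X)
    then obtain u where u: "u \<in> X" "\<forall>v\<in>X. le v u" by blast
    show ?case
    proof (cases "le x u")
      case False
      then have "le u x" using le_total by blast
      with u(2) have "\<forall>v\<in>insert x X. le v x" using le_trans le_refl by blast
      then show ?thesis by blast
    qed (use u in auto)
  qed auto
  from this[of "vars f"] obtain u where u: "u \<in> vars f" "\<forall>v\<in>vars f. le v u"
    using assms vars_empty_iff[of f] by auto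
  then have "leader le f = u" by (intro leader_eqI) blast+
  with u show "leader le f \<in> vars f" "v \<in> vars f \<Longrightarrow> le v (leader le f)"
    by simp_all
qed

lemma deg_leader_pos: "f \<notin> range Const \<Longrightarrow> 0 < deg_in (leader le f) f"
  by (simp only: deg_in_pos_iff leader(1) not_False_eq_True)

lemma initial_nonzero: "f \<noteq> 0 \<Longrightarrow> initial le f \<noteq> 0"
  by (simp add: initial_def lead_coeff_in_nonzero)

lemma vars_initial: "vars (initial le f) \<subseteq> vars f - {leader le f}"
  unfolding initial_def by (rule vars_coeff_in)

lemma rank_less_irrefl: "\<not> rank_less le r r"
  by (simp add: rank_less_def)

lemma rank_less_total: "rank_less le r s \<or> r = s \<or> rank_less le s r"
  using le_total[of "fst r" "fst s"] by (auto simp: rank_less_def prod_eq_iff)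

lemma rank_eqD:
  assumes "rank le f = rank le g"
  shows "leader le f = leader le g" "deg_in (leader le g) f = deg_in (leader le g) g"
proof -
  show l: "leader le f = leader le g" using arg_cong[OF assms, of fst] by (simp add: rank_def)
  show "deg_in (leader le g) f = deg_in (leader le g) g"
    using arg_cong[OF assms, of snd] unfolding rank_def snd_conv l .
qed

lemma reduced_cong_rank:
  assumes "rank le g = rank le h"
  shows "reduced le f g \<longleftrightarrow> reduced le f h"
  unfolding reduced_def rank_eqD[OF assms] ..

lemma reduced_by_higher:
  assumes f: "f \<notin> range Const" and g: "g \<notin> range Const"
    and less: "rank_less le (rank le g) (rank le f)" and red: "reduced le f g"
  shows "reduced le g f"
proof -
  have ne: "leader le g \<noteq> leader le f"
    using less red by (auto simp: rank_less_def rank_def reduced_def)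
  then have lt: "le (leader le g) (leader le f)" using less by (auto simp: rank_less_def rank_def)
  have "dapp \<theta> (leader le f) \<notin> vars g" for \<theta>
  proof
    assume "dapp \<theta> (leader le f) \<in> vars g"
    then have "le (leader le f) (leader le g)"
      using leader(2)[OF g] le_trans le_dapp by blast
    with lt ne le_antisym show False by blast
  qed
  from this this[of "{#}"] show ?thesis
    using deg_leader_pos[OF f] by (simp add: reduced_def deg_in_notin)
qed

text \<open>Keeping the elements of rank below f, appending f and dropping the rest gives an
  autoreduced set of lower rank: either f replaces an element of higher rank, or nothing was dropped
  and the longer list is the lower one.\<close>

lemma char_set_reduced_False:
  assumes A: "char_set le I A" and f: "f \<in> I" "f \<notin> range Const"
    and red: "\<And>g. g \<in> set A \<Longrightarrow> reduced le f g"
  shows False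
proof -
  define A' where "A' = takeWhile (\<lambda>g. rank_less le (rank le g) (rank le f)) A"
  define B where "B = A' @ [f]"
  have auto_A: "set A \<inter> range Const = {}" "\<And>f g. f \<in> set A \<Longrightarrow> g \<in> set A \<Longrightarrow> f \<noteq> g \<Longrightarrow> reduced le f g"
    "sorted_wrt (\<lambda>f g. rank_less le (rank le f) (rank le g)) A" "set A \<subseteq> I"
    using A unfolding char_set_def autoreduced_def by blast+
  have A': "g \<in> set A \<and> rank_less le (rank le g) (rank le f)" if "g \<in> set A'" for g
    using that set_takeWhileD unfolding A'_def by metis
  have "sorted_wrt (\<lambda>f g. rank_less le (rank le f) (rank le g)) A'"
    using auto_A(3) takeWhile_dropWhile_id sorted_wrt_append unfolding A'_def by metis
  then have "sorted_wrt (\<lambda>f g. rank_less le (rank le f) (rank le g)) B"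
    using A' by (simp add: B_def sorted_wrt_append)
  moreover have "reduced le g f" if "g \<in> set A'" for g
    using reduced_by_higher[OF f(2), of g] A'[OF that] auto_A(1) red by blast
  then have "\<forall>g\<in>set B. \<forall>h\<in>set B. g \<noteq> h \<longrightarrow> reduced le g h"
    using auto_A(2) A' red unfolding B_def by auto
  moreover have "set B \<inter> range Const = {}" using f(2) auto_A(1) A' unfolding B_def by auto
  ultimately have "autoreduced le B" unfolding autoreduced_def by blast
  moreover have "set B \<subseteq> I" using auto_A(4) A' f(1) by (auto simp: B_def)
  moreover have "lower_rank le B A"
  proof -
    have len: "length A' \<le> length A" unfolding A'_def by (rule length_takeWhile_le)
    have nth: "A' ! i = A ! i" if "i < length A'" for i
      using that unfolding A'_def by (rule takeWhile_nth)
    have agree: "\<forall>i<length A'. rank le (B ! i) = rank le (A ! i)"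
      using nth by (simp add: B_def nth_append)
    show ?thesis
    proof (cases "length A' < length A")
      case True
      then have "\<not> rank_less le (rank le (A ! length A')) (rank le f)"
        unfolding A'_def by (rule nth_length_takeWhile)
      moreover have "rank le (A ! length A') \<noteq> rank le f"
      proof
        assume "rank le (A ! length A') = rank le f"
        from rank_eqD[OF this] show False
          using red[OF nth_mem[OF True]] by (simp add: reduced_def)
      qed
      ultimately have "rank_less le (rank le (B ! length A')) (rank le (A ! length A'))"
        using rank_less_total by (fastforce simp: B_def)
      with True agree show ?thesis unfolding lower_rank_def by (auto simp: B_def)
    next
      case False
      with len have "length A' = length A" by simp
      with agree show ?thesis unfolding lower_rank_def by (auto simp: B_def)
    qed
  qed
  ultimately show False using A unfolding char_set_def by blast
qed

text \<open>Ranks are totally ordered, so at a first difference one of the two sets would be lower.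
  Consequently leaders, their degrees and the set of non-leaders depend on the ideal alone.\<close>

lemma char_sets_same_ranks:
  assumes A: "char_set le I A" and B: "char_set le I B"
  shows "map (rank le) A = map (rank le) B"
proof -
  have nl: "\<not> lower_rank le A B" "\<not> lower_rank le B A"
    using A B by (auto simp: char_set_def)
  have same: "rank le (A ! i) = rank le (B ! i)" if "i < length A" "i < length B" for i
    using that
  proof (induction i rule: less_induct)
    case (less i)
    then have IH: "\<forall>j<i. rank le (A ! j) = rank le (B ! j)" by auto
    show ?case
    proof (rule ccontr)
      assume "rank le (A ! i) \<noteq> rank le (B ! i)"
      then consider "rank_less le (rank le (A ! i)) (rank le (B ! i))"
        | "rank_less le (rank le (B ! i)) (rank le (A ! i))"
        using rank_less_total by blast
      then show False
      proof cases
        case 1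
        then have "lower_rank le A B" unfolding lower_rank_def using less.prems IH by blast
        with nl show False by blast
      next
        case 2
        then have "lower_rank le B A" unfolding lower_rank_def using less.prems IH by force
        with nl show False by blast
      qed
    qed
  qed
  have "length A = length B"
  proof (rule linorder_cases[of "length A" "length B"])
    assume "length A < length B"
    with nl same show ?thesis by (auto simp: lower_rank_def)
  next
    assume "length B < length A"
    with nl same show ?thesis by (auto simp: lower_rank_def)
  qed
  with same show ?thesis by (auto intro: nth_equalityI)
qed

lemma leader_image: "leader le ` set A = fst ` set (map (rank le) A)"
  by (simp add: rank_def image_image)

lemma nonleaders_alt: "nonleaders le A = - {dapp \<theta> u | \<theta> u. u \<in> leader le ` set A}"
  unfolding nonleaders_def by blast

lemma nonleaders_eq_if_ranks_eq:
  assumes "map (rank le) A = map (rank le) B"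
  shows "nonleaders le A = nonleaders le B"
  unfolding nonleaders_alt leader_image assms ..

lemma leader_notin_nonleaders: "f \<in> set A \<Longrightarrow> dapp \<theta> (leader le f) \<notin> nonleaders le A"
  by (auto simp: nonleaders_def)

lemma autoreducedD:
  assumes "autoreduced le A"
  shows "f \<in> set A \<Longrightarrow> f \<notin> range Const"
    and "f \<in> set A \<Longrightarrow> g \<in> set A \<Longrightarrow> f \<noteq> g \<Longrightarrow> deg_in (leader le g) f < deg_in (leader le g) g"
    and "f \<in> set A \<Longrightarrow> g \<in> set A \<Longrightarrow> dapp \<theta> (leader le g) \<in> vars f \<Longrightarrow> \<theta> = {#}"
    and "distinct A"
    and "f \<in> set A \<Longrightarrow> g \<in> set A \<Longrightarrow> leader le f = leader le g \<Longrightarrow> f = g"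
proof -
  have A: "set A \<inter> range Const = {}" "\<And>f g. f \<in> set A \<Longrightarrow> g \<in> set A \<Longrightarrow> f \<noteq> g \<Longrightarrow> reduced le f g"
    "sorted_wrt (\<lambda>f g. rank_less le (rank le f) (rank le g)) A"
    using assms unfolding autoreduced_def by blast+
  show nc: "f \<in> set A \<Longrightarrow> f \<notin> range Const" for f using A(1) by blast
  show deg: "f \<in> set A \<Longrightarrow> g \<in> set A \<Longrightarrow> f \<noteq> g \<Longrightarrow> deg_in (leader le g) f < deg_in (leader le g) g" for f g
    using A(2) unfolding reduced_def by blast
  show "f \<in> set A \<Longrightarrow> g \<in> set A \<Longrightarrow> dapp \<theta> (leader le g) \<in> vars f \<Longrightarrow> \<theta> = {#}"
  proof (cases "f = g")
    case True
    assume "f \<in> set A" "dapp \<theta> (leader le g) \<in> vars f"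
    then have "le (dapp \<theta> (leader le g)) (leader le g)" using True leader(2)[OF nc] by blast
    then show "\<theta> = {#}" using le_antisym[OF le_dapp] dapp_eq_self_iff by metis
  next
    case False
    assume "f \<in> set A" "g \<in> set A" "dapp \<theta> (leader le g) \<in> vars f"
    with A(2) False show "\<theta> = {#}" unfolding reduced_def by blast
  qed
  show "distinct A"
    unfolding distinct_conv_nth
  proof (intro allI impI)
    fix i j assume "i < length A" "j < length A" "i \<noteq> j"
    then have "rank_less le (rank le (A ! i)) (rank le (A ! j)) \<or>
        rank_less le (rank le (A ! j)) (rank le (A ! i))"
      using A(3) unfolding sorted_wrt_iff_nth_less by (cases "i < j") auto
    then show "A ! i \<noteq> A ! j" using rank_less_irrefl[of "rank le (A ! i)"] by auto
  qed
  show "f \<in> set A \<Longrightarrow> g \<in> set A \<Longrightarrow> leader le f = leader le g \<Longrightarrow> f = g"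
    using deg[of f g] deg[of g f] by (cases "f = g") auto
qed

end

section \<open>Uniqueness of the canonical characteristic set\<close>

locale ranked_differential_ring = differential_ring D + ranked le
  for D :: "'d \<Rightarrow> 'k::field_char_0 \<Rightarrow> 'k" and le :: "('d, 'l) dvar \<Rightarrow> ('d, 'l) dvar \<Rightarrow> bool"
begin

text \<open>Autoreduced sets contain no constants, so minimality of rank says nothing about
  constants in I; nonzero ones are excluded by properness.\<close>

lemma char_set_reduced_zero:
  assumes "diff_ideal D I" "1 \<notin> I" "char_set le I A" "f \<in> I"
    and "\<And>g. g \<in> set A \<Longrightarrow> reduced le f g"
  shows "f = 0"
proof (cases "f \<in> range Const")
  case True
  then obtain c where c: "f = Const c" by blast
  with diff_ideal_Const[OF assms(1)] assms(2,4) show ?thesis by (cases "c = 0") auto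
qed (use char_set_reduced_False assms(3-5) in blast)

lemma canonical_char_setD:
  assumes "canonical_char_set le I C"
  shows "char_set le I C"
    and "f \<in> set C \<Longrightarrow> initial le f \<in> poly_in (nonleaders le C)"
    and "f \<in> set C \<Longrightarrow> g \<in> poly_in (nonleaders le C) \<Longrightarrow> g dvd f \<Longrightarrow> g \<in> range Const"
    and "f \<in> set C \<Longrightarrow> lookup (initial le f) (lead_monom le (initial le f)) = 1"
  using assms unfolding canonical_char_set_def by simp_all

lemma canonical_char_set_unique_nth:
  assumes I: "diff_ideal D I" "1 \<notin> I"
    and C: "canonical_char_set le I C" and C': "canonical_char_set le I C'"
    and i: "i < length C"
  shows "C' ! i = C ! i"
proof -
  note cs = canonical_char_setD(1)[OF C] canonical_char_setD(1)[OF C']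
  note ini = canonical_char_setD(2)[OF C] canonical_char_setD(2)[OF C']
  note fac = canonical_char_setD(3)[OF C] canonical_char_setD(3)[OF C']
  note lc = canonical_char_setD(4)[OF C] canonical_char_setD(4)[OF C']
  note ranks = char_sets_same_ranks[OF cs]
  note N = nonleaders_eq_if_ranks_eq[OF ranks]
  have len: "length C = length C'" using ranks by (metis length_map)
  have rk: "rank le (C ! j) = rank le (C' ! j)" if "j < length C" for j
    using that len arg_cong[OF ranks, of "\<lambda>xs. xs ! j"] by simp
  have aut: "autoreduced le C" "autoreduced le C'" using cs by (auto simp: char_set_def)
  define f g where "f = C ! i" and "g = C' ! i"
  have fg: "f \<in> set C" "g \<in> set C'" using i len by (auto simp: f_def g_def)
  have lfg: "leader le g = leader le f" "deg_in (leader le f) g = deg_in (leader le f) f"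
    using rank_eqD[OF rk[OF i, symmetric]] by (simp_all add: f_def g_def)
  define u where "u = leader le f"
  define d where "d = deg_in u f"
  have dpos: "d > 0" using deg_leader_pos[OF autoreducedD(1)[OF aut(1) fg(1)]] by (simp add: d_def u_def)
  have inif: "initial le f = coeff_in u d f" and inig: "initial le g = coeff_in u d g"
    by (simp_all add: initial_def lfg u_def d_def)
  \<comment> \<open>The terms of degree d in u cancel; the rest of the work is to see that the other
    leaders cause no loss of reducedness.\<close>
  define R where "R = initial le g * f - initial le f * g"
  have varsR: "vars R \<subseteq> vars f \<union> vars g"
    using vars_diff[of "initial le g * f" "initial le f * g"] vars_mult[of "initial le g" f]
      vars_mult[of "initial le f" g] vars_initial[of f] vars_initial[of g] unfolding R_def by blast
  have "reduced le R h" if h: "h \<in> set C" for h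
  proof -
    from h obtain j where j: "j < length C" "h = C ! j" by (auto simp: in_set_conv_nth)
    define h' where "h' = C' ! j"
    have h': "h' \<in> set C'" "leader le h' = leader le h"
      "deg_in (leader le h) h' = deg_in (leader le h) h"
      using rank_eqD[OF rk[OF j(1), symmetric]] j len by (simp_all add: h'_def)
    have "dapp \<theta> (leader le h) \<notin> vars R" if "\<theta> \<noteq> {#}" for \<theta>
      using varsR that autoreducedD(3)[OF aut(1) fg(1) h] autoreducedD(3)[OF aut(2) fg(2) h'(1)] h'(2)
      by auto
    moreover have "deg_in (leader le h) R < deg_in (leader le h) h"
    proof (cases "j = i")
      case True
      then have hf: "h = f" by (simp add: j f_def)
      have "deg_in u (initial le g) = 0" "deg_in u (initial le f) = 0"
        unfolding inif inig by (simp_all add: deg_in_notin)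
      then have "deg_in u (initial le g * f) \<le> d" "deg_in u (initial le f * g) \<le> d"
        using deg_in_mult_le[of u "initial le g" f] deg_in_mult_le[of u "initial le f" g] lfg
        by (simp_all add: d_def u_def)
      then have "deg_in u R \<le> d" unfolding R_def by (rule deg_in_diff_le)
      moreover have "coeff_in u d R = 0"
        unfolding R_def coeff_in_diff inif inig by (simp add: coeff_in_mult_notin)
      ultimately have "deg_in u R \<noteq> d \<or> R = 0" using lead_coeff_in_nonzero[of R u] by auto
      with \<open>deg_in u R \<le> d\<close> dpos show ?thesis by (auto simp: hf u_def d_def)
    next
      case False
      have ne: "f \<noteq> h" "g \<noteq> h'"
        using False i j len autoreducedD(4)[OF aut(1)] autoreducedD(4)[OF aut(2)]
        by (auto simp: f_def g_def h'_def nth_eq_iff_index_eq)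
      \<comment> \<open>The initials lie in \<open>k[N]\<close> and are therefore free of every
        leader, so multiplying by them does not raise the degree in the leader of h.\<close>
      have "leader le h \<notin> nonleaders le C" using leader_notin_nonleaders[OF h, of "{#}"] by simp
      then have 0: "deg_in (leader le h) (initial le g) = 0" "deg_in (leader le h) (initial le f) = 0"
        using ini(1)[OF fg(1)] ini(2)[OF fg(2)] N by (auto simp: poly_in_def intro!: deg_in_notin)
      have "deg_in (leader le h) f < deg_in (leader le h) h"
        using autoreducedD(2)[OF aut(1) fg(1) h ne(1)] .
      moreover have "deg_in (leader le h) g < deg_in (leader le h) h"
        using autoreducedD(2)[OF aut(2) fg(2) h'(1) ne(2)] h' by simp
      ultimately have "deg_in (leader le h) (initial le g * f) \<le> deg_in (leader le h) h - 1"
        "deg_in (leader le h) (initial le f * g) \<le> deg_in (leader le h) h - 1"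
        using deg_in_mult_le[of "leader le h" "initial le g" f]
          deg_in_mult_le[of "leader le h" "initial le f" g] 0 by linarith+
      then have "deg_in (leader le h) R \<le> deg_in (leader le h) h - 1"
        unfolding R_def by (rule deg_in_diff_le)
      with \<open>deg_in (leader le h) f < deg_in (leader le h) h\<close> show ?thesis by linarith
    qed
    ultimately show ?thesis unfolding reduced_def by blast
  qed
  moreover have "R \<in> I"
    unfolding R_def using cs fg
    by (auto simp: char_set_def intro!: diff_ideal_diff[OF I(1)] diff_idealD(3)[OF I(1)])
  ultimately have "R = 0" using char_set_reduced_zero[OF I cs(1)] by blast
  then have eq: "initial le g * f = initial le f * g" by (simp add: R_def)
  have nz: "f \<noteq> 0" "g \<noteq> 0" using autoreducedD(1)[OF aut(1) fg(1)] autoreducedD(1)[OF aut(2) fg(2)]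
    by (metis Const_0 rangeI)+
  note inz = initial_nonzero[OF nz(1)] initial_nonzero[OF nz(2)]
  have "initial le f dvd initial le g * f" by (simp add: eq)
  from dvd_mult_split[OF inz(1) this] obtain a1 a2 where
    a: "initial le f = a1 * a2" "a1 dvd initial le g" "a2 dvd f" by blast
  have "a2 \<in> poly_in (nonleaders le C)"
    by (rule dvd_poly_in[OF _ inz(1) ini(1)[OF fg(1)]]) (simp add: a(1))
  \<comment> \<open>The part of the initial of f that divides f is constant by canonicity, so the
    whole initial divides that of g.\<close>
  then have "a2 \<in> range Const" using fac(1)[OF fg(1) _ a(3)] by blast
  then have "a2 dvd 1" using inz(1) a(1) by (auto simp: mpoly_dvd_1_iff)
  then have "initial le f dvd a1" using mult_dvd_mono[of a1 a1 a2 1] by (simp add: a(1))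
  then have "initial le f dvd initial le g" using a(2) by (rule dvd_trans)
  then obtain t where t: "initial le g = initial le f * t" by (elim dvdE)
  with eq have "initial le f * (t * f) = initial le f * g" by (simp add: mult.assoc)
  then have gt: "g = t * f" unfolding mpoly_mult_left_cancel[OF inz(1)] by (rule sym)
  have "t \<in> poly_in (nonleaders le C')"
    by (rule dvd_poly_in[OF _ inz(2) ini(2)[OF fg(2)]]) (simp add: t)
  \<comment> \<open>The same condition for g: the cofactor t divides g and lies in
    \<open>k[N]\<close>.\<close>
  then have "t \<in> range Const" by (rule fac(2)[OF fg(2)]) (simp add: gt)
  then obtain c where c: "t = Const c" by blast
  with gt nz have c0: "c \<noteq> 0" by auto
  have "coeff_in u d g = Const c * coeff_in u d f"
    unfolding gt c by (simp add: coeff_in_mult_notin)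
  then have lk: "lookup (initial le g) m = c * lookup (initial le f) m" for m
    by (simp add: inif inig lookup_Const_mult)
  \<comment> \<open>Scaling by a nonzero constant keeps the leading monomial, so the two
    normalizations to 1 force c to be 1.\<close>
  then have "keys (initial le g) = keys (initial le f)" using c0 by (auto simp: in_keys_iff)
  then have "lead_monom le (initial le g) = lead_monom le (initial le f)"
    by (simp add: lead_monom_def)
  with lk lc(1)[OF fg(1)] lc(2)[OF fg(2)] have "c = 1" by simp
  then show ?thesis using gt c by (simp add: f_def g_def)
qed

lemma canonical_char_set_unique:
  assumes I: "diff_ideal D I" "1 \<notin> I"
    and C: "canonical_char_set le I C" and C': "canonical_char_set le I C'"
  shows "C' = C"
proof (rule nth_equalityI)
  have "map (rank le) C' = map (rank le) C"
    by (rule char_sets_same_ranks[OF canonical_char_setD(1)[OF C'] canonical_char_setD(1)[OF C]])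
  then show len: "length C' = length C" by (rule map_eq_imp_length_eq)
  fix i assume "i < length C'"
  with len show "C' ! i = C ! i"
    using canonical_char_set_unique_nth[OF I C C'] by simp
qed

end

subsection \<open>Characterizable ideals are proper\<close>

definition monom_val :: "('v \<Rightarrow> 'k::comm_ring_1) \<Rightarrow> ('v \<Rightarrow>\<^sub>0 nat) \<Rightarrow> 'k" where
  "monom_val x m = (\<Prod>v\<in>keys m. x v ^ lookup m v)"

definition mpoly_val :: "('v \<Rightarrow> 'k::comm_ring_1) \<Rightarrow> ('v, 'k) mpoly \<Rightarrow> 'k" where
  "mpoly_val x f = (\<Sum>m\<in>keys f. lookup f m * monom_val x m)"

lemma monom_val_add: "monom_val x (m + n) = monom_val x m * monom_val x n"
proof -
  have *: "monom_val x l = (\<Prod>v\<in>keys m \<union> keys n. x v ^ lookup l v)"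
    if "keys l \<subseteq> keys m \<union> keys n" for l
    unfolding monom_val_def by (rule prod.mono_neutral_left) (use that in \<open>auto simp: in_keys_iff\<close>)
  show ?thesis
    by (simp add: * keys_add lookup_add power_add prod.distrib)
qed

lemma mpoly_val_superset:
  "finite K \<Longrightarrow> keys f \<subseteq> K \<Longrightarrow> mpoly_val x f = (\<Sum>m\<in>K. lookup f m * monom_val x m)"
  unfolding mpoly_val_def by (rule sum.mono_neutral_left) (auto simp: in_keys_iff)

lemma mpoly_val_0 [simp]: "mpoly_val x 0 = 0"
  by (simp add: mpoly_val_def)

lemma mpoly_val_add: "mpoly_val x (f + g) = mpoly_val x f + mpoly_val x g"
  using mpoly_val_superset[of "keys f \<union> keys g" "f + g" x]
    mpoly_val_superset[of "keys f \<union> keys g" f x] mpoly_val_superset[of "keys f \<union> keys g" g x]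
    keys_add[of f g]
  by (simp add: lookup_add distrib_right sum.distrib)

lemma mpoly_val_single: "mpoly_val x (single m c) = c * monom_val x m"
  by (cases "c = 0") (simp_all add: mpoly_val_def)

lemma mpoly_val_mult: "mpoly_val x (f * g) = mpoly_val x f * mpoly_val x g"
proof (induction f rule: poly_mapping_mono_induct)
  case (single m c)
  show ?case
    by (induction g rule: poly_mapping_mono_induct)
      (simp_all add: mult_single mpoly_val_single monom_val_add mpoly_val_add distrib_left distrib_right
        ac_simps)
qed (simp_all add: mpoly_val_add distrib_right)

lemma mpoly_val_Const [simp]: "mpoly_val x (Const c) = c"
  using mpoly_val_single[of x 0 c] by (simp add: Const_def monom_val_def)

lemma mpoly_val_1 [simp]: "mpoly_val x 1 = 1"
  using mpoly_val_Const[of x 1] by simp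

lemma mpoly_val_Var [simp]: "mpoly_val x (Var v) = x v"
  using mpoly_val_single[of x "single v 1" 1] by (simp add: Var_def monom_val_def)

lemma mpoly_val_power: "mpoly_val x (f ^ n) = mpoly_val x f ^ n"
  by (induction n) (simp_all add: mpoly_val_mult)

lemma mpoly_val_H:
  assumes "\<And>f. f \<in> set A \<Longrightarrow> mpoly_val x (initial le f) \<noteq> 0 \<and> mpoly_val x (separant le f) \<noteq> 0"
  shows "mpoly_val x (H le A) \<noteq> (0 :: 'k::idom)"
  using assms unfolding H_def by (induction A) (simp_all add: mpoly_val_mult)

context differential_ring
begin

text \<open>The indeterminates are given values in k, and their derivatives are then computed inside
  k. Because the derivations commute, the fold over a multiset is well behaved, and evaluation at
  this point commutes with the derivations, so its kernel is a differential ideal.\<close>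

definition diff_point :: "('l \<Rightarrow> 'k) \<Rightarrow> ('d, 'l) dvar \<Rightarrow> 'k" where
  "diff_point c v = fold_mset D (c (snd v)) (fst v)"

lemma diff_point_dapp: "diff_point c (dapp {#i#} v) = D i (diff_point c v)"
proof -
  interpret comp_fun_commute D
    by standard (auto simp: fun_eq_iff D_comm)
  show ?thesis by (simp add: diff_point_def dapp_def)
qed

lemma mpoly_val_dderiv:
  "mpoly_val (diff_point c) (dderiv D i f) = D i (mpoly_val (diff_point c) f)"
  by (induction f rule: mpoly_induct)
    (simp_all add: dderiv_Const dderiv_Var dderiv_add dderiv_mult mpoly_val_add mpoly_val_mult
      D_add D_mult diff_point_dapp)

lemma diff_ideal_kernel: "diff_ideal D {f. mpoly_val (diff_point c) f = 0}"
  by (simp add: diff_ideal_def mpoly_val_add mpoly_val_mult mpoly_val_dderiv)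

lemma diff_ideal_gen_subset: "diff_ideal D J \<Longrightarrow> F \<subseteq> J \<Longrightarrow> diff_ideal_gen D F \<subseteq> J"
  by (auto simp: diff_ideal_gen_def)

end

context ranked_differential_ring
begin

text \<open>A characteristic set of the unit ideal consists of polynomials \<open>a y\<^sub>j + b\<close> with constant
  \<open>a\<close> and \<open>b\<close>, and these have a common zero, at which their initials do not vanish.\<close>

lemma char_set_UNIV_linear:
  fixes A :: "('d, 'l, 'k) dpoly list"
  assumes A: "char_set le UNIV A" and f: "f \<in> set A"
  shows "\<exists>j a b. leader le f = ({#}, j) \<and> a \<noteq> 0 \<and> f = Const b + Const a * Var ({#}, j)"
proof -
  have aut: "autoreduced le A" using A by (simp add: char_set_def)
  \<comment> \<open>Each indeterminate belongs to the unit ideal, so it is not reduced with respect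
    to some g of A. As it has order 0 and degree 1, the leader of g must be this indeterminate and
    occur with degree 1.\<close>
  have "\<exists>g\<in>set A. leader le g = ({#}, j) \<and> deg_in ({#}, j) g = 1" for j
  proof -
    define y :: "('d, 'l, 'k) dpoly" where "y = Var ({#}, j)"
    have "y \<notin> range Const" using vars_empty_iff[of y] by (simp add: y_def)
    then obtain g where g: "g \<in> set A" "\<not> reduced le y g"
      using char_set_reduced_False[OF A UNIV_I] by blast
    have dg: "0 < deg_in (leader le g) g" by (rule deg_leader_pos[OF autoreducedD(1)[OF aut g(1)]])
    have "dapp \<theta> (leader le g) \<notin> vars y" if "\<theta> \<noteq> {#}" for \<theta>
      using that by (auto simp: y_def dapp_def)
    with g(2) have le: "deg_in (leader le g) g \<le> deg_in (leader le g) y"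
      by (auto simp: reduced_def)
    with dg have "0 < deg_in (leader le g) y" by simp
    then have l: "leader le g = ({#}, j)" by (simp add: deg_in_pos_iff y_def)
    moreover have "deg_in ({#}, j) y \<le> 1"
      unfolding deg_in_le_iff by (simp add: y_def coeff_in_Var)
    ultimately show ?thesis using g(1) le dg by (intro bexI[of _ g]) auto
  qed
  then obtain F where F: "\<And>j. F j \<in> set A" "\<And>j. leader le (F j) = ({#}, j)"
    "\<And>j. deg_in ({#}, j) (F j) = 1" by metis
  have nin: "(\<theta>, j) \<notin> vars g" if "g \<in> set A" "g \<noteq> F j" for g \<theta> j
  proof
    assume v: "(\<theta>, j) \<in> vars g"
    then have "dapp \<theta> (leader le (F j)) \<in> vars g" by (simp add: F dapp_def)
    then have "\<theta> = {#}" by (rule autoreducedD(3)[OF aut that(1) F(1)])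
    moreover have "deg_in ({#}, j) g = 0"
      using autoreducedD(2)[OF aut that(1) F(1) that(2)] by (simp add: F)
    ultimately show False using v deg_in_pos_iff[of "({#}, j)" g] by simp
  qed
  have "\<exists>j. f = F j"
  proof (rule ccontr)
    assume "\<nexists>j. f = F j"
    then have "vars f = {}" using nin[OF f] by auto
    then show False using autoreducedD(1)[OF aut f] by (simp add: vars_empty_iff)
  qed
  then obtain j where fj: "f = F j" ..
  have ne: "F j \<noteq> F i" if "i \<noteq> j" for i
    using F(2)[of i] F(2)[of j] that by auto
  have "vars f \<subseteq> {({#}, j)}"
  proof
    fix w assume w: "w \<in> vars f"
    obtain \<theta> i where wi: "w = (\<theta>, i)" by (cases w)
    with w nin[OF f, of i \<theta>] ne[of i] have "i = j" by (auto simp: fj)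
    with w wi have "dapp \<theta> (leader le f) \<in> vars f" by (simp add: fj F dapp_def)
    then have "\<theta> = {#}" by (rule autoreducedD(3)[OF aut f f])
    with wi \<open>i = j\<close> show "w \<in> {({#}, j)}" by simp
  qed
  then have "vars (coeff_in ({#}, j) d f) = {}" for d
    using vars_coeff_in[of "({#}, j)" d f] by auto
  then have "\<forall>d. \<exists>c. coeff_in ({#}, j) d f = Const c" by (auto simp: vars_empty_iff)
  then obtain c where c: "\<And>d. coeff_in ({#}, j) d f = Const (c d)" by metis
  have "deg_in ({#}, j) f \<le> 1" by (simp add: fj F)
  then have "f = (\<Sum>d\<le>1. coeff_in ({#}, j) d f * Var ({#}, j) ^ d)" by (rule coeff_in_expand)
  then have "f = Const (c 0) + Const (c 1) * Var ({#}, j)" by (simp add: c)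
  moreover have "f \<noteq> 0" using autoreducedD(1)[OF aut f] by (metis Const_0 rangeI)
  then have "c 1 \<noteq> 0"
    using lead_coeff_in_nonzero[of f "({#}, j)"] F(3)[of j] c[of 1] by (auto simp: fj)
  ultimately show ?thesis using F(2)[of j] unfolding fj[symmetric] by blast
qed

text \<open>If 1 were in I, a power of \<open>H le A\<close> would lie in the differential ideal
  generated by A. The common zero of A annihilates that ideal, but none of the initials and
  separants.\<close>

lemma characterizable_proper:
  assumes "characterizable D le I"
  shows "1 \<notin> I"
proof
  assume "1 \<in> I"
  from assms obtain A where I: "diff_ideal D I" and A: "char_set le I A"
    and sat: "I = saturation (diff_ideal_gen D (set A)) (H le A)"
    unfolding characterizable_def by blast
  have "I = UNIV" using diff_idealD(3)[OF I \<open>1 \<in> I\<close>] by auto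
  then have AU: "char_set le UNIV A" using A by simp
  then have aut: "autoreduced le A" by (simp add: char_set_def)
  note lin = char_set_UNIV_linear[OF AU]
  \<comment> \<open>At most one element of A has the given leader, so a single value r satisfies the
    condition for all f quantified over.\<close>
  define root where "root j = (SOME r. \<forall>f\<in>set A. leader le f = ({#}, j) \<longrightarrow>
    (\<exists>a b. a \<noteq> 0 \<and> f = Const b + Const a * Var ({#}, j) \<and> b + a * r = 0))" for j
  have root: "\<exists>a b. a \<noteq> 0 \<and> f = Const b + Const a * Var ({#}, j) \<and> b + a * root j = 0"
    if "f \<in> set A" "leader le f = ({#}, j)" for f j
  proof -
    from lin[OF that(1)] that(2) obtain a b where ab: "a \<noteq> 0" "f = Const b + Const a * Var ({#}, j)"
      by auto
    have "g = f" if "g \<in> set A" "leader le g = ({#}, j)" for g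
      using autoreducedD(5)[OF aut that(1) \<open>f \<in> set A\<close>] that(2) \<open>leader le f = ({#}, j)\<close> by simp
    then have "\<exists>r. \<forall>f\<in>set A. leader le f = ({#}, j) \<longrightarrow>
      (\<exists>a b. a \<noteq> 0 \<and> f = Const b + Const a * Var ({#}, j) \<and> b + a * r = 0)"
      using ab by (intro exI[of _ "- b / a"] ballI impI exI[of _ a] exI[of _ b]) simp
    from someI_ex[OF this] that show ?thesis unfolding root_def by blast
  qed
  let ?x = "diff_point root"
  have val: "mpoly_val ?x f = 0" "mpoly_val ?x (initial le f) \<noteq> 0" "mpoly_val ?x (separant le f) \<noteq> 0"
    if f: "f \<in> set A" for f
  proof -
    from lin[OF f] obtain j where j: "leader le f = ({#}, j)" by blast
    from root[OF f j] obtain a b where ab: "a \<noteq> 0" "f = Const b + Const a * Var ({#}, j)"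
      "b + a * root j = 0" by blast
    have x: "?x ({#}, j) = root j" by (simp add: diff_point_def)
    show "mpoly_val ?x f = 0" by (simp add: ab(2,3) mpoly_val_add mpoly_val_mult x)
    have co: "coeff_in ({#}, j) d f = (if d = 0 then Const b else if d = 1 then Const a else 0)" for d
      using coeff_in_Var_power[of "({#}, j)" d 1] coeff_in_notin[of "({#}, j)" "Const b" d]
      by (auto simp: ab(2) coeff_in_add coeff_in_mult_notin coeff_in_0_notin)
    have "deg_in ({#}, j) f \<le> 1" by (simp add: deg_in_le_iff co)
    moreover have "1 \<le> deg_in ({#}, j) f" by (rule le_deg_in) (simp add: co ab(1))
    ultimately have "deg_in ({#}, j) f = 1" by simp
    then have "initial le f = Const a" by (simp add: initial_def j co)
    then show "mpoly_val ?x (initial le f) \<noteq> 0" using ab(1) by simp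
    have "separant le f = partial ({#}, j) f" by (simp add: separant_def j)
    also have "\<dots> = Const a" by (simp add: ab(2) partial_add partial_mult partial_Var)
    finally have "separant le f = Const a" .
    then show "mpoly_val ?x (separant le f) \<noteq> 0" using ab(1) by simp
  qed
  have "diff_ideal_gen D (set A) \<subseteq> {f. mpoly_val ?x f = 0}"
    using val(1) by (intro diff_ideal_gen_subset[OF diff_ideal_kernel]) auto
  moreover obtain m where "H le A ^ m * 1 \<in> diff_ideal_gen D (set A)"
    using \<open>1 \<in> I\<close> unfolding sat saturation_def by blast
  ultimately have "mpoly_val ?x (H le A ^ m) = 0" by auto
  then have "mpoly_val ?x (H le A) = 0" by (simp add: mpoly_val_power)
  with mpoly_val_H[of A ?x le] val show False by blast
qed

end

subsection \<open>Algebraic dependence modulo a prime ideal\<close>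

lemma homogeneous_system_nontrivial:
  fixes a :: "'x \<Rightarrow> 'y \<Rightarrow> 'k::field"
  assumes "finite Y" "finite X" "card Y < card X"
  shows "\<exists>c. (\<exists>x\<in>X. c x \<noteq> 0) \<and> (\<forall>y\<in>Y. (\<Sum>x\<in>X. c x * a x y) = 0)"
  using assms
proof (induction Y arbitrary: X a rule: finite_induct)
  case empty
  then have "X \<noteq> {}" by auto
  then show ?case by (intro exI[of _ "\<lambda>_. 1"]) auto
next
  case (insert y Y)
  show ?case
  proof (cases "\<forall>x\<in>X. a x y = 0")
    case True
    moreover have "card Y < card X" using insert by simp
    ultimately show ?thesis using insert.IH[OF insert.prems(1), of a] by auto
  next
    case False
    then obtain z where z: "z \<in> X" "a z y \<noteq> 0" by blast
    let ?X = "X - {z}"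
    let ?a = "\<lambda>x w. a x w - a x y / a z y * a z w"
    have "card Y < card ?X" using insert z by simp
    with insert.IH[of ?X ?a] insert.prems(1) obtain c where
      c: "\<exists>x\<in>?X. c x \<noteq> 0" "\<And>w. w \<in> Y \<Longrightarrow> (\<Sum>x\<in>?X. c x * ?a x w) = 0" by auto
    define c' where "c' = c(z := - (\<Sum>x\<in>?X. c x * a x y) / a z y)"
    have sum: "(\<Sum>x\<in>X. c' x * a x w) = (\<Sum>x\<in>?X. c x * ?a x w)" for w
    proof -
      have "(\<Sum>x\<in>X. c' x * a x w) = c' z * a z w + (\<Sum>x\<in>?X. c' x * a x w)"
        by (rule sum.remove[OF insert.prems(1) z(1)])
      also have "(\<Sum>x\<in>?X. c' x * a x w) = (\<Sum>x\<in>?X. c x * a x w)"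
        by (rule sum.cong) (auto simp: c'_def)
      also have "c' z * a z w = - (\<Sum>x\<in>?X. c x * (a x y / a z y * a z w))"
        by (simp add: c'_def sum_divide_distrib sum_distrib_right sum_negf mult.assoc)
      finally show ?thesis by (simp add: sum_subtractf right_diff_distrib)
    qed
    have "\<exists>x\<in>X. c' x \<noteq> 0" using c(1) by (auto simp: c'_def)
    moreover have "(\<Sum>x\<in>?X. c x * ?a x y) = 0" using z(2) by simp
    ultimately show ?thesis using c(2) by (intro exI[of _ c']) (auto simp: sum)
  qed
qed

lemma card_bounded_monomials:
  fixes S :: "'v set" and n :: nat
  assumes "finite S"
  defines "M \<equiv> {m :: 'v \<Rightarrow>\<^sub>0 nat. keys m \<subseteq> S \<and> (\<forall>v. lookup m v \<le> n)}"
  shows "finite M" "card M = Suc n ^ card S"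
proof -
  have lk: "lookup (\<Sum>v\<in>S. single v (g v)) w = (if w \<in> S then g w else 0)" for g :: "'v \<Rightarrow> nat" and w
  proof -
    have "(\<Sum>v\<in>S. lookup (single v (g v)) w) = (\<Sum>v\<in>S. if v = w then g w else 0)"
      by (rule sum.cong) (auto simp: lookup_single when_def)
    then show ?thesis using assms(1) by (simp add: lookup_sum)
  qed
  have "bij_betw (\<lambda>m. restrict (lookup m) S) M (S \<rightarrow>\<^sub>E {..n})"
  proof (rule bij_betw_byWitness[where f' = "\<lambda>g. \<Sum>v\<in>S. single v (g v)"])
    show "\<forall>m\<in>M. (\<Sum>v\<in>S. single v (restrict (lookup m) S v)) = m"
    proof
      fix m assume m: "m \<in> M"
      show "(\<Sum>v\<in>S. single v (restrict (lookup m) S v)) = m"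
      proof (rule poly_mapping_eqI)
        fix w
        have "w \<notin> S \<Longrightarrow> lookup m w = 0" using m by (auto simp: M_def in_keys_iff)
        then show "lookup (\<Sum>v\<in>S. single v (restrict (lookup m) S v)) w = lookup m w"
          by (auto simp: lk)
      qed
    qed
    show "\<forall>g\<in>S \<rightarrow>\<^sub>E {..n}. restrict (lookup (\<Sum>v\<in>S. single v (g v))) S = g"
      by (auto simp: lk fun_eq_iff PiE_def extensional_def)
    show "(\<lambda>m. restrict (lookup m) S) ` M \<subseteq> S \<rightarrow>\<^sub>E {..n}" by (auto simp: M_def)
    show "(\<lambda>g. \<Sum>v\<in>S. single v (g v)) ` (S \<rightarrow>\<^sub>E {..n}) \<subseteq> M"
    proof
      fix m assume "m \<in> (\<lambda>g. \<Sum>v\<in>S. single v (g v)) ` (S \<rightarrow>\<^sub>E {..n})"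
      then obtain g where g: "g \<in> S \<rightarrow>\<^sub>E {..n}" and m: "m = (\<Sum>v\<in>S. single v (g v))" by blast
      have "lookup m w = (if w \<in> S then g w else 0)" for w unfolding m by (rule lk)
      with g show "m \<in> M" by (auto simp: M_def in_keys_iff PiE_def Pi_def split: if_splits)
    qed
  qed
  moreover have "finite (S \<rightarrow>\<^sub>E {..n})" using assms(1) by (intro finite_PiE) auto
  moreover have "card (S \<rightarrow>\<^sub>E {..n}) = Suc n ^ card S" by (simp add: card_PiE assms(1))
  ultimately show "finite M" "card M = Suc n ^ card S"
    using bij_betw_finite bij_betw_same_card by metis+
qed

text \<open>Exponents are bounded separately in each variable, so that the admissible monomials over
  a finite set S number exactly \<open>Suc n ^ card S\<close>.\<close>

definition bounded_exps :: "nat \<Rightarrow> ('v, 'k::zero) mpoly \<Rightarrow> bool" where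
  "bounded_exps n f \<longleftrightarrow> (\<forall>v. deg_in v f \<le> n)"

lemma bounded_expsD: "bounded_exps n f \<Longrightarrow> deg_in v f \<le> n"
  by (simp add: bounded_exps_def)

lemma bounded_exps_mdeg: "bounded_exps (mdeg f) f"
  unfolding bounded_exps_def
proof
  fix v show "deg_in v f \<le> mdeg f"
    by (cases "v \<in> vars f") (auto simp: mdeg_def deg_in_notin intro: member_le_sum)
qed

lemma bounded_exps_coeff_in: "bounded_exps n f \<Longrightarrow> bounded_exps n (coeff_in v d f)"
  by (simp add: bounded_exps_def order_trans[OF deg_in_coeff_in_le])

text \<open>Iterated algebraic dependence modulo P: each new variable satisfies a relation over
  variables already obtained. Requiring the leading coefficient to lie outside P keeps the relation
  nontrivial in the quotient.\<close>

inductive_set alg_closure :: "('v, 'k::comm_monoid_add) mpoly set \<Rightarrow> 'v set \<Rightarrow> 'v set" for P S where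
  base: "v \<in> S \<Longrightarrow> v \<in> alg_closure P S"
| step: "f \<in> P \<Longrightarrow> (\<And>w. w \<in> vars f \<Longrightarrow> w \<noteq> v \<Longrightarrow> w \<in> alg_closure P S) \<Longrightarrow> v \<in> vars f \<Longrightarrow>
    coeff_in v (deg_in v f) f \<notin> P \<Longrightarrow> v \<in> alg_closure P S"

text \<open>
  \<open>poly_growth P s X\<close>: modulo \<open>P\<close> and after multiplication by \<open>h ^ n\<close>, the polynomials in \<open>X\<close>
  with exponents at most \<open>n\<close> are contained in a space of dimension \<open>O(n ^ s)\<close>.
\<close>

definition poly_growth :: "('v, 'k::comm_ring_1) mpoly set \<Rightarrow> nat \<Rightarrow> 'v set \<Rightarrow> bool" where
  "poly_growth P s X \<longleftrightarrow> (\<exists>h d B. h \<notin> P \<and> (\<forall>n. finite (B n) \<and> card (B n) \<le> d * Suc n ^ s \<and>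
    (\<forall>g\<in>poly_in X. bounded_exps n g \<longrightarrow> (\<exists>r. keys r \<subseteq> B n \<and> h ^ n * g - r \<in> P))))"

lemma poly_growthI:
  assumes "h \<notin> P" "\<And>n. finite (B n)" "\<And>n. card (B n) \<le> d * Suc n ^ s"
    and "\<And>n g. g \<in> poly_in X \<Longrightarrow> bounded_exps n g \<Longrightarrow> \<exists>r. keys r \<subseteq> B n \<and> h ^ n * g - r \<in> P"
  shows "poly_growth P s X"
  unfolding poly_growth_def
  by (rule exI[of _ h], rule exI[of _ d], rule exI[of _ B]) (intro conjI allI ballI impI assms)

context differential_ring
begin

lemma poly_growth_base:
  assumes P: "prime_diff_ideal D P" and S: "finite S"
  shows "poly_growth P (card S) S"
proof -
  define B where "B n = {m. keys m \<subseteq> S \<and> (\<forall>v. lookup m v \<le> n)}" for n :: nat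
  have "finite (B n)" "card (B n) \<le> 1 * Suc n ^ card S" for n
    using card_bounded_monomials[OF S, of n] by (simp_all add: B_def)
  moreover have "\<exists>r. keys r \<subseteq> B n \<and> 1 ^ n * g - r \<in> P" if "g \<in> poly_in S" "bounded_exps n g" for n g
  proof (intro exI[of _ g] conjI subsetI)
    fix m assume m: "m \<in> keys g"
    have "keys m \<subseteq> S" using in_varsI[OF m] that(1) by (auto simp: poly_in_def)
    moreover have "lookup m v \<le> n" for v
      by (rule order_trans[OF lookup_le_deg_in[OF m] bounded_expsD[OF that(2)]])
    ultimately show "m \<in> B n" by (simp add: B_def)
  qed (use diff_idealD(1)[OF prime_diff_idealD(1)[OF P]] in simp)
  ultimately show ?thesis
    using prime_diff_idealD(2)[OF P] by (intro poly_growthI[of 1 P B 1])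
qed

text \<open>Each step of the pseudo-division raises exponents by at most b, so j steps cost
  \<open>j * b\<close>. This linear cost is what preserves the growth exponent when a dependent
  variable is adjoined.\<close>

lemma reduce_bounded:
  assumes J: "diff_ideal D J" and f: "f \<in> J" "deg_in v f = Suc e" "bounded_exps b f" "f \<in> poly_in W"
    and v: "v \<in> W" and g: "g \<in> poly_in W" "bounded_exps n g" "deg_in v g \<le> e + j"
  shows "\<exists>g'. coeff_in v (Suc e) f ^ j * g - g' \<in> J \<and> deg_in v g' \<le> e \<and>
    bounded_exps (n + j * b) g' \<and> g' \<in> poly_in W"
  using g
proof (induction j arbitrary: g n)
  case 0
  then show ?case using diff_idealD(1)[OF J] by (intro exI[of _ g]) auto
next
  case (Suc j)
  define a where "a = coeff_in v (Suc e) f"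
  define c where "c = coeff_in v (e + Suc j) g"
  define g1 where "g1 = a * g - c * Var v ^ j * f"
  have aW: "a \<in> poly_in W" "c \<in> poly_in W"
    unfolding a_def c_def by (rule poly_in_mono[OF poly_in_coeff_in Diff_subset], fact f Suc.prems)+
  have g1W: "g1 \<in> poly_in W"
    unfolding g1_def using aW f v Suc.prems
    by (intro poly_in_diff poly_in_mult poly_in_power poly_in_Var)
  have deg: "deg_in v g1 \<le> e + j"
    unfolding g1_def a_def c_def by (rule pseudo_division_step[OF f(2) Suc.prems(3)])
  have "bounded_exps (n + b) g1"
    unfolding bounded_exps_def
  proof
    fix u
    have fb: "deg_in u f \<le> b" and gn: "deg_in u g \<le> n" 
      by (rule bounded_expsD, fact)+
    have "deg_in u a \<le> b" using fb deg_in_coeff_in_le[of u v "Suc e" f] by (simp add: a_def)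
    then have 1: "deg_in u (a * g) \<le> n + b" using gn deg_in_mult_le[of u a g] by linarith
    have "deg_in u (c * Var v ^ j * f) \<le> n + b"
    proof (cases "u = v")
      case True
      show ?thesis
      proof (cases "c = 0")
        case False
        \<comment> \<open>A nonzero c means that g reaches degree \<open>e + Suc j\<close> in v, and
          the subtracted term reaches no more than that.\<close>
        then have "e + Suc j \<le> n" using le_deg_in[of v "e + Suc j" g] gn by (simp add: c_def True)
        have "deg_in v (Var v ^ j :: ('d, 'a, 'k) dpoly) \<le> j"
          by (simp add: deg_in_le_iff coeff_in_Var_power)
        moreover have "deg_in v c = 0" by (simp add: c_def deg_in_notin)
        ultimately have "deg_in v (c * Var v ^ j * f) \<le> 0 + j + Suc e"
          using deg_in_mult_le[of v "c * Var v ^ j" f] deg_in_mult_le[of v c "Var v ^ j"] f(2) by linarith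
        with \<open>e + Suc j \<le> n\<close> show ?thesis by (simp add: True)
      qed simp
    next
      case False
      have "u \<notin> vars (Var v ^ j :: ('d, 'a, 'k) dpoly)"
        using poly_in_power[OF poly_in_Var[of v "{v}"], of j] False by (auto simp: poly_in_def)
      then have "deg_in u (Var v ^ j :: ('d, 'a, 'k) dpoly) = 0" by (rule deg_in_notin)
      moreover have "deg_in u c \<le> n" using gn deg_in_coeff_in_le[of u v "e + Suc j" g] by (simp add: c_def)
      ultimately show ?thesis
        using deg_in_mult_le[of u "c * Var v ^ j" f] deg_in_mult_le[of u c "Var v ^ j"] fb by linarith
    qed
    with 1 show "deg_in u g1 \<le> n + b" unfolding g1_def by (rule deg_in_diff_le)
  qed
  from Suc.IH[OF g1W this deg] obtain g' where g': "a ^ j * g1 - g' \<in> J" "deg_in v g' \<le> e"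
    "bounded_exps (n + b + j * b) g'" "g' \<in> poly_in W" unfolding a_def by blast
  have "a ^ Suc j * g - g' = (a ^ j * g1 - g') + (a ^ j * c * Var v ^ j) * f"
    by (simp add: g1_def algebra_simps)
  also have "\<dots> \<in> J" by (rule diff_idealD(2)[OF J g'(1) diff_idealD(3)[OF J f(1)]])
  finally have "a ^ Suc j * g - g' \<in> J" .
  with g' show ?case unfolding a_def by (intro exI[of _ g']) (simp add: algebra_simps)
qed

text \<open>Reduction by f leaves at most \<open>e + 1\<close> powers of v, with coefficients whose
  exponents are at most \<open>n * Suc b\<close>. Applying the old bound to these coefficients
  multiplies the dimension by a constant, because \<open>Suc (n * Suc b)\<close> is at most
  \<open>Suc b * Suc n\<close>. The multiplier \<open>h'\<close> clears the leading coefficient and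
  the old multiplier together.\<close>

lemma poly_growth_step:
  assumes P: "prime_diff_ideal D P" and X: "poly_growth P s X"
    and f: "f \<in> P" "f \<in> poly_in (insert v X)" "v \<in> vars f" "coeff_in v (deg_in v f) f \<notin> P"
  shows "poly_growth P s (insert v X)"
proof -
  note J = prime_diff_idealD(1)[OF P]
  from X obtain h d B where h: "h \<notin> P" and B: "\<And>n. finite (B n)" "\<And>n. card (B n) \<le> d * Suc n ^ s"
    and red: "\<And>n g. g \<in> poly_in X \<Longrightarrow> bounded_exps n g \<Longrightarrow> \<exists>r. keys r \<subseteq> B n \<and> h ^ n * g - r \<in> P"
    unfolding poly_growth_def by blast
  obtain e where e: "deg_in v f = Suc e" using f(3) deg_in_pos_iff[of v f] gr0_implies_Suc by metis
  define a where "a = coeff_in v (Suc e) f"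
  define b where "b = mdeg f"
  define h' where "h' = a * h ^ Suc b"
  define B' where "B' n = (\<lambda>(m, i). m + single v i) ` (B (n * Suc b) \<times> {..e})" for n
  have h': "h' \<notin> P"
    using prime_diff_idealD(3)[OF P, of a "h ^ Suc b"] prime_diff_idealD(4)[OF P, of h "Suc b"] h f(4)
    unfolding h'_def a_def e by blast
  have finB': "finite (B' n)" for n unfolding B'_def using B(1) by blast
  have cardB': "card (B' n) \<le> (d * Suc b ^ s * Suc e) * Suc n ^ s" for n
  proof -
    have "card (B' n) \<le> card (B (n * Suc b) \<times> {..e})"
      unfolding B'_def using B(1) by (intro card_image_le) auto
    also have "\<dots> = card (B (n * Suc b)) * Suc e" by (simp add: card_cartesian_product)
    also have "\<dots> \<le> (d * Suc (n * Suc b) ^ s) * Suc e" using B(2) by (rule mult_le_mono1)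
    also have "\<dots> \<le> (d * (Suc b * Suc n) ^ s) * Suc e"
      by (intro mult_le_mono1 mult_le_mono2 power_mono) auto
    also have "\<dots> = (d * Suc b ^ s * Suc e) * Suc n ^ s" by (simp only: power_mult_distrib ac_simps)
    finally show ?thesis .
  qed
  have "\<exists>r. keys r \<subseteq> B' n \<and> h' ^ n * g - r \<in> P"
    if g: "g \<in> poly_in (insert v X)" "bounded_exps n g" for g n
  proof -
    have "deg_in v g \<le> e + n" using bounded_expsD[OF g(2), of v] by simp
    from reduce_bounded[OF J f(1) e bounded_exps_mdeg f(2) insertI1 g this] obtain g' where
      g': "a ^ n * g - g' \<in> P" "deg_in v g' \<le> e" "bounded_exps (n + n * b) g'"
        "g' \<in> poly_in (insert v X)" unfolding a_def b_def by blast
    have "\<exists>r. keys r \<subseteq> B (n * Suc b) \<and> h ^ (n * Suc b) * coeff_in v i g' - r \<in> P" for i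
    proof (rule red)
      show "coeff_in v i g' \<in> poly_in X"
        by (rule poly_in_mono[OF poly_in_coeff_in[OF g'(4)]]) auto
      show "bounded_exps (n * Suc b) (coeff_in v i g')"
        using bounded_exps_coeff_in[OF g'(3)] by simp
    qed
    then obtain r where r: "\<And>i. keys (r i) \<subseteq> B (n * Suc b)"
      "\<And>i. h ^ (n * Suc b) * coeff_in v i g' - r i \<in> P" by metis
    define r' where "r' = (\<Sum>i\<le>e. r i * Var v ^ i)"
    have "keys r' \<subseteq> B' n"
    proof
      fix m assume "m \<in> keys r'"
      then obtain i where i: "i \<le> e" "m \<in> keys (r i * Var v ^ i)"
        using keys_sum[of "\<lambda>i. r i * Var v ^ i" "{..e}"] unfolding r'_def by blast
      then obtain m' where "m' \<in> keys (r i)" "m = m' + single v i"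
        using keys_mult[of "r i" "Var v ^ i"] by (auto simp: Var_power)
      then show "m \<in> B' n" unfolding B'_def using i(1) r(1)[of i]
        by (intro image_eqI[of _ _ "(m', i)"]) auto
    qed
    moreover have "h' ^ n * g - r' \<in> P"
    proof -
      have hn: "h' ^ n = a ^ n * h ^ (n * Suc b)"
        by (simp only: h'_def power_mult_distrib power_mult[symmetric] mult.commute[of "Suc b"])
      have "h' ^ n * g - r' = h ^ (n * Suc b) * (a ^ n * g - g') + (h ^ (n * Suc b) * g' - r')"
        unfolding hn by (simp add: algebra_simps)
      also have "\<dots> \<in> P"
      proof (rule diff_idealD(2)[OF J diff_idealD(3)[OF J g'(1)]])
        have "h ^ (n * Suc b) * g' = h ^ (n * Suc b) * (\<Sum>i\<le>e. coeff_in v i g' * Var v ^ i)"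
          by (rule arg_cong[OF coeff_in_expand[OF g'(2)]])
        also have "\<dots> - r' = (\<Sum>i\<le>e. Var v ^ i * (h ^ (n * Suc b) * coeff_in v i g' - r i))"
          unfolding r'_def sum_distrib_left sum_subtractf[symmetric]
          by (rule sum.cong) (simp_all add: algebra_simps)
        also have "\<dots> \<in> P"
          by (intro diff_ideal_sum[OF J] diff_idealD(3)[OF J] r(2))
        finally show "h ^ (n * Suc b) * g' - r' \<in> P" .
      qed
      finally show ?thesis .
    qed
    ultimately show ?thesis by blast
  qed
  with h' finB' cardB' show ?thesis by (rule poly_growthI[of h' P B'])
qed

lemma alg_closure_growth:
  assumes P: "prime_diff_ideal D P" and v: "v \<in> alg_closure P S"
    and X: "S \<subseteq> X" "poly_growth P s X"
  shows "\<exists>X'. insert v X \<subseteq> X' \<and> poly_growth P s X'"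
  using v X
proof (induction arbitrary: X)
  case (base v)
  then show ?case by (intro exI[of _ X]) auto
next
  case (step f v)
  have "\<exists>X'. X \<union> V \<subseteq> X' \<and> poly_growth P s X'" if "finite V" "V \<subseteq> vars f - {v}" for V
    using that
  proof (induction V rule: finite_induct)
    case empty
    then show ?case using step.prems by (intro exI[of _ X]) auto
  next
    case (insert w V)
    then obtain X1 where X1: "X \<union> V \<subseteq> X1" "poly_growth P s X1" by auto
    have "\<exists>X'. insert w X1 \<subseteq> X' \<and> poly_growth P s X'"
      by (rule step.IH) (use insert.prems X1 step.prems(1) in auto)
    then show ?case using X1(1) by auto
  qed
  from this[of "vars f - {v}"] obtain X1 where X1: "X \<union> (vars f - {v}) \<subseteq> X1" "poly_growth P s X1"
    by auto
  have "poly_growth P s (insert v X1)"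
    by (rule poly_growth_step[OF P X1(2) step.hyps(1) _ step.hyps(3,4)])
      (use X1(1) in \<open>auto simp: poly_in_def\<close>)
  then show ?case using X1(1) by (intro exI[of _ "insert v X1"]) auto
qed

text \<open>Counting replaces the theory of transcendence degree: \<open>Suc n ^ card W\<close>
  monomials independent modulo P stay independent after multiplication by \<open>h ^ n\<close>, and
  must fit into a space of dimension at most \<open>d * Suc n ^ card S\<close> for every n.\<close>

lemma card_independent_le:
  assumes P: "prime_diff_ideal D P" and S: "finite S" and W: "finite W" "W \<subseteq> alg_closure P S"
    and indep: "P \<inter> poly_in W \<subseteq> {0}"
  shows "card W \<le> card S"
proof -
  note J = prime_diff_idealD(1)[OF P]
  have "\<exists>X. V \<subseteq> X \<and> S \<subseteq> X \<and> poly_growth P (card S) X" if "finite V" "V \<subseteq> alg_closure P S" for V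
    using that
  proof (induction V rule: finite_induct)
    case empty
    then show ?case using poly_growth_base[OF P S] by blast
  next
    case (insert w V)
    then obtain X where X: "V \<subseteq> X" "S \<subseteq> X" "poly_growth P (card S) X" by auto
    with alg_closure_growth[OF P _ X(2,3), of w] insert.prems obtain X' where
      "insert w X \<subseteq> X'" "poly_growth P (card S) X'" by auto
    with X show ?case by (intro exI[of _ X']) auto
  qed
  from this[OF W] obtain X where X: "W \<subseteq> X" "poly_growth P (card S) X" by auto
  then obtain h d B where h: "h \<notin> P" and B: "\<And>n. finite (B n)" "\<And>n. card (B n) \<le> d * Suc n ^ card S"
    and red: "\<And>n g. g \<in> poly_in X \<Longrightarrow> bounded_exps n g \<Longrightarrow> \<exists>r. keys r \<subseteq> B n \<and> h ^ n * g - r \<in> P"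
    unfolding poly_growth_def by blast
  have le: "Suc n ^ card W \<le> card (B n)" for n
  proof (rule ccontr)
    assume less: "\<not> Suc n ^ card W \<le> card (B n)"
    define M where "M = {m. keys m \<subseteq> W \<and> (\<forall>v. lookup m v \<le> n)}"
    have M: "finite M" "card M = Suc n ^ card W"
      using card_bounded_monomials[OF W(1), of n] by (simp_all add: M_def)
    have "\<exists>r. keys r \<subseteq> B n \<and> h ^ n * single m 1 - r \<in> P" if m: "m \<in> M" for m
    proof (rule red)
      show "single m 1 \<in> poly_in X" using m X(1) by (auto simp: poly_in_def vars_def M_def)
      show "bounded_exps n (single m 1)" using m by (auto simp: bounded_exps_def deg_in_def M_def)
    qed
    then obtain r where r: "\<And>m. m \<in> M \<Longrightarrow> keys (r m) \<subseteq> B n"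
      "\<And>m. m \<in> M \<Longrightarrow> h ^ n * single m 1 - r m \<in> P" by metis
    \<comment> \<open>With more monomials than equations there is a linear relation among the
      reduced monomials. Read back, it gives a nonzero g in \<open>k[W]\<close> with
      \<open>h ^ n * g\<close> in P, against independence.\<close>
    obtain c where c: "\<exists>m\<in>M. c m \<noteq> 0" "\<And>b. b \<in> B n \<Longrightarrow> (\<Sum>m\<in>M. c m * lookup (r m) b) = 0"
      using homogeneous_system_nontrivial[OF B(1)[of n] M(1), of "\<lambda>m b. lookup (r m) b"] less M(2) by auto
    have rs: "(\<Sum>m\<in>M. Const (c m) * r m) = 0"
    proof (rule poly_mapping_eqI)
      fix b
      show "lookup (\<Sum>m\<in>M. Const (c m) * r m) b = lookup 0 b"
      proof (cases "b \<in> B n")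
        case False
        then have "\<forall>m\<in>M. lookup (r m) b = 0" using r(1) by (meson in_keys_iff subsetD)
        then show ?thesis by (simp add: lookup_sum lookup_Const_mult)
      qed (simp add: lookup_sum lookup_Const_mult c(2))
    qed
    define g where "g = (\<Sum>m\<in>M. single m (c m))"
    have lg: "lookup g m = c m" if "m \<in> M" for m
    proof -
      have "lookup g m = (\<Sum>n\<in>M. if n = m then c m else 0)"
        unfolding g_def lookup_sum by (rule sum.cong) (auto simp: lookup_single when_def)
      then show ?thesis using that M(1) by simp
    qed
    have "h ^ n * g = (\<Sum>m\<in>M. Const (c m) * (h ^ n * single m 1 - r m)) + (\<Sum>m\<in>M. Const (c m) * r m)"
      unfolding g_def sum_distrib_left sum.distrib[symmetric]
      by (rule sum.cong[OF refl], subst single_conv_Const_mult) (simp add: algebra_simps)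
    also have "\<dots> \<in> P" unfolding rs add_0_right
      by (intro diff_ideal_sum[OF J] diff_idealD(3)[OF J] r(2))
    finally have "g \<in> P" using prime_diff_idealD(3,4)[OF P] h by blast
    moreover have "g \<in> poly_in W"
      unfolding g_def by (rule poly_in_sum) (auto simp: poly_in_def vars_def M_def)
    ultimately have "g = 0" using indep by blast
    with lg c(1) show False by auto
  qed
  show ?thesis
  proof (rule ccontr)
    assume "\<not> card W \<le> card S"
    \<comment> \<open>Taking n to be d is already enough: one additional factor \<open>Suc d\<close>
      exceeds the constant d.\<close>
    then have "Suc d ^ Suc (card S) \<le> Suc d ^ card W" by (intro power_increasing) auto
    also have "\<dots> \<le> d * Suc d ^ card S" using le[of d] B(2)[of d] by (rule order_trans)
    also have "\<dots> < Suc d ^ Suc (card S)" by simp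
    finally show False by simp
  qed
qed

end

subsection \<open>One derivation\<close>

locale ordinary = ranked_differential_ring D le
  for D :: "'d \<Rightarrow> 'k::field_char_0 \<Rightarrow> 'k" and le :: "('d, 'l::finite) dvar \<Rightarrow> ('d, 'l) dvar \<Rightarrow> bool" +
  assumes card_deriv: "CARD('d) = 1"
begin

definition delta :: 'd where "delta = (SOME d. True)"

lemma deriv_eq: "d = delta" for d :: 'd
proof -
  from card_deriv obtain x where x: "UNIV = {x :: 'd}" by (auto simp: card_1_singleton_iff)
  have "d \<in> {x}" "delta \<in> {x}" unfolding x[symmetric] by (rule UNIV_I)+
  then show ?thesis by simp
qed

lemma mset_eq: "\<theta> = replicate_mset (size \<theta>) delta" for \<theta> :: "'d multiset"
  using set_mset_subset_singletonD[of \<theta> delta] deriv_eq by auto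

text \<open>With a single derivation an operator is determined by its order, so a differential
  variable is handled as an indeterminate together with an order.\<close>

definition mk :: "'l \<Rightarrow> nat \<Rightarrow> ('d, 'l) dvar" where
  "mk j k = (replicate_mset k delta, j)"

definition mv :: "nat \<Rightarrow> ('d, 'l) dvar \<Rightarrow> ('d, 'l) dvar" where
  "mv k v = dapp (replicate_mset k delta) v"

lemma snd_mk [simp]: "snd (mk j k) = j"
  and dord_mk [simp]: "dord_var (mk j k) = k"
  and snd_mv [simp]: "snd (mv k v) = snd v"
  and dord_mv [simp]: "dord_var (mv k v) = k + dord_var v"
  and mv_0 [simp]: "mv 0 v = v"
  by (simp_all add: mk_def mv_def dapp_def dord_var_def)

lemma mk_snd_dord [simp]: "mk (snd v) (dord_var v) = v"
  unfolding mk_def dord_var_def using mset_eq[of "fst v"] by (metis prod.collapse)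

lemma dvar_eq_iff: "v = w \<longleftrightarrow> snd v = snd w \<and> dord_var v = dord_var w" for v w :: "('d, 'l) dvar"
  by (metis mk_snd_dord)

lemma dapp_eq_mv: "dapp \<theta> v = mv (size \<theta>) v"
  by (simp add: dvar_eq_iff) (simp add: dapp_def dord_var_def)

lemma mv_mv: "mv a (mv b v) = mv (a + b) v"
  by (simp add: dvar_eq_iff)

lemma mv_inj: "mv k v = mv k w \<longleftrightarrow> v = w"
  by (simp add: dvar_eq_iff)

lemma mv_eq_self_iff: "mv k v = v \<longleftrightarrow> k = 0"
  by (simp add: dvar_eq_iff)

lemma eq_mv_diff: "snd v = snd w \<Longrightarrow> dord_var v \<le> dord_var w \<Longrightarrow> w = mv (dord_var w - dord_var v) v"
  by (simp add: dvar_eq_iff)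

lemma le_mv: "le v (mv k v)"
  unfolding mv_def by (rule le_dapp)

lemma mv_mono: "le v w \<Longrightarrow> le (mv k v) (mv k w)"
  unfolding mv_def by (rule dapp_mono)

lemma mv_mono2: "le v w \<Longrightarrow> a \<le> b \<Longrightarrow> le (mv a v) (mv b w)"
  using le_trans[OF mv_mono[of v w a] le_mv[of "mv a w" "b - a"]] by (simp add: mv_mv)

abbreviation dl :: "('d, 'l, 'k) dpoly \<Rightarrow> ('d, 'l, 'k) dpoly" where
  "dl \<equiv> dderiv D delta"

lemma dapp_delta: "dapp {#delta#} v = mv 1 v"
  by (simp add: mv_def)

lemma vars_dl: "w \<in> vars (dl f) \<Longrightarrow> \<exists>u\<in>vars f. \<exists>k\<le>1. w = mv k u"
proof -
  assume "w \<in> vars (dl f)"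
  then consider "w \<in> vars f" | u where "u \<in> vars f" "w = mv 1 u"
    using vars_dderiv[of delta f] by (auto simp: dapp_delta)
  then show ?thesis
  proof cases
    case 1
    then show ?thesis by (intro bexI[of _ w] exI[of _ 0]) auto
  next
    case 2
    then show ?thesis by (intro bexI[of _ u] exI[of _ 1]) auto
  qed
qed

lemma dl_pow_mem: "diff_ideal D J \<Longrightarrow> f \<in> J \<Longrightarrow> (dl ^^ k) f \<in> J"
  by (induction k) (auto intro: diff_idealD(5))

text \<open>A derivative of f is linear in the newest derivative of v, with the same coefficient
  \<open>partial v f\<close> at every order. As no proper derivative of v occurs in f, no other term
  can reach it.\<close>

lemma dl_pow_form:
  assumes v: "\<And>j. mv (Suc j) v \<notin> vars f"
  shows "\<exists>T. (dl ^^ Suc k) f = partial v f * Var (mv (Suc k) v) + T \<and> mv (Suc k) v \<notin> vars T \<and>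
    (\<forall>w\<in>vars T. \<exists>u\<in>vars f. \<exists>i\<le>Suc k. w = mv i u)"
proof (induction k)
  case 0
  let ?c = "\<Sum>m\<in>keys f. single m (D delta (lookup f m))"
  let ?T = "?c + (\<Sum>w\<in>vars f - {v}. partial w f * Var (mv 1 w))"
  have "dl f = ?c + (\<Sum>w\<in>insert v (vars f). partial w f * Var (dapp {#delta#} w))"
    by (rule dderiv_alt) auto
  then have eq: "dl f = partial v f * Var (mv 1 v) + ?T"
    by (simp add: dapp_delta sum.insert_remove algebra_simps)
  have c: "vars ?c \<subseteq> vars f"
  proof
    fix w assume "w \<in> vars ?c"
    then obtain m where "m \<in> keys f" "w \<in> vars (single m (D delta (lookup f m)))"
      using vars_sum[of "\<lambda>m. single m (D delta (lookup f m))" "keys f"] by blast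
    then show "w \<in> vars f" using in_varsI[of m f w] by (auto simp: vars_def split: if_splits)
  qed
  have T: "w \<in> vars f \<or> (\<exists>u\<in>vars f - {v}. w = mv 1 u)" if "w \<in> vars ?T" for w
  proof -
    from that consider "w \<in> vars ?c"
      | "w \<in> vars (\<Sum>w\<in>vars f - {v}. partial w f * (Var (mv 1 w) :: ('d, 'l, 'k) dpoly))"
      using vars_add[of ?c "\<Sum>w\<in>vars f - {v}. partial w f * Var (mv 1 w)"] by blast
    then show ?thesis
    proof cases
      case 2
      then obtain u where u: "u \<in> vars f - {v}" "w \<in> vars (partial u f * (Var (mv 1 u) :: ('d, 'l, 'k) dpoly))"
        using vars_sum[of "\<lambda>w. partial w f * (Var (mv 1 w) :: ('d, 'l, 'k) dpoly)" "vars f - {v}"] by blast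
      then have "w \<in> vars (partial u f) \<union> {mv 1 u}" using vars_mult by fastforce
      with u(1) vars_partial[of u f] show ?thesis by blast
    qed (use c in blast)
  qed
  have "mv 1 v \<notin> vars ?T"
  proof
    assume "mv 1 v \<in> vars ?T"
    with T[of "mv 1 v"] v[of 0] show False by (auto simp: mv_inj)
  qed
  moreover have "\<forall>w\<in>vars ?T. \<exists>u\<in>vars f. \<exists>i\<le>1. w = mv i u"
  proof
    fix w assume "w \<in> vars ?T"
    from T[OF this] show "\<exists>u\<in>vars f. \<exists>i\<le>1. w = mv i u"
    proof
      assume "w \<in> vars f"
      then show ?thesis by (intro bexI[of _ w] exI[of _ 0]) auto
    next
      assume "\<exists>u\<in>vars f - {v}. w = mv 1 u"
      then obtain u where "u \<in> vars f" "w = mv 1 u" by blast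
      then show ?thesis by (intro bexI[of _ u] exI[of _ 1]) auto
    qed
  qed
  ultimately show ?case using eq by (intro exI[of _ ?T]) simp
next
  case (Suc k)
  then obtain T where T: "(dl ^^ Suc k) f = partial v f * Var (mv (Suc k) v) + T"
    "mv (Suc k) v \<notin> vars T" "\<And>w. w \<in> vars T \<Longrightarrow> \<exists>u\<in>vars f. \<exists>i\<le>Suc k. w = mv i u" by blast
  let ?T = "dl (partial v f) * Var (mv (Suc k) v) + dl T"
  have eq: "(dl ^^ Suc (Suc k)) f = partial v f * Var (mv (Suc (Suc k)) v) + ?T"
    unfolding funpow.simps(2)[of "Suc k"] o_apply T(1)
    by (simp add: dderiv_add dderiv_mult dderiv_Var dapp_delta mv_mv algebra_simps)
  have vT: "(\<exists>u\<in>vars f. \<exists>i\<le>1. w = mv i u) \<or> w = mv (Suc k) v \<or> (\<exists>u\<in>vars T. \<exists>i\<le>1. w = mv i u)"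
    if "w \<in> vars ?T" for w
  proof -
    from that have "w \<in> vars (dl (partial v f)) \<or> w = mv (Suc k) v \<or> w \<in> vars (dl T)"
      using vars_add[of "dl (partial v f) * Var (mv (Suc k) v)" "dl T"]
        vars_mult[of "dl (partial v f)" "Var (mv (Suc k) v)"] by auto
    moreover have "\<exists>u\<in>vars f. \<exists>i\<le>1. w = mv i u" if "w \<in> vars (dl (partial v f))"
      using vars_dl[OF that] vars_partial[of v f] by blast
    moreover have "\<exists>u\<in>vars T. \<exists>i\<le>1. w = mv i u" if "w \<in> vars (dl T)"
      by (rule vars_dl[OF that])
    ultimately show ?thesis by blast
  qed
  have nf: "mv i u \<noteq> mv (Suc (Suc k)) v" if "u \<in> vars f" "i < Suc (Suc k)" for i u
  proof
    assume eq: "mv i u = mv (Suc (Suc k)) v"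
    then have "u = mv (Suc (Suc k - i)) v" using that(2) by (auto simp: dvar_eq_iff)
    with v that(1) show False by blast
  qed
  have "mv (Suc (Suc k)) v \<notin> vars ?T"
  proof
    assume a: "mv (Suc (Suc k)) v \<in> vars ?T"
    have "\<not> (\<exists>u\<in>vars f. \<exists>i\<le>1. mv (Suc (Suc k)) v = mv i u)"
    proof
      assume "\<exists>u\<in>vars f. \<exists>i\<le>1. mv (Suc (Suc k)) v = mv i u"
      then obtain u i where "u \<in> vars f" "i \<le> 1" "mv (Suc (Suc k)) v = mv i u" by blast
      with nf[of u i] show False by simp
    qed
    moreover have "mv (Suc (Suc k)) v \<noteq> mv (Suc k) v" by (simp add: dvar_eq_iff)
    ultimately obtain u i where u: "u \<in> vars T" "i \<le> 1" "mv (Suc (Suc k)) v = mv i u"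
      using vT[OF a] by blast
    from T(3)[OF u(1)] obtain w j where w: "w \<in> vars f" "j \<le> Suc k" "u = mv j w" by blast
    show False
    proof (cases "i = 0")
      case True
      then show False using nf[of w j] w u by simp
    next
      case False
      with u(2) have "i = 1" by simp
      with u(3) have "u = mv (Suc k) v" by (simp add: dvar_eq_iff)
      with u(1) T(2) show False by simp
    qed
  qed
  moreover have "\<forall>w\<in>vars ?T. \<exists>u\<in>vars f. \<exists>i\<le>Suc (Suc k). w = mv i u"
  proof
    fix w assume w: "w \<in> vars ?T"
    from vT[OF w] consider u i where "u \<in> vars f" "i \<le> 1" "w = mv i u" | "w = mv (Suc k) v"
      | u i where "u \<in> vars T" "i \<le> 1" "w = mv i u" by blast
    then show "\<exists>u\<in>vars f. \<exists>i\<le>Suc (Suc k). w = mv i u"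
    proof cases
      case 1
      then show ?thesis by (intro bexI[of _ u] exI[of _ i]) auto
    next
      case 2
      \<comment> \<open>If v does not occur in f, then \<open>partial v f\<close> is zero and the
        summand that would contribute this variable vanishes.\<close>
      show ?thesis
      proof (cases "v \<in> vars f")
        case True
        then show ?thesis using 2 by (intro bexI[of _ v] exI[of _ "Suc k"]) auto
      next
        case False
        then have "?T = dl T" by (simp add: partial_notin)
        with w have "w \<in> vars (dl T)" by simp
        from vars_dl[OF this] obtain u i where ui: "u \<in> vars T" "i \<le> 1" "w = mv i u" by blast
        from T(3)[OF ui(1)] obtain u' j where "u' \<in> vars f" "j \<le> Suc k" "u = mv j u'" by blast
        with ui show ?thesis by (intro bexI[of _ u'] exI[of _ "i + j"]) (auto simp: mv_mv)
      qed
    next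
      case 3
      from T(3)[OF 3(1)] obtain u' j where "u' \<in> vars f" "j \<le> Suc k" "u = mv j u'" by blast
      with 3 show ?thesis by (intro bexI[of _ u'] exI[of _ "i + j"]) (auto simp: mv_mv)
    qed
  qed
  ultimately show ?case using eq by blast
qed

text \<open>The derivative of f has degree one in this variable with leading coefficient
  \<open>partial v f\<close>, which lies outside P, so it serves directly as a relation for the
  closure.\<close>

lemma closure_deriv_step:
  assumes P: "diff_ideal D P" and f: "f \<in> P" "partial v f \<notin> P"
    and v: "\<And>j. mv (Suc j) v \<notin> vars f"
    and cl: "\<And>u i. u \<in> vars f \<Longrightarrow> i \<le> Suc k \<Longrightarrow> mv i u \<noteq> mv (Suc k) v \<Longrightarrow> mv i u \<in> alg_closure P S"
  shows "mv (Suc k) v \<in> alg_closure P S"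
proof -
  let ?v = "mv (Suc k) v"
  obtain T where T: "(dl ^^ Suc k) f = partial v f * Var ?v + T" "?v \<notin> vars T"
    "\<And>w. w \<in> vars T \<Longrightarrow> \<exists>u\<in>vars f. \<exists>i\<le>Suc k. w = mv i u"
    using dl_pow_form[OF v, of k] by blast
  define g where "g = (dl ^^ Suc k) f"
  note Tg = T(1)[folded g_def]
  have nv: "?v \<notin> vars (partial v f)" using v[of k] vars_partial[of v f] by blast
  have co: "coeff_in ?v d g = (if d = 0 then T else if d = 1 then partial v f else 0)" for d
    using nv T(2)
    by (auto simp: Tg coeff_in_add coeff_in_mult_notin coeff_in_Var coeff_in_0_notin
        coeff_in_notin)
  have "partial v f \<noteq> 0" using f(2) diff_idealD(1)[OF P] by metis
  then have "1 \<le> deg_in ?v g" by (intro le_deg_in) (simp add: co)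
  moreover have "deg_in ?v g \<le> 1" by (simp add: deg_in_le_iff co)
  ultimately have deg: "deg_in ?v g = 1" by simp
  show ?thesis
  proof (rule alg_closure.step)
    show "g \<in> P" unfolding g_def by (rule dl_pow_mem[OF P f(1)])
    show "?v \<in> vars g" using deg_in_pos_iff[of ?v g] by (simp add: deg)
    show "coeff_in ?v (deg_in ?v g) g \<notin> P" using f(2) by (simp only: deg co) simp
    fix w assume w: "w \<in> vars g" "w \<noteq> ?v"
    then have "w \<in> vars (partial v f) \<or> w \<in> vars T"
      using vars_add[of "partial v f * Var ?v" T] vars_mult[of "partial v f" "Var ?v"]
      unfolding Tg by auto
    then have "\<exists>u\<in>vars f. \<exists>i\<le>Suc k. w = mv i u"
    proof
      assume "w \<in> vars (partial v f)"
      then have "w \<in> vars f" using vars_partial[of v f] by blast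
      then show ?thesis by (intro bexI[of _ w] exI[of _ 0]) auto
    qed (rule T(3))
    then show "w \<in> alg_closure P S" using cl w(2) by blast
  qed
qed

text \<open>For k = 0 the relation is f itself, with the initial as leading coefficient; for k > 0
  it is a derivative of f, with the separant.\<close>

lemma closure_leader_step:
  assumes P: "diff_ideal D P" and f: "f \<in> P" "f \<notin> range Const" "initial le f \<notin> P" "separant le f \<notin> P"
    and cl: "\<And>u i. u \<in> vars f \<Longrightarrow> i \<le> k \<Longrightarrow> mv i u \<noteq> mv k (leader le f) \<Longrightarrow> mv i u \<in> alg_closure P S"
  shows "mv k (leader le f) \<in> alg_closure P S"
proof (cases k)
  case 0
  show ?thesis unfolding 0 mv_0
  proof (rule alg_closure.step[OF f(1)])
    show "leader le f \<in> vars f" by (rule leader(1)[OF f(2)])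
    show "coeff_in (leader le f) (deg_in (leader le f) f) f \<notin> P"
      using f(3) by (simp add: initial_def)
    show "w \<in> alg_closure P S" if "w \<in> vars f" "w \<noteq> leader le f" for w
      using cl[of w 0] that by (simp add: 0)
  qed
next
  case (Suc k')
  have "mv (Suc j) (leader le f) \<notin> vars f" for j
  proof
    assume "mv (Suc j) (leader le f) \<in> vars f"
    then have "mv (Suc j) (leader le f) = leader le f" using leader(2)[OF f(2)] le_mv le_antisym by metis
    then show False by (simp add: mv_eq_self_iff)
  qed
  then show ?thesis
    using closure_deriv_step[OF P f(1), of "leader le f" k' S] f(4) cl
    unfolding separant_def Suc by blast
qed

lemma finite_has_least:
  assumes "finite X" "X \<noteq> {}"
  shows "\<exists>u\<in>X. \<forall>v\<in>X. le u v"
  using assms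
proof (induction X rule: finite_ne_induct)
  case (insert x X)
  then obtain u where u: "u \<in> X" "\<forall>v\<in>X. le u v" by blast
  show ?case
  proof (cases "le u x")
    case False
    then have "le x u" using le_total by blast
    with u have "\<forall>v\<in>insert x X. le x v" using le_trans le_refl by blast
    then show ?thesis by blast
  qed (use u in auto)
qed auto

text \<open>For each indeterminate only its derivative of least order in Q matters, since all others
  in Q rank above it. There are finitely many indeterminates, and a finite set has a least
  element.\<close>

lemma wf_ranking: "wf {(u, v). le u v \<and> u \<noteq> v}"
proof (rule wfI_min)
  fix v :: "('d, 'l) dvar" and Q assume v: "v \<in> Q"
  define X where "X = {mk j k | j k. mk j k \<in> Q \<and> (\<forall>k'<k. mk j k' \<notin> Q)}"
  have below: "\<exists>x\<in>X. le x w" if w: "w \<in> Q" for w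
  proof -
    have "mk (snd w) (dord_var w) \<in> Q" using w by simp
    define k where "k = (LEAST k. mk (snd w) k \<in> Q)"
    have k: "mk (snd w) k \<in> Q" "k \<le> dord_var w" "\<forall>k'<k. mk (snd w) k' \<notin> Q"
      unfolding k_def using LeastI[of "\<lambda>k. mk (snd w) k \<in> Q" "dord_var w"] \<open>mk (snd w) (dord_var w) \<in> Q\<close>
      by (auto intro: Least_le dest: not_less_Least)
    then have "mk (snd w) k \<in> X" by (auto simp: X_def)
    moreover have "w = mv (dord_var w - k) (mk (snd w) k)"
      using k(2) by (simp add: dvar_eq_iff)
    then have "le (mk (snd w) k) w" using le_mv by metis
    ultimately show ?thesis by blast
  qed
  have inj: "inj_on snd X"
  proof (rule inj_onI)
    fix x y assume "x \<in> X" "y \<in> X" "snd x = snd y"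
    then obtain j k k' where "x = mk j k" "y = mk j k'" "mk j k \<in> Q" "mk j k' \<in> Q"
      "\<forall>i<k. mk j i \<notin> Q" "\<forall>i<k'. mk j i \<notin> Q" by (auto simp: X_def)
    then show "x = y" by (metis linorder_neqE_nat)
  qed
  have "finite X" by (rule finite_imageD[OF _ inj]) (rule finite_subset[OF subset_UNIV finite])
  moreover have "X \<noteq> {}" using below[OF v] by blast
  ultimately obtain u where u: "u \<in> X" "\<forall>v\<in>X. le u v" using finite_has_least by blast
  have "u \<in> Q" using u(1) by (auto simp: X_def)
  moreover have "w \<notin> Q" if "le w u" "w \<noteq> u" for w
  proof
    assume "w \<in> Q"
    then obtain x where "x \<in> X" "le x w" using below by blast
    with u(2) have "le u w" using le_trans by blast
    with that show False using le_antisym by blast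
  qed
  ultimately show "\<exists>z\<in>Q. \<forall>y. (y, z) \<in> {(u, v). le u v \<and> u \<noteq> v} \<longrightarrow> y \<notin> Q" by blast
qed

text \<open>With one derivation, one of two leaders over the same indeterminate is a derivative of
  the other, and autoreducedness then makes them equal. Hence autoreduced sets are no longer than
  the number of indeterminates.\<close>

lemma leaders_distinct_snd:
  assumes A: "autoreduced le A" and f: "f \<in> set A" "g \<in> set A" "snd (leader le f) = snd (leader le g)"
  shows "f = g"
proof -
  have *: "f = g" if f: "f \<in> set A" "g \<in> set A" "snd (leader le f) = snd (leader le g)"
    "dord_var (leader le f) \<le> dord_var (leader le g)" for f g
  proof -
    define k where "k = dord_var (leader le g) - dord_var (leader le f)"
    have eq: "leader le g = mv k (leader le f)" unfolding k_def by (rule eq_mv_diff[OF f(3,4)])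
    have "leader le g \<in> vars g" by (rule leader(1)[OF autoreducedD(1)[OF A f(2)]])
    then have "dapp (replicate_mset k delta) (leader le f) \<in> vars g" by (simp add: eq mv_def)
    then have "replicate_mset k delta = {#}" by (rule autoreducedD(3)[OF A f(2,1)])
    then have "leader le f = leader le g" by (simp add: eq)
    then show "f = g" by (rule autoreducedD(5)[OF A f(1,2)])
  qed
  show ?thesis
    using *[OF f] *[OF f(2,1) f(3)[symmetric]] by (cases "dord_var (leader le f) \<le> dord_var (leader le g)") auto
qed

lemma nonleaders_iff:
  "v \<in> nonleaders le A \<longleftrightarrow>
    (\<forall>f\<in>set A. snd (leader le f) = snd v \<longrightarrow> dord_var v < dord_var (leader le f))"
proof -
  have *: "(\<exists>\<theta>. v = dapp \<theta> u) \<longleftrightarrow> snd u = snd v \<and> dord_var u \<le> dord_var v" for u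
  proof
    assume "\<exists>\<theta>. v = dapp \<theta> u"
    then show "snd u = snd v \<and> dord_var u \<le> dord_var v" by (auto simp: dapp_eq_mv)
  next
    assume "snd u = snd v \<and> dord_var u \<le> dord_var v"
    then have "v = mv (dord_var v - dord_var u) u" by (simp add: dvar_eq_iff)
    then show "\<exists>\<theta>. v = dapp \<theta> u" unfolding mv_def by blast
  qed
  have "v \<in> nonleaders le A \<longleftrightarrow> (\<forall>f\<in>set A. \<not> (\<exists>\<theta>. v = dapp \<theta> (leader le f)))"
    unfolding nonleaders_def by blast
  then show ?thesis unfolding * by (simp only: de_Morgan_conj not_le imp_conv_disj)
qed

end

subsection \<open>Regular elements modulo a characterizable ideal\<close>

lemma mem_ideal_if_coeffs:
  assumes J: "diff_ideal D J" and c: "\<And>d. coeff_in v d f \<in> J"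
  shows "f \<in> J"
proof -
  have "(\<Sum>d\<in>X. coeff_in v d f * Var v ^ d) \<in> J" if "finite X" for X
    using that
  proof (induction X rule: finite_induct)
    case empty
    then show ?case using J by (simp add: diff_ideal_def)
  next
    case (insert x X)
    have "Var v ^ x * coeff_in v x f \<in> J" using J c unfolding diff_ideal_def by blast
    with insert J show ?case by (simp add: diff_ideal_def mult.commute)
  qed
  then show ?thesis by (subst coeff_in_expand[OF order_refl, of f v]) simp
qed

text \<open>The presentation of I as a saturation is recorded in the form of cancellation of
  \<open>H le A\<close>.\<close>

locale characterized = ordinary D le
  for D :: "'d \<Rightarrow> 'k::field_char_0 \<Rightarrow> 'k" and le :: "('d, 'l::finite) dvar \<Rightarrow> ('d, 'l) dvar \<Rightarrow> bool" +
  fixes I :: "('d, 'l, 'k) dpoly set" and A :: "('d, 'l, 'k) dpoly list"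
  assumes I: "diff_ideal D I" and proper: "1 \<notin> I" and char_set: "char_set le I A"
    and H_cancel: "H le A * f \<in> I \<Longrightarrow> f \<in> I"
begin

abbreviation lead :: "nat \<Rightarrow> ('d, 'l) dvar" where "lead i \<equiv> leader le (A ! i)"

abbreviation N :: "('d, 'l) dvar set" where "N \<equiv> nonleaders le A"

text \<open>A tower over \<open>k[N]\<close> that adjoins the leaders in order of rank.
  \<open>A ! i\<close> lies over \<open>W (Suc i)\<close>, so reductions can proceed by induction on
  i.\<close>

definition W :: "nat \<Rightarrow> ('d, 'l) dvar set" where
  "W i = N \<union> leader le ` set (take i A)"

definition regular :: "('d, 'l, 'k) dpoly \<Rightarrow> bool" where
  "regular f \<longleftrightarrow> (\<forall>g. f * g \<in> I \<longrightarrow> g \<in> I)"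

lemma regularD: "regular f \<Longrightarrow> f * g \<in> I \<Longrightarrow> g \<in> I"
  unfolding regular_def by (erule allE, erule mp)

lemma regularI: "(\<And>g. f * g \<in> I \<Longrightarrow> g \<in> I) \<Longrightarrow> regular f"
  unfolding regular_def by (intro allI impI)

lemma regular_1: "regular 1"
  by (rule regularI) simp

lemma regular_mult: "regular f \<Longrightarrow> regular g \<Longrightarrow> regular (f * g)"
  by (rule regularI, rule regularD[of g], assumption, rule regularD[of f], assumption)
    (simp only: mult.assoc)

lemma regular_power: "regular f \<Longrightarrow> regular (f ^ n)"
  by (induction n) (simp_all add: regular_1 regular_mult)

lemma regular_dvd:
  assumes "regular f" "g dvd f"
  shows "regular g"
proof -
  from assms(2) obtain t where t: "f = g * t" by (elim dvdE)
  show ?thesis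
  proof (rule regularI)
    fix x assume "g * x \<in> I"
    then have "t * (g * x) \<in> I" by (rule diff_idealD(3)[OF I])
    then have "f * x \<in> I" by (simp add: t ac_simps)
    then show "x \<in> I" by (rule regularD[OF assms(1)])
  qed
qed

lemma autoreduced_A: "autoreduced le A" and A_subset: "set A \<subseteq> I"
  using char_set by (auto simp: char_set_def)

lemma A_not_Const: "i < length A \<Longrightarrow> A ! i \<notin> range Const"
  by (rule autoreducedD(1)[OF autoreduced_A]) simp

lemma A_in_I: "i < length A \<Longrightarrow> A ! i \<in> I"
  using A_subset by auto

lemma H_regular: "regular (H le A)"
  by (rule regularI) (rule H_cancel)

lemma initial_separant_dvd_H: "f \<in> set A \<Longrightarrow> initial le f * separant le f dvd H le A"
proof -
  assume "f \<in> set A"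
  then obtain xs ys where "A = xs @ f # ys" by (meson split_list)
  then have "H le A = (initial le f * separant le f) * (H le xs * H le ys)"
    by (simp add: H_def ac_simps)
  then show ?thesis by (simp only: dvd_triv_left)
qed

lemma initial_regular: "f \<in> set A \<Longrightarrow> regular (initial le f)"
  by (rule regular_dvd[OF H_regular dvd_mult_left[OF initial_separant_dvd_H]])

lemma separant_regular: "f \<in> set A \<Longrightarrow> regular (separant le f)"
  by (rule regular_dvd[OF H_regular dvd_mult_right[OF initial_separant_dvd_H]])

lemma lead_index_less:
  assumes "i < length A" "j < length A" "le (lead j) (lead i)" "lead j \<noteq> lead i"
  shows "j < i"
proof (rule ccontr)
  assume "\<not> j < i"
  with assms(4) have "i < j" by (metis linorder_neqE_nat)
  then have "rank_less le (rank le (A ! i)) (rank le (A ! j))"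
    using autoreduced_A assms(2) unfolding autoreduced_def sorted_wrt_iff_nth_less by blast
  then have "le (lead i) (lead j)" by (auto simp: rank_less_def rank_def)
  with assms(3,4) le_antisym show False by blast
qed

lemma lead_inj: "i < length A \<Longrightarrow> j < length A \<Longrightarrow> lead i = lead j \<Longrightarrow> i = j"
  using autoreducedD(5)[OF autoreduced_A, of "A ! i" "A ! j"] autoreducedD(4)[OF autoreduced_A]
  by (simp add: nth_eq_iff_index_eq)

lemma lead_notin_N: "i < length A \<Longrightarrow> lead i \<notin> N"
  using leader_notin_nonleaders[of "A ! i" A "{#}"] by simp

lemma W_0: "W 0 = N"
  by (simp add: W_def)

lemma W_Suc: "i < length A \<Longrightarrow> W (Suc i) = insert (lead i) (W i)"
  by (simp add: W_def take_Suc_conv_app_nth)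

lemma W_mono: "i \<le> j \<Longrightarrow> W i \<subseteq> W j"
  unfolding W_def using set_take_subset_set_take[of i j A] by blast

lemma N_subset_W: "N \<subseteq> W i"
  by (simp add: W_def)

lemma W_cases:
  assumes "v \<in> W i" "i \<le> length A"
  shows "v \<in> N \<or> (\<exists>j<i. v = lead j)"
proof -
  have "v \<in> N \<or> v \<in> leader le ` ((!) A ` {0..<i})"
    using assms(1) unfolding W_def nth_image[OF assms(2)] by simp
  then show ?thesis by force
qed

lemma lead_notin_W: "i \<le> j \<Longrightarrow> j < length A \<Longrightarrow> lead j \<notin> W i"
proof
  assume ij: "i \<le> j" "j < length A" and "lead j \<in> W i"
  then obtain l where "l < i" "lead j = lead l"
    using W_cases[of "lead j" i] lead_notin_N[of j] by auto
  with lead_inj[of j l] ij show False by simp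
qed

lemma deg_lead_W: "f \<in> poly_in (W i) \<Longrightarrow> i \<le> j \<Longrightarrow> j < length A \<Longrightarrow> deg_in (lead j) f = 0"
  using lead_notin_W by (intro deg_in_notin) (auto simp: poly_in_def)

lemma vars_cases:
  assumes g: "g \<in> set A" and v: "v \<in> vars g" "v \<notin> N"
  shows "\<exists>h\<in>set A. v = leader le h"
proof -
  from v(2) obtain \<theta> h where h: "h \<in> set A" "v = dapp \<theta> (leader le h)"
    by (auto simp: nonleaders_def)
  with v(1) have "\<theta> = {#}" using autoreducedD(3)[OF autoreduced_A g h(1)] by blast
  with h show ?thesis by auto
qed

lemma vars_subset_W:
  assumes f: "\<And>v. v \<in> vars f \<Longrightarrow> v \<in> N \<or> (\<exists>h\<in>set A. v = leader le h)"
    and le: "\<And>v. v \<in> vars f \<Longrightarrow> le v (lead i)" and i: "i < length A"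
  shows "f \<in> poly_in (W (Suc i))"
proof -
  have "v \<in> W (Suc i)" if v: "v \<in> vars f" for v
  proof (cases "v \<in> N")
    case False
    with f[OF v] obtain j where j: "j < length A" "v = lead j" by (auto simp: in_set_conv_nth)
    show ?thesis
    proof (cases "j = i")
      case False
      then have "lead j \<noteq> lead i" using lead_inj i j(1) by blast
      then have "j < i" using lead_index_less[OF i j(1)] le[OF v] j(2) by blast
      then have "v \<in> W (Suc j)" using j by (simp add: W_Suc)
      then show ?thesis using W_mono[of "Suc j" "Suc i"] \<open>j < i\<close> by auto
    qed (use i j in \<open>simp add: W_Suc\<close>)
  qed (use N_subset_W in blast)
  then show ?thesis by (auto simp: poly_in_def)
qed

lemma A_in_W: "i < length A \<Longrightarrow> A ! i \<in> poly_in (W (Suc i))"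
  using vars_cases[of "A ! i"] leader(2)[OF A_not_Const] by (intro vars_subset_W) auto

text \<open>Proper derivatives of leaders and the later leaders do not occur in \<open>W i\<close>
  at all, so the degrees in the first i leaders decide reducedness.\<close>

lemma reduced_zero:
  assumes r: "r \<in> I" "r \<in> poly_in (W i)" "i \<le> length A"
    and deg: "\<And>j. j < i \<Longrightarrow> deg_in (lead j) r < deg_in (lead j) (A ! j)"
  shows "r = 0"
proof (rule char_set_reduced_zero[OF I proper char_set r(1)])
  fix g assume "g \<in> set A"
  then obtain j where j: "j < length A" "g = A ! j" by (auto simp: in_set_conv_nth)
  have "dapp \<theta> (lead j) \<notin> vars r" if "\<theta> \<noteq> {#}" for \<theta>
  proof
    assume "dapp \<theta> (lead j) \<in> vars r"
    then have "dapp \<theta> (lead j) \<in> W i" using r(2) by (auto simp: poly_in_def)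
    moreover have "dapp \<theta> (lead j) \<notin> N" using leader_notin_nonleaders[of "A ! j" A \<theta>] j by simp
    ultimately obtain l where l: "l < i" "dapp \<theta> (lead j) = lead l" using W_cases[OF _ r(3)] by blast
    then have "dapp \<theta> (lead j) \<in> vars (A ! l)" using leader(1)[OF A_not_Const] r(3) by simp
    then have "\<theta> = {#}" using autoreducedD(3)[OF autoreduced_A, of "A ! l" "A ! j"] l j r(3) by simp
    with that show False by blast
  qed
  moreover have "deg_in (lead j) r < deg_in (lead j) g"
  proof (cases "j < i")
    case False
    then have "deg_in (lead j) r = 0" using deg_lead_W[OF r(2)] j by simp
    then show ?thesis using deg_leader_pos[OF A_not_Const] j by simp
  qed (use deg j in simp)
  ultimately show "reduced le r g" by (simp add: reduced_def j)
qed

lemma mult_N_deg_le: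
  fixes w f :: "('d, 'l, 'k) dpoly"
  assumes "w \<in> poly_in N" "i < length A"
  shows "deg_in (lead i) (w * f) \<le> deg_in (lead i) f"
proof -
  have "deg_in (lead i) w = 0"
    using assms lead_notin_N by (intro deg_in_notin) (auto simp: poly_in_def)
  then show ?thesis using deg_in_mult_le[of "lead i" w f] by simp
qed

text \<open>The polynomials that are congruent, after multiplication by a power of \<open>H\<close>, to one without
  proper derivatives of leaders form a subring.\<close>

lemma partial_reduction: "\<exists>m. \<exists>r\<in>poly_in (W (length A)). H le A ^ m * f - r \<in> I"
proof -
  let ?H = "H le A" and ?R = "poly_in (W (length A)) :: ('d, 'l, 'k) dpoly set"
  define Q where "Q f \<longleftrightarrow> (\<exists>m. \<exists>r\<in>?R. ?H ^ m * f - r \<in> I)" for f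
  have QR: "Q f" if "f \<in> ?R" for f
    unfolding Q_def using that diff_idealD(1)[OF I] by (intro exI[of _ 0] bexI[of _ f]) auto
  have AR: "g \<in> ?R" if "g \<in> set A" for g
  proof -
    from that obtain i where i: "i < length A" "g = A ! i" by (auto simp: in_set_conv_nth)
    then show ?thesis using poly_in_mono[OF A_in_W[OF i(1)] W_mono[of "Suc i" "length A"]] by simp
  qed
  have sepR: "separant le g \<in> ?R" and iniR: "initial le g \<in> ?R" if "g \<in> set A" for g
    unfolding separant_def initial_def
    using poly_in_partial[OF AR[OF that]] poly_in_mono[OF poly_in_coeff_in[OF AR[OF that]] Diff_subset]
    by blast+
  have prodR: "prod_list xs \<in> ?R" if "\<And>x. x \<in> set xs \<Longrightarrow> x \<in> ?R" for xs
    using that by (induction xs) (auto intro: poly_in_mult)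
  have HR: "?H \<in> ?R"
    unfolding H_def by (rule prodR) (use sepR iniR in \<open>auto intro!: poly_in_mult\<close>)
  have Qadd: "Q (f + g)" if "Q f" "Q g" for f g
  proof -
    from that obtain m n r s where rs: "r \<in> ?R" "?H ^ m * f - r \<in> I" "s \<in> ?R" "?H ^ n * g - s \<in> I"
      unfolding Q_def by blast
    have "?H ^ (m + n) * (f + g) - (?H ^ n * r + ?H ^ m * s) =
        ?H ^ n * (?H ^ m * f - r) + ?H ^ m * (?H ^ n * g - s)"
      by (simp add: power_add algebra_simps)
    also have "\<dots> \<in> I" by (intro diff_idealD(2,3)[OF I] rs)
    finally show ?thesis unfolding Q_def using HR rs
      by (intro exI[of _ "m + n"] bexI[of _ "?H ^ n * r + ?H ^ m * s"])
        (auto intro: poly_in_add poly_in_mult poly_in_power)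
  qed
  have Qmult: "Q (f * g)" if "Q f" "Q g" for f g
  proof -
    from that obtain m n r s where rs: "r \<in> ?R" "?H ^ m * f - r \<in> I" "s \<in> ?R" "?H ^ n * g - s \<in> I"
      unfolding Q_def by blast
    have "?H ^ (m + n) * (f * g) - r * s =
        (?H ^ m * f) * (?H ^ n * g - s) + s * (?H ^ m * f - r)"
      by (simp add: power_add algebra_simps)
    also have "\<dots> \<in> I" by (intro diff_idealD(2,3)[OF I] rs)
    finally show ?thesis unfolding Q_def using rs
      by (intro exI[of _ "m + n"] bexI[of _ "r * s"]) (auto intro: poly_in_mult)
  qed
  have Qpoly: "Q f" if "\<And>v. v \<in> vars f \<Longrightarrow> Q (Var v)" for f
    by (rule mpoly_induct[of Q f, OF QR that Qadd Qmult]) simp_all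
  have Qvar: "Q (Var v)" for v
  proof (induction v rule: wf_induct_rule[OF wf_ranking])
    case (1 v)
    show ?case
    proof (cases "v \<in> W (length A)")
      case True
      then show ?thesis by (intro QR poly_in_Var)
    next
      case False
      then have "v \<notin> N" using N_subset_W by blast
      then obtain \<theta> g where g: "g \<in> set A" "v = dapp \<theta> (leader le g)"
        by (auto simp: nonleaders_def)
      have gc: "g \<notin> range Const" by (rule autoreducedD(1)[OF autoreduced_A g(1)])
      obtain k where k: "v = mv k (leader le g)" using g(2) dapp_eq_mv by blast
      have "k \<noteq> 0"
      proof
        assume "k = 0"
        then have "v \<in> leader le ` set A" using k g(1) by simp
        then show False using False by (simp add: W_def)
      qed
      then obtain k' where k': "k = Suc k'" using not0_implies_Suc by blast
      have nv: "mv (Suc j) (leader le g) \<notin> vars g" for j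
      proof
        assume "mv (Suc j) (leader le g) \<in> vars g"
        then have "mv (Suc j) (leader le g) = leader le g"
          using leader(2)[OF gc] le_mv le_antisym by metis
        then show False by (simp add: mv_eq_self_iff)
      qed
      obtain T where T: "(dl ^^ Suc k') g = partial (leader le g) g * Var v + T" "v \<notin> vars T"
        "\<And>w. w \<in> vars T \<Longrightarrow> \<exists>u\<in>vars g. \<exists>i\<le>Suc k'. w = mv i u"
        using dl_pow_form[of "leader le g" g k'] nv unfolding k k' by blast
      have "Q T"
      proof (rule Qpoly)
        fix w assume w: "w \<in> vars T"
        from T(3)[OF w] obtain u i where u: "u \<in> vars g" "i \<le> Suc k'" "w = mv i u" by blast
        then have "le w v" using mv_mono2[OF leader(2)[OF gc u(1)], of i "Suc k'"] by (simp add: k k')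
        moreover have "w \<noteq> v" using w T(2) by blast
        ultimately show "Q (Var w)" by (intro 1) simp
      qed
      \<comment> \<open>The cofactor s turns the coefficient of v in the derivative of g into
        \<open>H le A\<close>. Thus H times v is congruent to \<open>- (s * T)\<close>, where s has
        no proper derivatives of leaders and the variables of T rank below v.\<close>
      have "separant le g dvd ?H" using initial_separant_dvd_H[OF g(1)] by (rule dvd_mult_right)
      then obtain s where s: "?H = separant le g * s" by (elim dvdE)
      have "H le A \<noteq> 0" using regularD[OF H_regular, of 1] proper diff_idealD(1)[OF I] by auto
      then have "s \<in> ?R" using dvd_poly_in[of s ?H, OF _ _ HR] s by auto
      then have "Q (- (s * T))"
        using Qmult[OF QR[of "- s"] \<open>Q T\<close>] poly_in_uminus by auto
      then obtain m r where r: "r \<in> ?R" "?H ^ m * (- (s * T)) - r \<in> I" unfolding Q_def by blast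
      have "?H ^ m * (s * (dl ^^ Suc k') g) \<in> I"
        using g(1) A_subset by (intro diff_idealD(3)[OF I] dl_pow_mem[OF I]) auto
      moreover have "?H ^ Suc m * Var v - r =
          ?H ^ m * (s * (dl ^^ Suc k') g) + (?H ^ m * (- (s * T)) - r)"
        unfolding T(1) power_Suc2 by (subst (2) s) (simp add: separant_def algebra_simps)
      ultimately have "?H ^ Suc m * Var v - r \<in> I" using diff_idealD(2)[OF I _ r(2)] by metis
      with r(1) show ?thesis unfolding Q_def by blast
    qed
  qed
  then have "Q f" by (rule Qpoly)
  then show ?thesis by (simp add: Q_def)
qed

text \<open>The highest leader is reduced first, then the coefficients with respect to it, which lie
  one level lower. These coefficients must share one multiplier if they are to be reassembled, which
  is why a finite set is treated with a common h.\<close>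

lemma algebraic_reduction:
  assumes "i \<le> length A" "finite X" "X \<subseteq> poly_in (W i)"
  shows "\<exists>h r. regular h \<and> (\<forall>x\<in>X. r x \<in> poly_in (W i) \<and> h * x - r x \<in> I \<and>
    (\<forall>j<i. deg_in (lead j) (r x) < deg_in (lead j) (A ! j)))"
  using assms
proof (induction i arbitrary: X)
  case 0
  then show ?case using regular_1 diff_idealD(1)[OF I] by (intro exI[of _ 1] exI[of _ "\<lambda>x. x"]) auto
next
  case (Suc i)
  let ?v = "lead i"
  from Suc.prems(1) have i: "i < length A" by simp
  obtain e where e: "deg_in ?v (A ! i) = Suc e"
    using deg_leader_pos[OF A_not_Const[OF i]] gr0_implies_Suc by blast
  define a where "a = coeff_in ?v (Suc e) (A ! i)"
  have areg: "regular a"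
    using initial_regular[of "A ! i"] i by (simp add: a_def initial_def e)
  define n where "n = (\<Sum>x\<in>X. deg_in ?v x)"
  have "\<exists>q s. a ^ n * x = q * (A ! i) + s \<and> deg_in ?v s \<le> e \<and> s \<in> poly_in (W (Suc i))"
    if x: "x \<in> X" for x
  proof -
    have "deg_in ?v x \<le> n" unfolding n_def by (rule member_le_sum[OF x]) (use Suc.prems in auto)
    then have "deg_in ?v x \<le> e + n" by simp
    moreover have "?v \<in> W (Suc i)" using W_Suc[OF i] by simp
    moreover have "x \<in> poly_in (W (Suc i))" using x Suc.prems(3) by blast
    ultimately show ?thesis
      using pseudo_division[OF e _ A_in_W[OF i], of x n] unfolding a_def by blast
  qed
  then obtain q s where qs: "\<And>x. x \<in> X \<Longrightarrow> a ^ n * x = q x * (A ! i) + s x"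
    "\<And>x. x \<in> X \<Longrightarrow> deg_in ?v (s x) \<le> e" "\<And>x. x \<in> X \<Longrightarrow> s x \<in> poly_in (W (Suc i))" by metis
  have cW: "coeff_in ?v l f \<in> poly_in (W i)" if "f \<in> poly_in (W (Suc i))" for l f
    by (rule poly_in_mono[OF poly_in_coeff_in[OF that]]) (auto simp: W_Suc[OF i])
  define Y where "Y = (\<lambda>(x, l). coeff_in ?v l (s x)) ` (X \<times> {..e})"
  have "finite Y" unfolding Y_def using Suc.prems(2) by simp
  moreover have "Y \<subseteq> poly_in (W i)" unfolding Y_def using cW qs(3) by auto
  ultimately obtain h r0 where h: "regular h" and r0: "\<forall>y\<in>Y. r0 y \<in> poly_in (W i) \<and>
    h * y - r0 y \<in> I \<and> (\<forall>j<i. deg_in (lead j) (r0 y) < deg_in (lead j) (A ! j))"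
    using Suc.IH[of Y] i by auto
  define r where "r z = r0 (coeff_in ?v (snd z) (s (fst z)))" for z
  have inY: "coeff_in ?v l (s x) \<in> Y" if "x \<in> X" "l \<le> e" for x l
    unfolding Y_def using that by (intro image_eqI[of _ _ "(x, l)"]) auto
  have r: "\<And>x l. x \<in> X \<Longrightarrow> l \<le> e \<Longrightarrow> r (x, l) \<in> poly_in (W i)"
    "\<And>x l. x \<in> X \<Longrightarrow> l \<le> e \<Longrightarrow> h * coeff_in ?v l (s x) - r (x, l) \<in> I"
    "\<And>x l j. x \<in> X \<Longrightarrow> l \<le> e \<Longrightarrow> j < i \<Longrightarrow> deg_in (lead j) (r (x, l)) < deg_in (lead j) (A ! j)"
    using r0 inY unfolding r_def by simp_all
  define r' where "r' x = (\<Sum>l\<le>e. r (x, l) * Var ?v ^ l)" for x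
  have "r' x \<in> poly_in (W (Suc i)) \<and> h * a ^ n * x - r' x \<in> I \<and>
      (\<forall>j<Suc i. deg_in (lead j) (r' x) < deg_in (lead j) (A ! j))" if x: "x \<in> X" for x
  proof (intro conjI allI impI)
    have "r (x, l) \<in> poly_in (W (Suc i))" if "l \<le> e" for l
      using poly_in_mono[OF r(1)[OF x that] W_mono[of i "Suc i"]] by simp
    moreover have "(Var ?v :: ('d, 'l, 'k) dpoly) \<in> poly_in (W (Suc i))"
      using W_Suc[OF i] by (intro poly_in_Var) simp
    ultimately show "r' x \<in> poly_in (W (Suc i))"
      unfolding r'_def by (intro poly_in_sum poly_in_mult poly_in_power) auto
    have "h * s x = h * (\<Sum>l\<le>e. coeff_in ?v l (s x) * Var ?v ^ l)"
      by (rule arg_cong[OF coeff_in_expand[OF qs(2)[OF x]]])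
    then have "h * s x - r' x = (\<Sum>l\<le>e. Var ?v ^ l * (h * coeff_in ?v l (s x) - r (x, l)))"
      unfolding r'_def sum_distrib_left by (simp add: sum_subtractf[symmetric] algebra_simps)
    also have "\<dots> \<in> I"
      by (intro diff_ideal_sum[OF I] diff_idealD(3)[OF I] r(2)[OF x]) simp
    finally have 1: "h * s x - r' x \<in> I" .
    have "h * a ^ n * x - r' x = (h * q x) * (A ! i) + (h * s x - r' x)"
      unfolding mult.assoc qs(1)[OF x] by (simp add: algebra_simps)
    also have "\<dots> \<in> I" by (intro diff_idealD(2)[OF I _ 1] diff_idealD(3)[OF I] A_in_I i)
    finally show "h * a ^ n * x - r' x \<in> I" .
    fix j assume j: "j < Suc i"
    show "deg_in (lead j) (r' x) < deg_in (lead j) (A ! j)"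
    proof (cases "j = i")
      case True
      have "deg_in ?v (r (x, l) * Var ?v ^ l) \<le> e" if "l \<le> e" for l
      proof -
        have "deg_in ?v (r (x, l)) = 0" using deg_lead_W[OF r(1)[OF x that] order_refl i] .
        moreover have "deg_in ?v (Var ?v ^ l :: ('d, 'l, 'k) dpoly) \<le> l"
          by (simp add: deg_in_le_iff coeff_in_Var_power)
        ultimately show ?thesis using deg_in_mult_le[of ?v "r (x, l)" "Var ?v ^ l"] that by linarith
      qed
      then have "deg_in ?v (r' x) \<le> e" unfolding r'_def by (intro deg_in_sum_le) simp
      then show ?thesis by (simp add: True e)
    next
      case False
      with j have ji: "j < i" by simp
      then have ne: "lead j \<noteq> ?v" using lead_inj[of j i] i by auto
      have "deg_in (lead j) (r (x, l) * Var ?v ^ l) \<le> deg_in (lead j) (A ! j) - 1" if "l \<le> e" for l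
      proof -
        have "lead j \<notin> vars (Var ?v ^ l :: ('d, 'l, 'k) dpoly)"
          using poly_in_power[OF poly_in_Var[of ?v "{?v}"], of l] ne by (auto simp: poly_in_def)
        then have "deg_in (lead j) (Var ?v ^ l :: ('d, 'l, 'k) dpoly) = 0" by (rule deg_in_notin)
        then show ?thesis
          using deg_in_mult_le[of "lead j" "r (x, l)" "Var ?v ^ l"] r(3)[OF x that ji] by linarith
      qed
      then have "deg_in (lead j) (r' x) \<le> deg_in (lead j) (A ! j) - 1"
        unfolding r'_def by (intro deg_in_sum_le) simp
      moreover have "0 < deg_in (lead j) (A ! j)"
        using deg_leader_pos[OF A_not_Const] ji i by simp
      ultimately show ?thesis by linarith
    qed
  qed
  moreover have "regular (h * a ^ n)" by (intro regular_mult regular_power h areg)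
  ultimately show ?case by (intro exI[of _ "h * a ^ n"] exI[of _ r']) blast
qed

text \<open>Up to a regular multiplier, f is congruent to a reduced r. A factor w from
  \<open>k[N]\<close> is free of leaders, so \<open>w * r\<close> is still reduced; lying in I it
  vanishes, and therefore r does.\<close>

lemma N_regular:
  assumes w: "w \<in> poly_in N" "w \<noteq> 0"
  shows "regular w"
proof (rule regularI)
  fix f assume wf: "w * f \<in> I"
  obtain m r0 where r0: "r0 \<in> poly_in (W (length A))" "H le A ^ m * f - r0 \<in> I"
    using partial_reduction by blast
  obtain h r where h: "regular h" and r: "r \<in> poly_in (W (length A))" "h * r0 - r \<in> I"
    "\<And>j. j < length A \<Longrightarrow> deg_in (lead j) r < deg_in (lead j) (A ! j)"
    using algebraic_reduction[of "length A" "{r0}"] r0(1) by auto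
  have "h * H le A ^ m * f - r = h * (H le A ^ m * f - r0) + (h * r0 - r)"
    by (simp add: algebra_simps)
  also have "\<dots> \<in> I" by (intro diff_idealD(2)[OF I _ r(2)] diff_idealD(3)[OF I] r0)
  finally have fr: "h * H le A ^ m * f - r \<in> I" .
  have "w * r = h * H le A ^ m * (w * f) - w * (h * H le A ^ m * f - r)"
    by (simp add: algebra_simps)
  also have "\<dots> \<in> I" by (intro diff_ideal_diff[OF I] diff_idealD(3)[OF I] wf fr)
  finally have "w * r \<in> I" .
  moreover have "w * r \<in> poly_in (W (length A))"
    using poly_in_mult[OF poly_in_mono[OF w(1) N_subset_W] r(1)] .
  moreover have "deg_in (lead j) (w * r) < deg_in (lead j) (A ! j)" if "j < length A" for j
    using mult_N_deg_le[OF w(1) that, of r] r(3)[OF that] by linarith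
  ultimately have "w * r = 0" using reduced_zero[of "w * r" "length A"] by blast
  with w(2) have "r = 0" by simp
  with fr have "h * H le A ^ m * f \<in> I" by simp
  moreover have "regular (h * H le A ^ m)" by (intro regular_mult regular_power h H_regular)
  ultimately show "f \<in> I" using regularD by blast
qed

text \<open>Below the degree of \<open>A ! i\<close>, powers of its leader are linearly independent
  modulo I over the lower level. Reducing all coefficients with one multiplier gives a reduced
  element of I, which is zero coefficient by coefficient.\<close>

lemma coeff_in_mem:
  assumes i: "i < length A" and F: "F \<in> I" "F \<in> poly_in (W (Suc i))"
    "deg_in (lead i) F < deg_in (lead i) (A ! i)"
  shows "coeff_in (lead i) l F \<in> I"
proof (cases "l \<le> deg_in (lead i) F")
  case True
  let ?v = "lead i"
  define e where "e = deg_in ?v F"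
  have cW: "coeff_in ?v l F \<in> poly_in (W i)" for l
    by (rule poly_in_mono[OF poly_in_coeff_in[OF F(2)]]) (auto simp: W_Suc[OF i])
  obtain h r0 where h: "regular h" and r0: "\<forall>x\<in>(\<lambda>l. coeff_in ?v l F) ` {..e}.
    r0 x \<in> poly_in (W i) \<and> h * x - r0 x \<in> I \<and>
    (\<forall>j<i. deg_in (lead j) (r0 x) < deg_in (lead j) (A ! j))"
    using algebraic_reduction[of i "(\<lambda>l. coeff_in ?v l F) ` {..e}"] i cW by auto
  define r where "r l = r0 (coeff_in ?v l F)" for l
  have r: "\<And>l. l \<le> e \<Longrightarrow> r l \<in> poly_in (W i)" "\<And>l. l \<le> e \<Longrightarrow> h * coeff_in ?v l F - r l \<in> I"
    "\<And>l j. l \<le> e \<Longrightarrow> j < i \<Longrightarrow> deg_in (lead j) (r l) < deg_in (lead j) (A ! j)"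
    using r0 by (simp_all add: r_def)
  define R where "R = (\<Sum>l\<le>e. r l * Var ?v ^ l)"
  have vr: "?v \<notin> vars (r l)" if "l \<le> e" for l
    using r(1)[OF that] lead_notin_W[OF order_refl i] by (auto simp: poly_in_def)
  have co: "coeff_in ?v d R = (if d \<le> e then r d else 0)" for d
  proof -
    have "coeff_in ?v d R = (\<Sum>l\<le>e. if l = d then r d else 0)"
      unfolding R_def coeff_in_sum
      by (rule sum.cong) (use vr in \<open>auto simp: coeff_in_mult_notin coeff_in_Var_power\<close>)
    then show ?thesis by simp
  qed
  have "h * F = h * (\<Sum>l\<le>e. coeff_in ?v l F * Var ?v ^ l)"
    by (rule arg_cong[OF coeff_in_expand]) (simp add: e_def)
  then have "h * F - R = (\<Sum>l\<le>e. Var ?v ^ l * (h * coeff_in ?v l F - r l))"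
    unfolding R_def sum_distrib_left by (simp add: sum_subtractf[symmetric] algebra_simps)
  also have "\<dots> \<in> I" by (intro diff_ideal_sum[OF I] diff_idealD(3)[OF I] r(2)) simp
  finally have hR: "h * F - R \<in> I" .
  have "h * F - (h * F - R) \<in> I"
    by (rule diff_ideal_diff[OF I diff_idealD(3)[OF I F(1)] hR])
  moreover have "h * F - (h * F - R) = R" by simp
  ultimately have "R \<in> I" by (simp only:)
  moreover have "R \<in> poly_in (W (Suc i))"
    unfolding R_def using r(1) W_mono[of i "Suc i"] W_Suc[OF i]
    by (intro poly_in_sum poly_in_mult poly_in_power poly_in_Var) (auto intro: poly_in_mono)
  moreover have "deg_in (lead j) R < deg_in (lead j) (A ! j)" if j: "j < Suc i" for j
  proof (cases "j = i")
    case True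
    have "deg_in ?v R \<le> e" by (simp add: deg_in_le_iff co)
    with F(3) show ?thesis by (simp add: True e_def)
  next
    case False
    with j have ji: "j < i" by simp
    then have ne: "lead j \<noteq> ?v" using lead_inj[of j i] i by auto
    have "deg_in (lead j) (r l * Var ?v ^ l) \<le> deg_in (lead j) (A ! j) - 1" if "l \<le> e" for l
    proof -
      have "lead j \<notin> vars (Var ?v ^ l :: ('d, 'l, 'k) dpoly)"
        using poly_in_power[OF poly_in_Var[of ?v "{?v}"], of l] ne by (auto simp: poly_in_def)
      then have "deg_in (lead j) (Var ?v ^ l :: ('d, 'l, 'k) dpoly) = 0" by (rule deg_in_notin)
      then show ?thesis
        using deg_in_mult_le[of "lead j" "r l" "Var ?v ^ l"] r(3)[OF that ji] by linarith
    qed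
    then have "deg_in (lead j) R \<le> deg_in (lead j) (A ! j) - 1"
      unfolding R_def by (intro deg_in_sum_le) simp
    moreover have "0 < deg_in (lead j) (A ! j)" using deg_leader_pos[OF A_not_Const] ji i by simp
    ultimately show ?thesis by linarith
  qed
  ultimately have "R = 0" using reduced_zero[of R "Suc i"] i by simp
  have "r l = 0" using co[of l] True by (simp add: \<open>R = 0\<close> e_def)
  then have "h * coeff_in ?v l F \<in> I" using r(2)[of l] True by (simp add: e_def)
  then show ?thesis by (rule regularD[OF h])
next
  case False
  then show ?thesis using diff_idealD(1)[OF I] by (simp add: coeff_in_above_deg)
qed

text \<open>The coefficients of the partial derivative are integer multiples of those of F, which
  lie in I. This permits relations of low degree to be differentiated with respect to a
  leader.\<close>

lemma partial_mem:
  assumes "i < length A" "F \<in> I" "F \<in> poly_in (W (Suc i))"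
    "deg_in (lead i) F < deg_in (lead i) (A ! i)"
  shows "partial (lead i) F \<in> I"
  by (rule mem_ideal_if_coeffs[OF I, of "lead i"])
    (auto simp: coeff_in_partial intro!: diff_idealD(3)[OF I] coeff_in_mem[OF assms] simp del: of_nat_Suc)

end

text \<open>A is the set presenting I as a saturation, so its initials and separants are regular at
  once. C has the same ranks; its initials are regular because they lie in \<open>k[N]\<close>, its
  separants by comparison with A.\<close>

locale canonical = characterized D le I A
  for D :: "'d \<Rightarrow> 'k::field_char_0 \<Rightarrow> 'k" and le :: "('d, 'l::finite) dvar \<Rightarrow> ('d, 'l) dvar \<Rightarrow> bool"
    and I :: "('d, 'l, 'k) dpoly set" and A :: "('d, 'l, 'k) dpoly list" +
  fixes C :: "('d, 'l, 'k) dpoly list"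
  assumes canonical: "canonical_char_set le I C"
begin

lemma char_set_C: "char_set le I C"
  by (rule canonical_char_setD(1)[OF canonical])

lemma autoreduced_C: "autoreduced le C" and C_subset: "set C \<subseteq> I"
  using char_set_C by (auto simp: char_set_def)

lemma ranks_C: "map (rank le) C = map (rank le) A"
  by (rule char_sets_same_ranks[OF char_set_C char_set])

lemma length_C: "length C = length A"
  using ranks_C by (rule map_eq_imp_length_eq)

lemma nonleaders_C: "nonleaders le C = N"
  by (rule nonleaders_eq_if_ranks_eq[OF ranks_C])

lemma rank_C_nth:
  assumes "i < length A"
  shows "rank le (C ! i) = rank le (A ! i)"
  using arg_cong[OF ranks_C, of "\<lambda>xs. xs ! i"] assms length_C by simp

lemma leader_C: "i < length A \<Longrightarrow> leader le (C ! i) = lead i"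
  and deg_C: "i < length A \<Longrightarrow> deg_in (lead i) (C ! i) = deg_in (lead i) (A ! i)"
  by (simp_all only: rank_eqD[OF rank_C_nth])

lemma C_in_set: "i < length A \<Longrightarrow> C ! i \<in> set C"
  using length_C by simp

lemma C_in_I: "i < length A \<Longrightarrow> C ! i \<in> I"
  using C_subset C_in_set by blast

lemma C_not_Const: "i < length A \<Longrightarrow> C ! i \<notin> range Const"
  by (rule autoreducedD(1)[OF autoreduced_C C_in_set])

lemma C_vars_cases:
  assumes g: "g \<in> set C" and v: "v \<in> vars g" "v \<notin> N"
  shows "\<exists>j<length A. v = lead j"
proof -
  from v(2) have "v \<notin> nonleaders le C" unfolding nonleaders_C .
  then obtain \<theta> h where h: "h \<in> set C" "v = dapp \<theta> (leader le h)"
    by (auto simp: nonleaders_def)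
  with v(1) have "\<theta> = {#}" using autoreducedD(3)[OF autoreduced_C g h(1)] by blast
  moreover obtain j where "j < length A" "h = C ! j" using h(1) length_C by (auto simp: in_set_conv_nth)
  ultimately show ?thesis using h(2) leader_C by auto
qed

lemma C_in_W:
  assumes i: "i < length A"
  shows "C ! i \<in> poly_in (W (Suc i))"
proof (rule vars_subset_W[OF _ _ i])
  fix v assume v: "v \<in> vars (C ! i)"
  show "v \<in> N \<or> (\<exists>h\<in>set A. v = leader le h)"
    using C_vars_cases[OF C_in_set[OF i] v] nth_mem[of _ A] by blast
  show "le v (lead i)" using leader(2)[OF C_not_Const[OF i] v] leader_C[OF i] by simp
qed

lemma initial_C_in_N: "i < length A \<Longrightarrow> initial le (C ! i) \<in> poly_in N"
  using canonical_char_setD(2)[OF canonical C_in_set] nonleaders_C by simp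

lemma C_nonzero: "i < length A \<Longrightarrow> C ! i \<noteq> 0"
  using C_not_Const[of i] by (auto simp flip: Const_0)

lemma initial_C_nonzero: "i < length A \<Longrightarrow> initial le (C ! i) \<noteq> 0"
  by (rule initial_nonzero[OF C_nonzero])

lemma initial_C_regular: "i < length A \<Longrightarrow> regular (initial le (C ! i))"
  by (rule N_regular[OF initial_C_in_N initial_C_nonzero])

lemma initial_C_eq: "i < length A \<Longrightarrow> initial le (C ! i) = coeff_in (lead i) (deg_in (lead i) (A ! i)) (C ! i)"
  by (simp add: initial_def leader_C deg_C)

text \<open>Cross-multiplying \<open>C ! i\<close> and \<open>A ! i\<close> by their initials
  cancels the top degree, so the difference may be differentiated inside I. This relates the two
  separants modulo I with factors a and b, and both a and the separant of \<open>A ! i\<close> are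
  regular.\<close>

lemma separant_C_regular:
  assumes i: "i < length A"
  shows "regular (separant le (C ! i))"
proof (rule regularI)
  let ?v = "lead i" and ?f = "C ! i" and ?g = "A ! i"
  let ?d = "deg_in ?v ?g"
  define a b where "a = initial le ?f" and "b = initial le ?g"
  have ab: "a = coeff_in ?v ?d ?f" "b = coeff_in ?v ?d ?g"
    by (simp_all add: a_def b_def initial_C_eq i) (simp add: initial_def)
  have nin: "?v \<notin> vars a" "?v \<notin> vars b" by (simp_all add: ab)
  define F where "F = b * ?f - a * ?g"
  have FI: "F \<in> I" unfolding F_def
    by (intro diff_ideal_diff[OF I] diff_idealD(3)[OF I] C_in_I A_in_I i)
  have coW: "coeff_in ?v d p \<in> poly_in (W (Suc i))" if "p \<in> poly_in (W (Suc i))" for d p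
    by (rule poly_in_mono[OF poly_in_coeff_in[OF that] Diff_subset])
  have FW: "F \<in> poly_in (W (Suc i))"
    unfolding F_def ab by (intro poly_in_diff poly_in_mult coW C_in_W A_in_W i)
  have "deg_in ?v a = 0" "deg_in ?v b = 0" using nin by (simp_all add: deg_in_notin)
  then have "deg_in ?v (b * ?f) \<le> ?d" "deg_in ?v (a * ?g) \<le> ?d"
    using deg_in_mult_le[of ?v b ?f] deg_in_mult_le[of ?v a ?g] deg_C[OF i] by simp_all
  then have le: "deg_in ?v F \<le> ?d" unfolding F_def by (rule deg_in_diff_le)
  have "coeff_in ?v ?d F = 0"
    unfolding F_def coeff_in_diff coeff_in_mult_notin[OF nin(1)] coeff_in_mult_notin[OF nin(2)]
    by (simp flip: ab add: mult.commute)
  then have "deg_in ?v F < ?d"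
    by (rule deg_in_less_if_coeff_0[OF le _ deg_leader_pos[OF A_not_Const[OF i]]])
  then have "partial ?v F \<in> I" by (rule partial_mem[OF i FI FW])
  moreover have "partial ?v F = b * partial ?v ?f - a * partial ?v ?g"
    unfolding F_def partial_diff partial_mult partial_notin[OF nin(1)] partial_notin[OF nin(2)] by simp
  ultimately have key: "b * partial ?v ?f - a * partial ?v ?g \<in> I" by simp
  fix x assume "separant le ?f * x \<in> I"
  then have "b * (separant le ?f * x) \<in> I" by (rule diff_idealD(3)[OF I])
  then have "b * (separant le ?f * x) - x * (b * partial ?v ?f - a * partial ?v ?g) \<in> I"
    by (rule diff_ideal_diff[OF I _ diff_idealD(3)[OF I key]])
  moreover have "b * (separant le ?f * x) - x * (b * partial ?v ?f - a * partial ?v ?g) =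
      a * separant le ?g * x"
    by (simp add: separant_def leader_C[OF i] algebra_simps)
  ultimately have "a * separant le ?g * x \<in> I" by simp
  moreover have "regular (a * separant le ?g)"
    unfolding a_def using i by (intro regular_mult initial_C_regular separant_regular) auto
  ultimately show "x \<in> I" using regularD by blast
qed

lemma power_diff_mem: "x - y \<in> I \<Longrightarrow> x ^ n - y ^ n \<in> I"
proof (induction n)
  case (Suc n)
  have "x ^ Suc n - y ^ Suc n = x * (x ^ n - y ^ n) + y ^ n * (x - y)" by (simp add: algebra_simps)
  also have "\<dots> \<in> I" by (intro diff_idealD(2,3)[OF I] Suc)
  finally show ?case .
qed (simp add: diff_idealD(1)[OF I])

lemma nilpotent_cong: "x - y \<in> I \<Longrightarrow> y ^ n \<in> I \<Longrightarrow> x ^ n \<in> I"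
  using power_diff_mem[of x y n] diff_idealD(2)[OF I, of "x ^ n - y ^ n" "y ^ n"] by simp

text \<open>
  Take \<open>r\<close> nilpotent modulo \<open>I\<close>, not in \<open>I\<close>, of least degree in the leader \<open>v\<close>.  Dividing \<open>C\<^sub>i\<close> by
  \<open>r\<close> and differentiating with respect to \<open>v\<close> shows that \<open>a\<^sup>n S r\<close> is a multiple of \<open>r\<^sup>2\<close> modulo
  \<open>I\<close>, where \<open>a\<close> is the leading coefficient of \<open>r\<close>, so a power of \<open>a\<close> lies in \<open>I\<close>.
\<close>

lemma radical_W:
  assumes "i \<le> length A" "f \<in> poly_in (W i)" "f ^ n \<in> I"
  shows "f \<in> I"
  using assms
proof (induction i arbitrary: f n)
  case 0
  have "f = 0"
  proof (rule ccontr)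
    assume "f \<noteq> 0"
    then have "regular (f ^ n)" using 0 W_0 by (intro regular_power N_regular) auto
    then have "1 \<in> I" using regularD[of "f ^ n" 1] 0(3) by simp
    with proper show False by blast
  qed
  then show ?case using diff_idealD(1)[OF I] by simp
next
  case (Suc i)
  let ?v = "lead i" and ?R = "poly_in (W (Suc i)) :: ('d, 'l, 'k) dpoly set"
  from Suc.prems(1) have i: "i < length A" by simp
  note pos = deg_leader_pos[OF A_not_Const[OF i]]
  obtain e where e: "deg_in ?v (A ! i) = Suc e" using pos gr0_implies_Suc by blast
  have eC: "deg_in ?v (C ! i) = Suc e" using deg_C[OF i] e by simp
  have vW: "?v \<in> W (Suc i)" using W_Suc[OF i] by simp
  have cW: "coeff_in ?v l p \<in> poly_in (W i)" if "p \<in> ?R" for l p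
    by (rule poly_in_mono[OF poly_in_coeff_in[OF that]]) (auto simp: W_Suc[OF i])
  have WR: "p \<in> ?R" if "p \<in> poly_in (W i)" for p
    by (rule poly_in_mono[OF that]) (auto simp: W_Suc[OF i])
  define Bad where "Bad r \<longleftrightarrow> r \<in> ?R \<and> r \<notin> I \<and> (\<exists>n. r ^ n \<in> I)" for r
  show ?case
  proof (rule ccontr)
    assume "f \<notin> I"
    with Suc.prems have "Bad f" by (auto simp: Bad_def)
    then obtain r where r: "Bad r" "\<And>s. Bad s \<Longrightarrow> deg_in ?v r \<le> deg_in ?v s"
      using ex_has_least_nat[of Bad f "deg_in ?v"] by blast
    then obtain m where rR: "r \<in> ?R" and rI: "r \<notin> I" and rm: "r ^ m \<in> I" by (auto simp: Bad_def)
    have small: "s \<in> I" if "s \<in> ?R" "deg_in ?v s < deg_in ?v r" "s ^ n \<in> I" for s n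
    proof (rule ccontr)
      assume "s \<notin> I"
      with that have "Bad s" by (auto simp: Bad_def)
      with r(2)[of s] that(2) show False by simp
    qed
    \<comment> \<open>Otherwise the pseudo-remainder of r by \<open>C ! i\<close> is nilpotent of
      smaller degree, hence in I, and regularity of the initial puts r itself in I.\<close>
    have deg_r: "deg_in ?v r \<le> e"
    proof (rule ccontr)
      assume big: "\<not> deg_in ?v r \<le> e"
      define a where "a = coeff_in ?v (Suc e) (C ! i)"
      have areg: "regular (a ^ n)" for n
        using initial_C_regular[OF i] initial_C_eq[OF i] by (simp add: a_def e regular_power)
      obtain q s where qs: "a ^ deg_in ?v r * r = q * (C ! i) + s" "deg_in ?v s \<le> e" "s \<in> ?R"
        using pseudo_division[OF eC rR C_in_W[OF i] vW, of "deg_in ?v r"] unfolding a_def by auto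
      have "s - a ^ deg_in ?v r * r = - q * (C ! i)" by (simp add: qs(1))
      then have cong: "s - a ^ deg_in ?v r * r \<in> I" 
        using diff_idealD(3)[OF I C_in_I[OF i], of "- q"] by simp
      have nil: "(a ^ deg_in ?v r * r) ^ m \<in> I"
        unfolding power_mult_distrib by (rule diff_idealD(3)[OF I rm])
      have "s \<in> I" by (rule small[OF qs(3) _ nilpotent_cong[OF cong nil]]) (use qs(2) big in simp)
      then have "a ^ deg_in ?v r * r \<in> I" using diff_ideal_diff[OF I _ cong, of s] by simp
      then show False using regularD[OF areg] rI by blast
    qed
    define a where "a = coeff_in ?v (deg_in ?v r) r"
    have aW: "a \<in> poly_in (W i)" unfolding a_def by (rule cW[OF rR])
    have IH: "p \<in> I" if "p \<in> poly_in (W i)" "p ^ n \<in> I" for p n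
      using Suc.IH[OF _ that] i by simp
    have r0: "r \<noteq> 0" using rI diff_idealD(1)[OF I] by metis
    have dpos: "deg_in ?v r \<noteq> 0"
    proof
      assume "deg_in ?v r = 0"
      then have "?v \<notin> vars r" using deg_in_pos_iff[of ?v r] by simp
      then have "r \<in> poly_in (W i)" using rR by (auto simp: poly_in_def W_Suc[OF i])
      with IH rm rI show False by blast
    qed
    then obtain e' where e': "deg_in ?v r = Suc e'" using not0_implies_Suc by blast
    \<comment> \<open>A nilpotent leading coefficient lies in I by the induction hypothesis.
      Dropping the leading term then gives an element of smaller degree congruent to r, which would
      have to lie in I.\<close>
    have a_not_nil: "a ^ n \<notin> I" for n
    proof
      assume "a ^ n \<in> I"
      then have aI: "a \<in> I" by (rule IH[OF aW])
      define s where "s = r - a * Var ?v ^ Suc e'"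
      have sr: "s - r \<in> I"
        unfolding s_def using diff_idealD(3)[OF I aI, of "- (Var ?v ^ Suc e')"] by (simp add: mult.commute)
      have "s \<in> ?R" unfolding s_def using rR WR[OF aW] vW
        by (intro poly_in_diff poly_in_mult poly_in_power poly_in_Var)
      moreover have "deg_in ?v s \<le> e'"
        unfolding deg_in_le_iff
      proof (intro allI impI)
        fix d assume d: "e' < d"
        have "?v \<notin> vars a" by (simp add: a_def)
        then have "coeff_in ?v d s = coeff_in ?v d r - (if d = Suc e' then a else 0)"
          by (simp add: s_def coeff_in_diff coeff_in_mult_notin coeff_in_Var_power del: power_Suc)
        then show "coeff_in ?v d s = 0"
          using d by (cases "d = Suc e'") (simp_all add: a_def e' coeff_in_above_deg)
      qed
      ultimately have "s \<in> I" using small[of s m] nilpotent_cong[OF sr rm] e' by simp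
      then have "s - (s - r) \<in> I" by (rule diff_ideal_diff[OF I _ sr])
      with rI show False by simp
    qed
    \<comment> \<open>Division of \<open>C ! i\<close> by r: the remainder s is congruent to a
      multiple of r, hence nilpotent, and by minimality lies in I. Its degree is small enough for
      its derivative to lie in I too.\<close>
    define k where "k = deg_in ?v (C ! i)"
    obtain q s where qs: "a ^ k * (C ! i) = q * r + s" "deg_in ?v s \<le> e'" "s \<in> ?R"
      using pseudo_division[OF e' C_in_W[OF i] rR vW, of k] unfolding a_def e' k_def by auto
    have "s - (- q * r) = a ^ k * (C ! i)" by (simp add: qs(1))
    then have cong: "s - (- q * r) \<in> I" using diff_idealD(3)[OF I C_in_I[OF i]] by simp
    have nil: "(- q * r) ^ m \<in> I" unfolding power_mult_distrib by (rule diff_idealD(3)[OF I rm])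
    have sI: "s \<in> I"
      by (rule small[OF qs(3) _ nilpotent_cong[OF cong nil]]) (use qs(2) e' in simp)
    have "deg_in ?v s < deg_in ?v (A ! i)" using qs(2) e' deg_r e by simp
    then have dsI: "partial ?v s \<in> I" by (rule partial_mem[OF i sI qs(3)])
    define S where "S = partial ?v (C ! i)"
    define b where "b = a ^ k * S"
    define c where "c = partial ?v q"
    have ak: "?v \<notin> vars (a ^ k)"
      using poly_in_power[OF poly_in_vars[of a], of k] by (auto simp: poly_in_def a_def)
    have "partial ?v (a ^ k * (C ! i)) = b"
      by (simp add: partial_mult partial_notin[OF ak] b_def S_def)
    then have b_eq: "b = c * r + q * partial ?v r + partial ?v s"
      unfolding qs(1) by (simp add: partial_add partial_mult c_def)
    \<comment> \<open>Multiplying the equation for b by r kills the terms with \<open>q * r\<close>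
      and with the derivative of s, leaving b r congruent to c times the square of r.\<close>
    have qr: "q * r \<in> I"
    proof -
      have "q * r = a ^ k * (C ! i) - s" by (simp add: qs(1))
      also have "\<dots> \<in> I" by (intro diff_ideal_diff[OF I] diff_idealD(3)[OF I] C_in_I i sI)
      finally show ?thesis .
    qed
    have br: "b * r - c * r * r \<in> I"
    proof -
      have "b * r - c * r * r = partial ?v r * (q * r) + r * partial ?v s"
        by (simp add: b_eq algebra_simps)
      also have "\<dots> \<in> I" by (intro diff_idealD(2,3)[OF I] qr dsI)
      finally show ?thesis .
    qed
    \<comment> \<open>Iterating the congruence raises the power of r until it reaches the nilpotency
      exponent m.\<close>
    have bn: "b ^ n * r - c ^ n * r ^ Suc n \<in> I" for n
    proof (induction n)
      case (Suc n)
      have "b ^ Suc n * r - c ^ Suc n * r ^ Suc (Suc n) =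
          b * (b ^ n * r - c ^ n * r ^ Suc n) + c ^ n * r ^ n * (b * r - c * r * r)"
        by (simp add: algebra_simps)
      also have "\<dots> \<in> I" by (intro diff_idealD(2,3)[OF I] Suc br)
      finally show ?case .
    qed (simp add: diff_idealD(1)[OF I])
    have "c ^ m * r ^ Suc m \<in> I"
      using diff_idealD(3)[OF I rm, of "c ^ m * r"] by (simp add: mult.assoc)
    then have "(b ^ m * r - c ^ m * r ^ Suc m) + c ^ m * r ^ Suc m \<in> I"
      by (rule diff_idealD(2)[OF I bn])
    then have "b ^ m * r \<in> I" by simp
    then have "S ^ m * ((a ^ k) ^ m * r) \<in> I"
      unfolding b_def power_mult_distrib by (simp add: ac_simps)
    moreover have "regular (S ^ m)"
      using separant_C_regular[OF i] leader_C[OF i] by (simp add: S_def separant_def regular_power)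
    ultimately have arI: "(a ^ k) ^ m * r \<in> I" using regularD by blast
    have akm: "?v \<notin> vars ((a ^ k) ^ m)"
      using poly_in_power[OF poly_in_vars[of "a ^ k"], of m] ak by (auto simp: poly_in_def)
    have "deg_in ?v ((a ^ k) ^ m * r) \<le> deg_in ?v r"
      using deg_in_mult_le[of ?v "(a ^ k) ^ m" r] deg_in_notin[OF akm] by simp
    then have "deg_in ?v ((a ^ k) ^ m * r) < deg_in ?v (A ! i)" using deg_r e by simp
    moreover have "(a ^ k) ^ m * r \<in> ?R"
      using WR[OF aW] rR by (intro poly_in_mult poly_in_power)
    \<comment> \<open>The element is of low degree in the leader, so its top coefficient, a power of
      a, is in I as well.\<close>
    ultimately have "coeff_in ?v (deg_in ?v r) ((a ^ k) ^ m * r) \<in> I"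
      by (intro coeff_in_mem[OF i arI])
    then have "(a ^ k) ^ m * a \<in> I" unfolding coeff_in_mult_notin[OF akm] a_def[symmetric] .
    then have "a ^ Suc (k * m) \<in> I" by (simp add: power_mult mult.commute)
    with a_not_nil show False by blast
  qed
qed

text \<open>If the derivative were in I, the combination R, whose top terms in the leader cancel,
  would be a reduced element of I and so zero. As \<open>C ! i\<close> has no nonconstant factor in
  \<open>k[N]\<close>, a would then divide \<open>partial z a\<close>; comparing degrees in z gives
  \<open>partial z a = 0\<close>, and then \<open>partial z ?f = 0\<close> although z
  occurs.\<close>

lemma partial_C_notin:
  assumes i: "i < length A" and z: "z \<in> vars (C ! i)" "z \<in> N"
  shows "partial z (C ! i) \<notin> I"
proof
  let ?f = "C ! i" and ?v = "lead i"
  let ?d = "deg_in ?v (A ! i)"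
  define a where "a = initial le ?f"
  have a: "a = coeff_in ?v ?d ?f" by (simp add: a_def initial_C_eq i)
  have aN: "a \<in> poly_in N" "partial z a \<in> poly_in N"
    unfolding a_def by (rule initial_C_in_N[OF i], rule poly_in_partial[OF initial_C_in_N[OF i]])
  have zv: "z \<noteq> ?v" using z(2) lead_notin_N[OF i] by blast
  define R where "R = a * partial z ?f - partial z a * ?f"
  assume "partial z ?f \<in> I"
  then have "R \<in> I"
    unfolding R_def by (intro diff_ideal_diff[OF I] diff_idealD(3)[OF I] C_in_I i)
  moreover have "R \<in> poly_in (W (Suc i))"
    unfolding R_def
    by (intro poly_in_diff poly_in_mult poly_in_mono[OF aN(1) N_subset_W]
        poly_in_mono[OF aN(2) N_subset_W] C_in_W[OF i] poly_in_partial[OF C_in_W[OF i]])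
  moreover have "deg_in (lead j) R < deg_in (lead j) (A ! j)" if j: "j < Suc i" for j
  proof -
    from j i have jA: "j < length A" by simp
    have le: "deg_in (lead j) R \<le> deg_in (lead j) ?f"
      unfolding R_def
      using order_trans[OF mult_N_deg_le[OF aN(1) jA] deg_in_partial_le] mult_N_deg_le[OF aN(2) jA]
      by (rule deg_in_diff_le)
    show ?thesis
    proof (cases "j = i")
      case True
      have nv: "?v \<notin> vars a" "?v \<notin> vars (partial z a)"
        using aN lead_notin_N[OF i] by (auto simp: poly_in_def)
      have "coeff_in ?v ?d R = 0"
        unfolding R_def coeff_in_diff coeff_in_mult_notin[OF nv(1)] coeff_in_mult_notin[OF nv(2)]
          coeff_in_partial_other[OF zv[symmetric]]
        by (simp flip: a add: mult.commute)
      moreover have "deg_in ?v R \<le> ?d" using le deg_C[OF i] True by simp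
      ultimately show ?thesis
        using deg_in_less_if_coeff_0[OF _ _ deg_leader_pos[OF A_not_Const[OF i]]] True by simp
    next
      case False
      then have "C ! i \<noteq> C ! j"
        using autoreducedD(4)[OF autoreduced_C] i jA length_C by (simp add: nth_eq_iff_index_eq)
      then have "deg_in (lead j) ?f < deg_in (lead j) (C ! j)"
        using autoreducedD(2)[OF autoreduced_C C_in_set[OF i] C_in_set[OF jA]] leader_C[OF jA] by simp
      with le deg_C[OF jA] show ?thesis by simp
    qed
  qed
  ultimately have "R = 0" using reduced_zero[of R "Suc i"] i by simp
  then have eq: "a * partial z ?f = partial z a * ?f" by (simp add: R_def)
  have a0: "a \<noteq> 0" unfolding a_def by (rule initial_C_nonzero[OF i])
  have "a dvd partial z a * ?f" by (simp flip: eq)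
  from dvd_mult_split[OF a0 this] obtain a1 a2 where
    a12: "a = a1 * a2" "a1 dvd partial z a" "a2 dvd ?f" by blast
  have "a2 \<in> poly_in (nonleaders le C)"
    unfolding nonleaders_C by (rule dvd_poly_in[OF _ a0 aN(1)]) (simp add: a12(1))
  then have "a2 \<in> range Const"
    using canonical_char_setD(3)[OF canonical C_in_set[OF i] _ a12(3)] by blast
  then have "a2 dvd 1" using a0 a12(1) by (auto simp: mpoly_dvd_1_iff)
  then have "a dvd a1" using mult_dvd_mono[of a1 a1 a2 1] by (simp add: a12(1))
  then have "a dvd partial z a" using a12(2) by (rule dvd_trans)
  then obtain t where t: "partial z a = a * t" by (elim dvdE)
  \<comment> \<open>A nonzero multiple of a has at least the degree of a in z, whereas
    differentiation lowers that degree.\<close>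
  have "partial z a = 0"
  proof (rule ccontr)
    assume nz: "partial z a \<noteq> 0"
    then have "t \<noteq> 0" using t by auto
    then have "deg_in z (partial z a) = deg_in z a + deg_in z t" unfolding t by (rule deg_in_mult[OF a0])
    moreover have "0 < deg_in z a" using nz partial_notin[of z a] deg_in_pos_iff[of z a] by blast
    ultimately show False using deg_in_partial_same[of z a] by simp
  qed
  with eq a0 have "partial z ?f = 0" by simp
  with partial_nonzero[OF z(1)] show False by blast
qed

text \<open>By \<open>radical_W\<close> no power of g lies in I, so some prime avoids all powers and
  contains a minimal one. With g = 1 this also yields that minimal primes exist.\<close>

lemma minimal_prime_avoiding:
  assumes g: "g \<in> poly_in (W (length A))" "g \<notin> I"
  shows "\<exists>P\<in>minimal_primes D I. g \<notin> P"
proof -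
  have "\<exists>Q. prime_diff_ideal D Q \<and> I \<subseteq> Q \<and> Q \<inter> range (\<lambda>n. g ^ n) = {}"
  proof (rule prime_diff_ideal_avoiding[OF I])
    show "1 \<in> range (\<lambda>n. g ^ n)" using range_eqI[of 1 "\<lambda>n. g ^ n" 0] by simp
    show "p * q \<in> range (\<lambda>n. g ^ n)" if "p \<in> range (\<lambda>n. g ^ n)" "q \<in> range (\<lambda>n. g ^ n)" for p q
      using that by (auto simp flip: power_add)
    show "I \<inter> range (\<lambda>n. g ^ n) = {}" using radical_W[OF order_refl g(1)] g(2) by blast
  qed
  then obtain Q where Q: "prime_diff_ideal D Q" "I \<subseteq> Q" "Q \<inter> range (\<lambda>n. g ^ n) = {}" by blast
  have "g \<notin> Q" using Q(3) range_eqI[of g "\<lambda>n. g ^ n" 1] by auto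
  moreover obtain P where "P \<in> minimal_primes D I" "P \<subseteq> Q" using minimal_prime_below[OF Q(1,2)] by blast
  ultimately show ?thesis by blast
qed

end

subsection \<open>Existence of orderly rankings and characteristic sets\<close>

context ordinary
begin

lemma wf_rank_less: "wf {(r, s). rank_less le r s}"
proof -
  have "{(r, s). rank_less le r s} = {(u, v). le u v \<and> u \<noteq> v} <*lex*> less_than"
    by (auto simp: rank_less_def)
  then show ?thesis by (simp add: wf_lex_prod wf_ranking)
qed

lemma autoreduced_length_le:
  assumes "autoreduced le A"
  shows "length A \<le> CARD('l)"
proof -
  have "inj_on (\<lambda>f. snd (leader le f)) (set A)"
    by (rule inj_onI) (rule leaders_distinct_snd[OF assms])
  then have "card (set A) \<le> card (UNIV :: 'l set)"
    by (rule card_inj_on_le) auto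
  then show ?thesis using autoreducedD(4)[OF assms] by (simp add: distinct_card)
qed

text \<open>Choose successively an element of least rank that is reduced with respect to the previous
  ones.\<close>

lemma char_set_exists:
  fixes P :: "('d, 'l, 'b::comm_ring_1) dpoly set"
  shows "\<exists>A. char_set le P A"
proof -
  define S where "S B = {f \<in> P. f \<notin> range Const \<and> (\<forall>g\<in>B. reduced le f g)}"
    for B :: "('d, 'l, 'b) dpoly set"
  define greedy where "greedy A \<longleftrightarrow> (\<forall>i<length A. A ! i \<in> S (set (take i A)) \<and>
    (\<forall>f\<in>S (set (take i A)). \<not> rank_less le (rank le f) (rank le (A ! i))))" for A
  have autored: "autoreduced le A" if g: "greedy A" for A
  proof -
    have mem: "A ! i \<in> P" "A ! i \<notin> range Const" if "i < length A" for i
      using g that by (auto simp: greedy_def S_def)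
    have red: "reduced le (A ! j) (A ! i)" if "i < j" "j < length A" for i j
    proof -
      have "A ! i \<in> set (take j A)" using that by (auto simp: in_set_conv_nth intro: exI[of _ i])
      moreover have "A ! j \<in> S (set (take j A))" using g that by (simp add: greedy_def)
      ultimately show ?thesis by (simp add: S_def)
    qed
    have less: "rank_less le (rank le (A ! i)) (rank le (A ! j))" if ij: "i < j" "j < length A" for i j
    proof -
      have "set (take i A) \<subseteq> set (take j A)" using ij by (intro set_take_subset_set_take) simp
      moreover have "A ! j \<in> S (set (take j A))" using g ij by (simp add: greedy_def)
      ultimately have "A ! j \<in> S (set (take i A))" by (auto simp: S_def)
      then have "\<not> rank_less le (rank le (A ! j)) (rank le (A ! i))"
        using g ij by (simp add: greedy_def)
      moreover have "rank le (A ! j) \<noteq> rank le (A ! i)"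
      proof
        assume "rank le (A ! j) = rank le (A ! i)"
        from rank_eqD[OF this] red[OF ij] show False by (simp add: reduced_def)
      qed
      ultimately show ?thesis using rank_less_total[of "rank le (A ! i)" "rank le (A ! j)"] by auto
    qed
    have "reduced le f h" if "f \<in> set A" "h \<in> set A" "f \<noteq> h" for f h
    proof -
      from that obtain i j where ij: "i < length A" "j < length A" "f = A ! i" "h = A ! j"
        by (auto simp: in_set_conv_nth)
      with that(3) consider "i < j" | "j < i" by (metis linorder_neqE_nat)
      then show ?thesis
      proof cases
        case 1
        show ?thesis unfolding ij
          by (rule reduced_by_higher[OF mem(2)[OF ij(2)] mem(2)[OF ij(1)] less[OF 1 ij(2)] red[OF 1 ij(2)]])
      next
        case 2
        show ?thesis unfolding ij by (rule red[OF 2 ij(1)])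
      qed
    qed
    moreover have "set A \<inter> range Const = {}" using mem(2) by (fastforce simp: in_set_conv_nth)
    moreover have "sorted_wrt (\<lambda>f g. rank_less le (rank le f) (rank le g)) A"
      unfolding sorted_wrt_iff_nth_less using less by blast
    ultimately show ?thesis unfolding autoreduced_def by blast
  qed
  have "greedy []" by (simp add: greedy_def)
  moreover have "\<forall>A. greedy A \<longrightarrow> length A < Suc (CARD('l))"
    using autored autoreduced_length_le less_Suc_eq_le by blast
  ultimately obtain A where A: "greedy A" "\<And>B. greedy B \<Longrightarrow> length B \<le> length A"
    using ex_has_greatest_nat[of greedy "[]" length "Suc (CARD('l))"] by blast
  \<comment> \<open>A longest greedy list leaves no candidate, since one of least rank could be
    appended.\<close>
  have S_empty: "f \<notin> S (set A)" for f
  proof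
    assume "f \<in> S (set A)"
    then have "rank le f \<in> rank le ` S (set A)" by blast
    then obtain r where r: "r \<in> rank le ` S (set A)"
      "\<And>s. (s, r) \<in> {(r, s). rank_less le r s} \<Longrightarrow> s \<notin> rank le ` S (set A)"
      by (rule wfE_min[OF wf_rank_less]) blast
    then obtain g where g: "g \<in> S (set A)" "r = rank le g" by blast
    have min: "\<not> rank_less le (rank le h) (rank le g)" if "h \<in> S (set A)" for h
      using r(2)[of "rank le h"] that g(2) by auto
    have "greedy (A @ [g])"
      unfolding greedy_def
    proof (intro allI impI)
      fix i assume "i < length (A @ [g])"
      then consider "i < length A" | "i = length A" by fastforce
      then show "(A @ [g]) ! i \<in> S (set (take i (A @ [g]))) \<and>
        (\<forall>f\<in>S (set (take i (A @ [g]))). \<not> rank_less le (rank le f) (rank le ((A @ [g]) ! i)))"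
      proof cases
        case 1
        then show ?thesis using A(1) by (simp add: greedy_def nth_append)
      next
        case 2
        then show ?thesis using g(1) min by simp
      qed
    qed
    from A(2)[OF this] show False by simp
  qed
  have inP: "set A \<subseteq> P" using A(1) by (auto simp: greedy_def S_def in_set_conv_nth)
  have "\<not> lower_rank le B A" if B: "autoreduced le B" "set B \<subseteq> P" for B
  proof
    assume "lower_rank le B A"
    \<comment> \<open>Reducedness depends only on the rank of the divisor. So if B agrees in rank
      with A before j, its next element was a candidate when \<open>A ! j\<close> was
      chosen.\<close>
    have BS: "B ! j \<in> S (set (take j A))"
      if j: "j < length B" "j \<le> length A" "\<And>i. i < j \<Longrightarrow> rank le (B ! i) = rank le (A ! i)" for j
    proof -
      have "B ! j \<in> P" using B(2) j(1) by auto
      moreover have "B ! j \<notin> range Const" using autoreducedD(1)[OF B(1)] j(1) by simp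
      moreover have "reduced le (B ! j) g" if "g \<in> set (take j A)" for g
      proof -
        from that obtain i where i: "i < j" "g = A ! i" by (auto simp: in_set_conv_nth)
        have "B ! j \<noteq> B ! i"
          using autoreducedD(4)[OF B(1)] i(1) j(1) by (simp add: nth_eq_iff_index_eq)
        then have "reduced le (B ! j) (B ! i)"
          using B(1) i(1) j(1) by (auto simp: autoreduced_def)
        then show ?thesis using reduced_cong_rank[OF j(3)[OF i(1)]] i(2) by simp
      qed
      ultimately show ?thesis by (simp add: S_def)
    qed
    from \<open>lower_rank le B A\<close> consider
      j where "j < length B" "j < length A" "\<forall>i<j. rank le (B ! i) = rank le (A ! i)"
        "rank_less le (rank le (B ! j)) (rank le (A ! j))"
      | "length A < length B" "\<forall>i<length A. rank le (B ! i) = rank le (A ! i)"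
      unfolding lower_rank_def by blast
    then show False
    proof cases
      case 1
      then have "B ! j \<in> S (set (take j A))" using BS[of j] by simp
      with A(1) 1(2,4) show False by (auto simp: greedy_def)
    next
      case 2
      then have "B ! length A \<in> S (set A)" using BS[of "length A"] by simp
      with S_empty show False by blast
    qed
  qed
  with autored[OF A(1)] inP have "char_set le P A" unfolding char_set_def by blast
  then show ?thesis by blast
qed

lemma orderly_ranking_exists:
  "\<exists>le' :: ('d, 'l) dvar \<Rightarrow> ('d, 'l) dvar \<Rightarrow> bool. ranking le' \<and> orderly le'"
proof -
  obtain idx :: "'l \<Rightarrow> nat" where idx: "inj idx"
    using finite_imp_inj_to_nat_seg[of "UNIV :: 'l set"] by auto
  define le' where "le' v w \<longleftrightarrow> dord_var v < dord_var w \<or> (dord_var v = dord_var w \<and> idx (snd v) \<le> idx (snd w))"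
    for v w :: "('d, 'l) dvar"
  have eqI: "v = w" if "dord_var v = dord_var w" "idx (snd v) = idx (snd w)" for v w :: "('d, 'l) dvar"
    using injD[OF idx that(2)] that(1) by (simp add: dvar_eq_iff)
  have "linear_order {(u, v). le' u v}"
    unfolding linear_order_on_def partial_order_on_def preorder_on_def
  proof (intro conjI)
    show "refl {(u, v). le' u v}" by (rule refl_onI) (simp_all add: le'_def)
    show "trans {(u, v). le' u v}" by (rule transI) (auto simp: le'_def)
    show "antisym {(u, v). le' u v}"
      by (rule antisymI) (unfold mem_Collect_eq case_prod_conv le'_def, rule eqI, linarith+)
    show "total {(u, v). le' u v}"
    proof (rule total_onI)
      fix v w :: "('d, 'l) dvar"
      show "(v, w) \<in> {(u, v). le' u v} \<or> (w, v) \<in> {(u, v). le' u v}"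
        unfolding mem_Collect_eq case_prod_conv le'_def by linarith
    qed
  qed (simp_all add: le'_def)
  moreover have "le' u (dapp \<theta> u)" for \<theta> u
    by (cases "\<theta> = {#}") (auto simp: le'_def dapp_eq_mv nonempty_has_size)
  moreover have "le' (dapp \<theta> v) (dapp \<theta> u)" if "le' v u" for \<theta> u v
    using that by (auto simp: le'_def dapp_eq_mv)
  ultimately have "ranking le'" unfolding ranking_def by blast
  moreover have "orderly le'" by (auto simp: orderly_def le'_def)
  ultimately show ?thesis by blast
qed

subsection \<open>Dependence among the derivatives modulo a prime ideal\<close>

definition led :: "('d, 'l, 'k) dpoly list \<Rightarrow> 'l set" where
  "led A = (\<lambda>f. snd (leader le f)) ` set A"

text \<open>The non-leaders split into these, finitely many for an autoreduced A, and the
  derivatives of parametric indeterminates, which are infinitely many if there are any and are cut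
  off at order t in \<open>free\<close>.\<close>

definition below :: "('d, 'l, 'k) dpoly list \<Rightarrow> ('d, 'l) dvar set" where
  "below A = {v \<in> nonleaders le A. snd v \<in> led A}"

definition free :: "('d, 'l, 'k) dpoly list \<Rightarrow> nat \<Rightarrow> ('d, 'l) dvar set" where
  "free A t = {v. snd v \<notin> led A \<and> dord_var v \<le> t}"

text \<open>It uses the orders of the leaders, not of the polynomials. Under an orderly ranking the
  two agree, but in general a polynomial can have larger order than its leader.\<close>

definition total_order :: "('d, 'l, 'k) dpoly list \<Rightarrow> nat" where
  "total_order A = (\<Sum>f\<leftarrow>A. dord_var (leader le f))"

text \<open>The properties shared by a characteristic set of P and by the canonical set of I, which
  is treated modulo a minimal prime without being shown to be a characteristic set of that
  prime.\<close>

definition triangular :: "('d, 'l, 'k) dpoly list \<Rightarrow> ('d, 'l, 'k) dpoly set \<Rightarrow> bool" where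
  "triangular A P \<longleftrightarrow> autoreduced le A \<and> set A \<subseteq> P \<and>
    (\<forall>f\<in>set A. initial le f \<notin> P \<and> separant le f \<notin> P) \<and> P \<inter> poly_in (nonleaders le A) \<subseteq> {0}"

lemma free_subset: "free A t \<subseteq> nonleaders le A"
  unfolding free_def led_def nonleaders_iff[abs_def] by (auto simp: nonleaders_iff)

lemma below_subset: "below A \<subseteq> nonleaders le A"
  by (auto simp: below_def)

lemma below_free_disjoint: "below A \<inter> free A t = {}"
  by (auto simp: below_def free_def)

lemma nonleaders_cases:
  "v \<in> nonleaders le A \<Longrightarrow> dord_var v \<le> t \<Longrightarrow> v \<in> below A \<union> free A t"
  by (simp add: below_def free_def)

lemma leader_deriv_cases:
  assumes "v \<notin> nonleaders le A"
  shows "\<exists>f\<in>set A. \<exists>k. v = mv k (leader le f)"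
proof -
  from assms obtain f where f: "f \<in> set A" "snd (leader le f) = snd v"
    "dord_var (leader le f) \<le> dord_var v"
    by (auto simp: nonleaders_iff not_less)
  with eq_mv_diff[OF f(2,3)] show ?thesis by blast
qed

lemma card_below:
  assumes A: "autoreduced le A"
  shows "finite (below A)" "card (below A) = total_order A"
proof -
  let ?X = "SIGMA f:set A. {..<dord_var (leader le f)}"
  let ?g = "\<lambda>(f, k). mk (snd (leader le f)) k"
  have "below A = ?g ` ?X"
  proof (intro equalityI subsetI)
    fix v assume "v \<in> below A"
    then obtain f where "f \<in> set A" "snd v = snd (leader le f)" "v \<in> nonleaders le A"
      by (auto simp: below_def led_def)
    then have "v = ?g (f, dord_var v)" "(f, dord_var v) \<in> ?X"
      by (simp_all add: dvar_eq_iff nonleaders_iff)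
    then show "v \<in> ?g ` ?X" by (rule image_eqI)
  next
    fix v assume "v \<in> ?g ` ?X"
    then obtain f k where fk: "f \<in> set A" "k < dord_var (leader le f)" "v = mk (snd (leader le f)) k"
      by auto
    have "v \<in> nonleaders le A"
      unfolding nonleaders_iff
    proof (intro ballI impI)
      fix g assume "g \<in> set A" "snd (leader le g) = snd v"
      then have "g = f" using leaders_distinct_snd[OF A _ fk(1)] by (simp add: fk(3))
      then show "dord_var v < dord_var (leader le g)" by (simp add: fk)
    qed
    with fk show "v \<in> below A" by (auto simp: below_def led_def)
  qed
  moreover have "inj_on ?g ?X"
  proof (rule inj_onI)
    fix x y assume xy: "x \<in> ?X" "y \<in> ?X" "?g x = ?g y"
    obtain f k g l where x: "x = (f, k)" and y: "y = (g, l)" by (cases x, cases y)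
    from xy(3) have "snd (leader le f) = snd (leader le g)" "k = l"
      by (simp_all add: x y dvar_eq_iff)
    with leaders_distinct_snd[OF A] xy(1,2) show "x = y" by (simp add: x y)
  qed
  moreover have "finite ?X" by simp
  moreover have "card ?X = (\<Sum>f\<in>set A. dord_var (leader le f))" by (simp add: card_SigmaI)
  moreover have "\<dots> = total_order A"
    unfolding total_order_def by (rule sum_list_distinct_conv_sum_set[OF autoreducedD(4)[OF A], symmetric])
  ultimately show "finite (below A)" "card (below A) = total_order A"
    by (simp_all add: card_image)
qed

lemma card_free: "finite (free A t)" "card (free A t) = card (- led A) * Suc t"
proof -
  let ?g = "\<lambda>(j, k). mk j k"
  have "free A t = ?g ` ((- led A) \<times> {..t})"
  proof (intro equalityI subsetI)
    fix v assume "v \<in> free A t"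
    then have "v = ?g (snd v, dord_var v)" "(snd v, dord_var v) \<in> (- led A) \<times> {..t}"
      by (simp_all add: free_def)
    then show "v \<in> ?g ` ((- led A) \<times> {..t})" by (rule image_eqI)
  qed (auto simp: free_def)
  moreover have "inj_on ?g ((- led A) \<times> {..t})"
    by (rule inj_onI) (auto simp: dvar_eq_iff)
  ultimately show "finite (free A t)" "card (free A t) = card (- led A) * Suc t"
    by (simp_all add: card_image)
qed

lemma card_below_free:
  assumes "autoreduced le A"
  shows "finite (below A \<union> free A t)"
    "card (below A \<union> free A t) = total_order A + card (- led A) * Suc t"
  using card_below[OF assms] card_free[of A t] below_free_disjoint[of A t]
  by (simp_all add: card_Un_disjoint)

lemma leader_order_le:
  assumes "f \<in> set A"
  shows "dord_var (leader le f) \<le> total_order A"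
  unfolding total_order_def by (rule member_le_sum_list) (use assms in auto)

lemma below_order_le: "v \<in> below A \<Longrightarrow> dord_var v \<le> total_order A"
proof -
  assume "v \<in> below A"
  then obtain f where "f \<in> set A" "dord_var v < dord_var (leader le f)"
    by (auto simp: below_def led_def nonleaders_iff)
  with leader_order_le show ?thesis by fastforce
qed

lemma triangularD:
  assumes "triangular A P"
  shows "autoreduced le A" "f \<in> set A \<Longrightarrow> f \<in> P" "f \<in> set A \<Longrightarrow> initial le f \<notin> P"
    "f \<in> set A \<Longrightarrow> separant le f \<notin> P" "W \<subseteq> nonleaders le A \<Longrightarrow> P \<inter> poly_in W \<subseteq> {0}"
proof -
  show "P \<inter> poly_in W \<subseteq> {0}" if "W \<subseteq> nonleaders le A"
    using assms poly_in_mono[OF _ that] unfolding triangular_def by auto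
qed (use assms in \<open>auto simp: triangular_def\<close>)

lemma leader_less:
  assumes "f \<notin> range Const" "v \<in> vars f" "v \<noteq> leader le f"
  shows "(v, leader le f) \<in> {(u, v). le u v \<and> u \<noteq> v}"
  using leader(2)[OF assms(1,2)] assms(3) by simp

text \<open>A derivative of w is a non-leader or a derivative of some leader. If w itself lies below
  that leader, fewer than k derivations have been applied to the leader, so induction on k applies;
  if w is a leader, either i < k or its rank is below that of f.\<close>

lemma closure_led_var:
  assumes A: "autoreduced le A" and below: "below A \<subseteq> Cl"
    and f: "f \<in> set A" "w \<in> vars f" "snd w \<in> led A" "i \<le> k" "mv i w \<noteq> mv k (leader le f)"
    and IH1: "\<And>g k' w i. g \<in> set A \<Longrightarrow> k' < k \<Longrightarrow> w \<in> vars f \<Longrightarrow> i \<le> k \<Longrightarrow>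
      mv k' (leader le g) = mv i w \<Longrightarrow> mv k' (leader le g) \<in> Cl"
    and IH2: "\<And>g. g \<in> set A \<Longrightarrow> leader le g \<in> vars f \<Longrightarrow> leader le g \<noteq> leader le f \<Longrightarrow>
      mv k (leader le g) \<in> Cl"
  shows "mv i w \<in> Cl"
proof (cases "w \<in> nonleaders le A")
  case True
  show ?thesis
  proof (cases "mv i w \<in> nonleaders le A")
    case True
    then have "mv i w \<in> below A" using f(3) by (simp add: below_def)
    with below show ?thesis by blast
  next
    case False
    then obtain g b where g: "g \<in> set A" "mv i w = mv b (leader le g)"
      using leader_deriv_cases by blast
    then have "snd (leader le g) = snd w" by (simp add: dvar_eq_iff)
    with True g(1) have "dord_var w < dord_var (leader le g)" by (simp add: nonleaders_iff)
    moreover have "i + dord_var w = b + dord_var (leader le g)" using g(2) by (simp add: dvar_eq_iff)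
    ultimately have "b < k" using f(4) by simp
    with IH1[OF g(1) _ f(2,4) g(2)[symmetric]] g(2) show ?thesis by simp
  qed
next
  case False
  then obtain g b where g: "g \<in> set A" "w = mv b (leader le g)" using leader_deriv_cases by blast
  then have "dapp (replicate_mset b delta) (leader le g) \<in> vars f" using f(2) by (simp add: mv_def)
  then have "replicate_mset b delta = {#}" by (rule autoreducedD(3)[OF A f(1) g(1)])
  then have w: "w = leader le g" using g(2) by simp
  show ?thesis
  proof (cases "i = k")
    case True
    with f(5) w have "leader le g \<noteq> leader le f" by auto
    then show ?thesis using IH2[OF g(1)] f(2) w True by simp
  next
    case False
    then have "i < k" using f(4) by simp
    then show ?thesis using IH1[OF g(1) _ f(2,4)] w by simp
  qed
qed

lemma closure_leader:
  assumes P: "diff_ideal D P" and A: "triangular A P" and below: "below A \<subseteq> alg_closure P S"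
    and f: "f \<in> set A"
    and IH1: "\<And>g k' w i. g \<in> set A \<Longrightarrow> k' < k \<Longrightarrow> w \<in> vars f \<Longrightarrow> i \<le> k \<Longrightarrow>
      mv k' (leader le g) = mv i w \<Longrightarrow> mv k' (leader le g) \<in> alg_closure P S"
    and IH2: "\<And>g. g \<in> set A \<Longrightarrow> leader le g \<in> vars f \<Longrightarrow> leader le g \<noteq> leader le f \<Longrightarrow>
      mv k (leader le g) \<in> alg_closure P S"
    and free: "\<And>w i. w \<in> vars f \<Longrightarrow> snd w \<notin> led A \<Longrightarrow> i \<le> k \<Longrightarrow> mv i w \<in> alg_closure P S"
  shows "mv k (leader le f) \<in> alg_closure P S"
proof (rule closure_leader_step[OF P triangularD(2)[OF A f] autoreducedD(1)[OF triangularD(1)[OF A] f]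
    triangularD(3,4)[OF A f]])
  fix u i assume u: "u \<in> vars f" "i \<le> k" "mv i u \<noteq> mv k (leader le f)"
  show "mv i u \<in> alg_closure P S"
  proof (cases "snd u \<in> led A")
    case True
    show ?thesis
      by (rule closure_led_var[OF triangularD(1)[OF A] below f u(1) True u(2,3) IH1 IH2])
  qed (rule free[OF u(1) _ u(2)])
qed

text \<open>Nested induction, first on the number of derivations, then on the rank of the leader.
  The predicate \<open>ok\<close> delimits the derivatives for which the available parametric
  variables suffice; it must be inherited by every leader derivative met on the way.\<close>

lemma closure_leaders:
  assumes P: "diff_ideal D P" and A: "triangular A P" and below: "below A \<subseteq> alg_closure P S"
    and ok1: "\<And>g h k k' w i. ok k g \<Longrightarrow> g \<in> set A \<Longrightarrow> h \<in> set A \<Longrightarrow> k' < k \<Longrightarrow> w \<in> vars g \<Longrightarrow> i \<le> k \<Longrightarrow>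
      mv k' (leader le h) = mv i w \<Longrightarrow> ok k' h"
    and ok2: "\<And>g h k. ok k g \<Longrightarrow> g \<in> set A \<Longrightarrow> h \<in> set A \<Longrightarrow> leader le h \<in> vars g \<Longrightarrow> ok k h"
    and free: "\<And>g w i k. ok k g \<Longrightarrow> g \<in> set A \<Longrightarrow> w \<in> vars g \<Longrightarrow> snd w \<notin> led A \<Longrightarrow> i \<le> k \<Longrightarrow>
      mv i w \<in> alg_closure P S"
    and f: "f \<in> set A" "ok k f"
  shows "mv k (leader le f) \<in> alg_closure P S"
  using f
proof (induction k arbitrary: f rule: less_induct)
  case (less k)
  have "\<forall>f\<in>set A. leader le f = v \<longrightarrow> ok k f \<longrightarrow> mv k (leader le f) \<in> alg_closure P S" for v
  proof (induction v rule: wf_induct_rule[OF wf_ranking])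
    case (1 v)
    show ?case
    proof (intro ballI impI)
      fix f assume f: "f \<in> set A" "leader le f = v" "ok k f"
      note nc = autoreducedD(1)[OF triangularD(1)[OF A] f(1)]
      show "mv k (leader le f) \<in> alg_closure P S"
      proof (rule closure_leader[OF P A below f(1)])
        fix g k' w i
        assume g: "g \<in> set A" "k' < k" "w \<in> vars f" "i \<le> k" "mv k' (leader le g) = mv i w"
        show "mv k' (leader le g) \<in> alg_closure P S"
          by (rule less.IH[OF g(2,1) ok1[OF f(3,1) g]])
      next
        fix g assume g: "g \<in> set A" "leader le g \<in> vars f" "leader le g \<noteq> leader le f"
        from 1[OF leader_less[OF nc g(2,3), unfolded f(2)]] g(1) ok2[OF f(3,1) g(1,2)]
        show "mv k (leader le g) \<in> alg_closure P S" by blast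
      next
        fix w i assume "w \<in> vars f" "snd w \<notin> led A" "i \<le> k"
        then show "mv i w \<in> alg_closure P S" by (rule free[OF f(3,1)])
      qed
    qed
  qed
  with less.prems show ?case by blast
qed

text \<open>Under an orderly ranking no variable of an element of A exceeds its leader in order, so
  expressing a variable of order at most t never calls for orders above t.\<close>

lemma closure_orderly:
  assumes P: "diff_ideal D P" and A: "triangular A P" and orderly: "orderly le" and v: "dord_var v \<le> t"
  shows "v \<in> alg_closure P (below A \<union> free A t)"
proof (cases "v \<in> nonleaders le A")
  case True
  show ?thesis by (rule alg_closure.base[OF nonleaders_cases[OF True v]])
next
  case False
  then obtain f k where f: "f \<in> set A" "v = mv k (leader le f)" using leader_deriv_cases by blast
  have ord_le: "dord_var w \<le> dord_var (leader le g)" if "g \<in> set A" "w \<in> vars g" for g w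
  proof (rule ccontr)
    assume "\<not> dord_var w \<le> dord_var (leader le g)"
    then have "le (leader le g) w" "leader le g \<noteq> w"
      using orderly[unfolded orderly_def, rule_format, of "leader le g" w] by simp_all
    with leader(2)[OF autoreducedD(1)[OF triangularD(1)[OF A] that(1)] that(2)] le_antisym
    show False by blast
  qed
  have ok: "k + dord_var (leader le f) \<le> t" using v f(2) by simp
  have "mv k (leader le f) \<in> alg_closure P (below A \<union> free A t)"
  proof (rule closure_leaders[OF P A _ _ _ _ f(1), of _ "\<lambda>k g. k + dord_var (leader le g) \<le> t"])
    show "below A \<subseteq> alg_closure P (below A \<union> free A t)" by (auto intro: alg_closure.base)
    show "k' + dord_var (leader le h) \<le> t"
      if "k + dord_var (leader le g) \<le> t" "g \<in> set A" "w \<in> vars g" "i \<le> k"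
        "mv k' (leader le h) = mv i w" for g h k k' w i
    proof -
      have "k' + dord_var (leader le h) = i + dord_var w" using that(5) by (simp add: dvar_eq_iff)
      with ord_le[OF that(2,3)] that(1,4) show ?thesis by linarith
    qed
    show "k + dord_var (leader le h) \<le> t"
      if "k + dord_var (leader le g) \<le> t" "g \<in> set A" "leader le h \<in> vars g" for g h k
      using ord_le[OF that(2,3)] that(1) by linarith
    show "mv i w \<in> alg_closure P (below A \<union> free A t)"
      if "k + dord_var (leader le g) \<le> t" "g \<in> set A" "w \<in> vars g" "snd w \<notin> led A" "i \<le> k" for g w i k
    proof -
      have "dord_var (mv i w) \<le> t" using ord_le[OF that(2,3)] that(1,5) by simp
      then have "mv i w \<in> free A t" using that(4) by (simp add: free_def)
      then show ?thesis by (intro alg_closure.base) blast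
    qed
  qed (rule ok)
  then show ?thesis by (simp add: f(2))
qed

text \<open>For an arbitrary ranking, parametric variables may have larger order than the leader.
  Their order is at most s, so t derivations stay within the cutoff \<open>t + s\<close>.\<close>

lemma closure_triangular:
  assumes P: "diff_ideal D P" and A: "triangular A P"
    and s: "\<And>g w. g \<in> set A \<Longrightarrow> w \<in> vars g \<Longrightarrow> dord_var w \<le> s" and v: "dord_var v \<le> t"
  shows "v \<in> alg_closure P (below A \<union> free A (t + s))"
proof (cases "v \<in> nonleaders le A")
  case True
  then show ?thesis using nonleaders_cases[OF True, of "t + s"] v by (intro alg_closure.base) simp
next
  case False
  then obtain f k where f: "f \<in> set A" "v = mv k (leader le f)" using leader_deriv_cases by blast
  have "k \<le> t" using v f(2) by simp
  have "mv k (leader le f) \<in> alg_closure P (below A \<union> free A (t + s))"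
  proof (rule closure_leaders[OF P A _ _ _ _ f(1), of _ "\<lambda>k g. k \<le> t"])
    show "below A \<subseteq> alg_closure P (below A \<union> free A (t + s))" by (auto intro: alg_closure.base)
    show "mv i w \<in> alg_closure P (below A \<union> free A (t + s))"
      if "k \<le> t" "g \<in> set A" "w \<in> vars g" "snd w \<notin> led A" "i \<le> k" for g w i k
    proof -
      have "dord_var (mv i w) \<le> t + s" using s[OF that(2,3)] that(1,5) by simp
      then have "mv i w \<in> free A (t + s)" using that(4) by (simp add: free_def)
      then show ?thesis by (intro alg_closure.base) blast
    qed
  qed (use \<open>k \<le> t\<close> in auto)
  then show ?thesis by (simp add: f(2))
qed

text \<open>
  Let \<open>z\<close> be a free variable of the highest order \<open>s\<close> occurring in \<open>A\<close>, and let it occur in \<open>f0\<close> but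
  in no element of lower leader.  Then the \<open>k\<close>-th derivative of \<open>f0\<close> is linear in that of \<open>z\<close>, which
  is thus recovered from the \<open>k\<close>-th derivative of the leader of \<open>f0\<close>.
\<close>

lemma closure_exchange:
  assumes P: "diff_ideal D P" and A: "triangular A P"
    and T: "\<And>v. dord_var v \<le> t \<Longrightarrow> v \<in> alg_closure P S" and t: "total_order A \<le> t" "s \<le> t"
    and f0: "f0 \<in> set A" "z \<in> vars f0" "snd z \<notin> led A" "dord_var z = s" "partial z f0 \<notin> P"
    and max: "\<And>g w. g \<in> set A \<Longrightarrow> w \<in> vars g \<Longrightarrow> snd w \<notin> led A \<Longrightarrow> dord_var w \<le> s"
    and least: "\<And>g w. g \<in> set A \<Longrightarrow> le (leader le g) (leader le f0) \<Longrightarrow> leader le g \<noteq> leader le f0 \<Longrightarrow>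
      w \<in> vars g \<Longrightarrow> snd w \<notin> led A \<Longrightarrow> dord_var w < s"
    and extra: "\<And>v. snd v \<notin> led A \<Longrightarrow> snd v \<noteq> snd z \<Longrightarrow> t < dord_var v \<Longrightarrow>
      dord_var v \<le> s + (t - dord_var (leader le f0)) \<Longrightarrow> v \<in> alg_closure P S"
    and k: "k \<le> t - dord_var (leader le f0)"
  shows "(\<forall>f\<in>set A. mv k (leader le f) \<in> alg_closure P S) \<and>
    (\<forall>w. snd w \<notin> led A \<longrightarrow> dord_var w \<le> s + k \<longrightarrow> w \<in> alg_closure P S)"
  using k
proof (induction k rule: less_induct)
  case (less k)
  let ?Cl = "alg_closure P S"
  note nc = autoreducedD(1)[OF triangularD(1)[OF A]]
  have f0t: "k + dord_var (leader le f0) \<le> t"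
    using less.prems leader_order_le[OF f0(1)] t(1) by linarith
  have below: "below A \<subseteq> ?Cl" using below_order_le t(1) T order_trans by blast
  have IH: "mv k' (leader le g) \<in> ?Cl" if "g \<in> set A" "k' < k" for g k'
    using less.IH[OF that(2)] less.prems that by simp
  \<comment> \<open>Parametric variables of order below \<open>s + k\<close> are supplied by the
    previous stage, or by T when k = 0.\<close>
  have lower: "w \<in> ?Cl" if w: "snd w \<notin> led A" "dord_var w < s + k" for w
  proof (cases k)
    case 0
    then show ?thesis using w t(2) by (intro T) simp
  next
    case (Suc k')
    then have k': "k' < k" "k' \<le> t - dord_var (leader le f0)" using less.prems by simp_all
    show ?thesis
      by (rule conjunct2[OF less.IH[OF k'], rule_format, OF w(1)]) (use w(2) Suc in simp)
  qed
  \<comment> \<open>Elements with leader below that of \<open>f0\<close> contain only parametric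
    variables of order less than s, so their derivatives need nothing of order
    \<open>s + k\<close>.\<close>
  have low: "\<forall>g\<in>set A. leader le g = v \<longrightarrow> le v (leader le f0) \<longrightarrow> v \<noteq> leader le f0 \<longrightarrow>
    mv k (leader le g) \<in> ?Cl" for v
  proof (induction v rule: wf_induct_rule[OF wf_ranking])
    case (1 v)
    show ?case
    proof (intro ballI impI)
      fix g assume g: "g \<in> set A" "leader le g = v" "le v (leader le f0)" "v \<noteq> leader le f0"
      show "mv k (leader le g) \<in> ?Cl"
      proof (rule closure_leader[OF P A below g(1)])
        fix h assume h: "h \<in> set A" "leader le h \<in> vars g" "leader le h \<noteq> leader le g"
        have hv: "(leader le h, v) \<in> {(u, v). le u v \<and> u \<noteq> v}"
          using leader_less[OF nc[OF g(1)] h(2,3)] g(2) by simp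
        then have lt: "le (leader le h) v" "leader le h \<noteq> v" by simp_all
        have "le (leader le h) (leader le f0)" by (rule le_trans[OF lt(1) g(3)])
        moreover have "leader le h \<noteq> leader le f0" using le_antisym[OF g(3)] lt by auto
        ultimately show "mv k (leader le h) \<in> ?Cl" using 1[OF hv] h(1) by blast
      next
        fix w i assume w: "w \<in> vars g" "snd w \<notin> led A" "i \<le> k"
        have "dord_var w < s" using least[OF g(1) _ _ w(1,2)] g(2-4) by simp
        then show "mv i w \<in> ?Cl" using w by (intro lower) simp_all
      qed (rule IH)
    qed
  qed
  have u0: "mv k (leader le f0) \<in> ?Cl" using f0t by (intro T) simp
  \<comment> \<open>Variables of order exactly \<open>s + k\<close> over the other parametric
    indeterminates are known outright up to order t, and beyond that they are adjoined through
    \<open>extra\<close>.\<close>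
  have same: "w \<in> ?Cl" if w: "snd w \<notin> led A" "snd w \<noteq> snd z" "dord_var w = s + k" for w
  proof (cases "s + k \<le> t")
    case True
    then show ?thesis using w(3) by (intro T) simp
  next
    case False
    then show ?thesis using w less.prems by (intro extra) simp_all
  qed
  \<comment> \<open>In the derivative of \<open>f0\<close> everything but the derivative of z is now
    known: the leader of \<open>f0\<close> because its order is at most t, lower leaders by
    \<open>low\<close>, and parametric variables by \<open>lower\<close> and
    \<open>same\<close>.\<close>
  have ztop: "mv k z \<in> ?Cl"
  proof (cases k)
    case 0
    then show ?thesis using f0(4) t(2) by (intro T) simp
  next
    case (Suc k')
    show ?thesis unfolding Suc
    proof (rule closure_deriv_step[OF P triangularD(2)[OF A f0(1)] f0(5)])
      show "mv (Suc j) z \<notin> vars f0" for j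
        using max[OF f0(1), of "mv (Suc j) z"] f0(3,4) by auto
      fix u i assume u: "u \<in> vars f0" "i \<le> Suc k'" "mv i u \<noteq> mv (Suc k') z"
      show "mv i u \<in> ?Cl"
      proof (cases "snd u \<in> led A")
        case True
        show ?thesis
        proof (cases "mv i u = mv k (leader le f0)")
          case False
          show ?thesis
          proof (rule closure_led_var[OF triangularD(1)[OF A] below f0(1) u(1) True _ False])
            show "i \<le> k" using u(2) Suc by simp
            fix g assume g: "g \<in> set A" "leader le g \<in> vars f0" "leader le g \<noteq> leader le f0"
            have "le (leader le g) (leader le f0)" by (rule leader(2)[OF nc[OF f0(1)] g(2)])
            with low g(1,3) show "mv k (leader le g) \<in> ?Cl" by blast
          qed (rule IH)
        qed (use u0 in simp)
      next
        case False
        have du: "dord_var u \<le> s" by (rule max[OF f0(1) u(1) False])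
        show ?thesis
        proof (cases "dord_var (mv i u) < s + k")
          case True
          then show ?thesis using False by (intro lower) simp_all
        next
          case nless: False
          then have "dord_var (mv i u) = s + k" using du u(2) Suc by simp
          moreover have "snd u \<noteq> snd z"
          proof
            assume "snd u = snd z"
            then have "mv i u = mv (Suc k') z"
              using \<open>dord_var (mv i u) = s + k\<close> Suc f0(4) by (simp add: dvar_eq_iff)
            with u(3) show False by blast
          qed
          ultimately show ?thesis using False by (intro same) simp_all
        qed
      qed
    qed
  qed
  have upto: "w \<in> ?Cl" if w: "snd w \<notin> led A" "dord_var w \<le> s + k" for w
  proof (cases "dord_var w < s + k")
    case True
    then show ?thesis using w(1) by (intro lower)
  next
    case False
    then have eq: "dord_var w = s + k" using w(2) by simp
    show ?thesis
    proof (cases "snd w = snd z")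
      case True
      then have "w = mv k z" using eq f0(4) by (simp add: dvar_eq_iff)
      then show ?thesis using ztop by simp
    next
      case False
      then show ?thesis using w(1) eq by (intro same)
    qed
  qed
  \<comment> \<open>With all parametric variables up to order \<open>s + k\<close> available, the
    remaining leaders follow in order of rank.\<close>
  have "\<forall>g\<in>set A. leader le g = v \<longrightarrow> mv k (leader le g) \<in> ?Cl" for v
  proof (induction v rule: wf_induct_rule[OF wf_ranking])
    case (1 v)
    show ?case
    proof (intro ballI impI)
      fix g assume g: "g \<in> set A" "leader le g = v"
      show "mv k (leader le g) \<in> ?Cl"
      proof (rule closure_leader[OF P A below g(1)])
        fix h assume h: "h \<in> set A" "leader le h \<in> vars g" "leader le h \<noteq> leader le g"
        have "(leader le h, v) \<in> {(u, v). le u v \<and> u \<noteq> v}"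
          using leader_less[OF nc[OF g(1)] h(2,3)] g(2) by simp
        from 1[OF this] h(1) show "mv k (leader le h) \<in> ?Cl" by blast
      next
        fix w i assume w: "w \<in> vars g" "snd w \<notin> led A" "i \<le> k"
        have "dord_var w \<le> s" by (rule max[OF g(1) w(1,2)])
        then show "mv i w \<in> ?Cl" using w by (intro upto) simp_all
      qed (rule IH)
    qed
  qed
  with upto show ?case by blast
qed

end

subsection \<open>The order bound\<close>

lemma linear_growth_compare:
  fixes a b x y :: nat
  assumes "\<And>t. t0 \<le> t \<Longrightarrow> a + x * Suc t \<le> b + y * Suc t"
  shows "x \<le> y" "x = y \<Longrightarrow> a \<le> b"
proof -
  show "x \<le> y"
  proof (rule ccontr)
    assume "\<not> x \<le> y"
    then have "Suc y * Suc (t0 + b) \<le> x * Suc (t0 + b)" by (intro mult_le_mono1) simp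
    with assms[of "t0 + b"] show False by simp
  qed
  show "x = y \<Longrightarrow> a \<le> b" using assms[of t0] by simp
qed

context ordinary
begin

text \<open>Initials, separants and polynomials in the non-leaders are themselves reduced, so a
  nonzero one cannot belong to P.\<close>

lemma triangular_char_set:
  assumes P: "prime_diff_ideal D P" and A: "char_set le P A"
  shows "triangular A P"
proof -
  note J = prime_diff_idealD(1)[OF P] and one = prime_diff_idealD(2)[OF P]
  have aut: "autoreduced le A" and sub: "set A \<subseteq> P" using A by (auto simp: char_set_def)
  have not_mem: "p \<notin> P" if "p \<noteq> 0" "\<And>g. g \<in> set A \<Longrightarrow> reduced le p g" for p
    using char_set_reduced_zero[OF J one A _ that(2)] that(1) by blast
  have red: "reduced le p g" if f: "f \<in> set A" "g \<in> set A" and p: "vars p \<subseteq> vars f"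
    "deg_in (leader le g) p \<le> deg_in (leader le g) f"
    "deg_in (leader le f) p < deg_in (leader le f) f" for p f g
  proof -
    have "dapp \<theta> (leader le g) \<notin> vars p" if "\<theta> \<noteq> {#}" for \<theta>
      using autoreducedD(3)[OF aut f] p(1) that by blast
    moreover have "deg_in (leader le g) p < deg_in (leader le g) g"
      using autoreducedD(2)[OF aut f] p(2,3) by (cases "f = g") auto
    ultimately show ?thesis by (simp add: reduced_def)
  qed
  have "initial le f \<notin> P" if f: "f \<in> set A" for f
  proof (rule not_mem)
    have nc: "f \<notin> range Const" by (rule autoreducedD(1)[OF aut f])
    then have "f \<noteq> 0" by (auto simp flip: Const_0)
    then show "initial le f \<noteq> 0" by (rule initial_nonzero)
    show "reduced le (initial le f) g" if "g \<in> set A" for g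
    proof (rule red[OF f that])
      show "vars (initial le f) \<subseteq> vars f" using vars_initial[of f] by blast
      show "deg_in (leader le g) (initial le f) \<le> deg_in (leader le g) f"
        unfolding initial_def by (rule deg_in_coeff_in_le)
      show "deg_in (leader le f) (initial le f) < deg_in (leader le f) f"
        using deg_leader_pos[OF nc] by (simp add: initial_def deg_in_notin)
    qed
  qed
  moreover have "separant le f \<notin> P" if f: "f \<in> set A" for f
  proof (rule not_mem)
    have nc: "f \<notin> range Const" by (rule autoreducedD(1)[OF aut f])
    show "separant le f \<noteq> 0" unfolding separant_def by (rule partial_nonzero[OF leader(1)[OF nc]])
    show "reduced le (separant le f) g" if "g \<in> set A" for g
      unfolding separant_def
      by (rule red[OF f that vars_partial deg_in_partial_le deg_in_partial_same[OF deg_leader_pos[OF nc]]])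
  qed
  moreover have "P \<inter> poly_in (nonleaders le A) \<subseteq> {0}"
  proof
    fix p assume p: "p \<in> P \<inter> poly_in (nonleaders le A)"
    have "reduced le p g" if g: "g \<in> set A" for g
    proof -
      have *: "dapp \<theta> (leader le g) \<notin> vars p" for \<theta>
        using leader_notin_nonleaders[OF g, of \<theta>] p by (auto simp: poly_in_def)
      then have "deg_in (leader le g) p = 0" using *[of "{#}"] by (simp add: deg_in_notin)
      then show ?thesis
        using * deg_leader_pos[OF autoreducedD(1)[OF aut g]] by (simp add: reduced_def)
    qed
    with not_mem p show "p \<in> {0}" by blast
  qed
  ultimately show ?thesis using aut sub by (simp add: triangular_def)
qed

lemma dord_orderly:
  assumes "orderly le" "f \<notin> range Const"
  shows "dord f = dord_var (leader le f)"
proof -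
  have "dord_var w \<le> dord_var (leader le f)" if w: "w \<in> vars f" for w
  proof (rule ccontr)
    assume "\<not> dord_var w \<le> dord_var (leader le f)"
    then have "le (leader le f) w" "leader le f \<noteq> w"
      using assms(1)[unfolded orderly_def, rule_format, of "leader le f" w] by simp_all
    with leader(2)[OF assms(2) w] le_antisym show False by blast
  qed
  then show ?thesis unfolding dord_def
    using leader(1)[OF assms(2)] by (intro Max_eqI) auto
qed

lemma sum_dord_orderly:
  assumes "orderly le" "autoreduced le A"
  shows "sum_list (map dord A) = total_order A"
  unfolding total_order_def
  using dord_orderly[OF assms(1) autoreducedD(1)[OF assms(2)]] by (simp cong: map_cong)

text \<open>Modulo P, the independent family of each set is algebraic over that of the other, up to
  a shift of the cutoff. The first two bounds compare linear functions of the cutoff; the second is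
  uniform in P. The third exploits the derivatives of z that come without new generators.\<close>

lemma order_bounds:
  assumes P: "prime_diff_ideal D P" and C: "triangular C P"
    and le': "ranking le'" "orderly le'" and A: "char_set le' P A"
    and s: "\<And>g w. g \<in> set C \<Longrightarrow> w \<in> vars g \<Longrightarrow> dord_var w \<le> s"
  shows "total_order C \<le> sum_list (map dord A)"
    and "sum_list (map dord A) \<le> total_order C + card (- led C) * s"
    and "\<lbrakk>f0 \<in> set C; z \<in> vars f0; snd z \<notin> led C; partial z f0 \<notin> P;
      \<And>g w. g \<in> set C \<Longrightarrow> w \<in> vars g \<Longrightarrow> snd w \<notin> led C \<Longrightarrow> dord_var w \<le> dord_var z;
      \<And>g w. g \<in> set C \<Longrightarrow> le (leader le g) (leader le f0) \<Longrightarrow> leader le g \<noteq> leader le f0 \<Longrightarrow>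
        w \<in> vars g \<Longrightarrow> snd w \<notin> led C \<Longrightarrow> dord_var w < dord_var z\<rbrakk>
      \<Longrightarrow> dord_var z \<le> sum_list (map dord A)"
proof -
  interpret O: ordinary D le'
    by unfold_locales (use le'(1) card_deriv in auto)
  note J = prime_diff_idealD(1)[OF P]
  note TA = O.triangular_char_set[OF P A]
  note autA = O.triangularD(1)[OF TA] and autC = triangularD(1)[OF C]
  define h where "h = sum_list (map dord A)"
  have h: "h = O.total_order A" unfolding h_def by (rule O.sum_dord_orderly[OF le'(2) autA])
  define e where "e = total_order C"
  define q where "q = card (- led C)"
  define q' where "q' = card (- O.led A)"
  have finC: "finite (below C \<union> free C t)" and cardC: "card (below C \<union> free C t) = e + q * Suc t" for t
    unfolding e_def q_def by (rule card_below_free[OF autC])+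
  have finA: "finite (O.below A \<union> O.free A t)"
    and cardA: "card (O.below A \<union> O.free A t) = h + q' * Suc t" for t
    unfolding h q'_def by (rule O.card_below_free[OF autA])+
  have TcA: "v \<in> alg_closure P (O.below A \<union> O.free A t)" if "dord_var v \<le> t" for v t
    by (rule O.closure_orderly[OF J TA le'(2) that])
  have TcC: "v \<in> alg_closure P (below C \<union> free C (t + s))" if "dord_var v \<le> t" for v t
    by (rule closure_triangular[OF J C s that])
  have indA: "P \<inter> poly_in (O.below A \<union> O.free A t) \<subseteq> {0}" for t
    by (rule O.triangularD(5)[OF TA Un_least[OF O.below_subset O.free_subset]])
  have indC: "P \<inter> poly_in (below C \<union> free C t) \<subseteq> {0}" for t
    by (rule triangularD(5)[OF C Un_least[OF below_subset free_subset]])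
  have L1: "h + q' * Suc t \<le> (e + q * s) + q * Suc t" if "h \<le> t" for t
  proof -
    have "dord_var v \<le> t" if "v \<in> O.below A \<union> O.free A t" for v
      using that O.below_order_le[of v A] \<open>h \<le> t\<close> by (auto simp: O.free_def h)
    then have "O.below A \<union> O.free A t \<subseteq> alg_closure P (below C \<union> free C (t + s))" using TcC by blast
    from card_independent_le[OF P finC finA this indA] show ?thesis
      by (simp add: cardA cardC algebra_simps)
  qed
  have L2: "e + q * Suc t \<le> h + q' * Suc t" if "e \<le> t" for t
  proof -
    have "dord_var v \<le> t" if "v \<in> below C \<union> free C t" for v
      using that below_order_le[of v C] \<open>e \<le> t\<close> by (auto simp: free_def e_def)
    then have "below C \<union> free C t \<subseteq> alg_closure P (O.below A \<union> O.free A t)" using TcA by blast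
    from card_independent_le[OF P finA finC this indC] show ?thesis
      by (simp only: cardA cardC)
  qed
  \<comment> \<open>The slopes in t must agree before the constant terms can be compared.\<close>
  have "q' \<le> q" by (rule linear_growth_compare(1)[OF L1])
  moreover have "q \<le> q'" by (rule linear_growth_compare(1)[OF L2])
  ultimately have qq: "q' = q" by (rule antisym)
  show e_le: "total_order C \<le> sum_list (map dord A)"
    unfolding e_def[symmetric] h_def[symmetric]
    by (rule linear_growth_compare(2)[OF L2 qq[symmetric]])
  show "sum_list (map dord A) \<le> total_order C + card (- led C) * s"
    unfolding e_def[symmetric] h_def[symmetric] q_def[symmetric]
    by (rule linear_growth_compare(2)[OF L1 qq])
  assume f0: "f0 \<in> set C" "z \<in> vars f0" "snd z \<notin> led C" "partial z f0 \<notin> P"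
    and max: "\<And>g w. g \<in> set C \<Longrightarrow> w \<in> vars g \<Longrightarrow> snd w \<notin> led C \<Longrightarrow> dord_var w \<le> dord_var z"
    and least: "\<And>g w. g \<in> set C \<Longrightarrow> le (leader le g) (leader le f0) \<Longrightarrow> leader le g \<noteq> leader le f0 \<Longrightarrow>
        w \<in> vars g \<Longrightarrow> snd w \<notin> led C \<Longrightarrow> dord_var w < dord_var z"
  define E where "E = dord_var (leader le f0)"
  have Ee: "E \<le> e" unfolding E_def e_def by (rule leader_order_le[OF f0(1)])
  show "dord_var z \<le> sum_list (map dord A)"
  proof (cases "dord_var z \<le> E")
    case True
    with Ee e_le show ?thesis by (simp add: e_def)
  next
    case False
    define d where "d = dord_var z - E"
    \<comment> \<open>Large enough for z, the leader of \<open>f0\<close> and all of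
      \<open>below C\<close> to have order at most t.\<close>
    define t where "t = e + dord_var z"
    have td: "dord_var z + (t - E) = t + d" using False Ee by (simp add: d_def t_def)
    \<comment> \<open>Only the derivatives over parametric indeterminates other than that of z are
      adjoined between orders \<open>t + 1\<close> and \<open>t + d\<close>; those of z are
      recovered from the leader of \<open>f0\<close>.\<close>
    define X where "X = (\<lambda>(j, k). mk j k) ` ((- led C - {snd z}) \<times> {t<..t + d})"
    define S where "S = (O.below A \<union> O.free A t) \<union> X"
    have finX: "finite X" by (simp add: X_def)
    have "card X \<le> card ((- led C - {snd z}) \<times> {t<..t + d})"
      unfolding X_def by (rule card_image_le) simp
    also have "\<dots> = (q - 1) * d"
      using f0(3) by (simp add: card_cartesian_product q_def card_Diff_singleton)
    finally have cardX: "card X \<le> (q - 1) * d" .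
    have mono: "v \<in> alg_closure P S" if "v \<in> alg_closure P (O.below A \<union> O.free A t)" for v
      using that
    proof induction
      case (base v)
      then show ?case by (intro alg_closure.base) (simp add: S_def)
    next
      case (step f v)
      show ?case by (rule alg_closure.step[OF step.hyps(1) step.IH step.hyps(3,4)])
    qed
    have T: "v \<in> alg_closure P S" if "dord_var v \<le> t" for v
      by (rule mono[OF TcA[OF that]])
    have exch: "(\<forall>f\<in>set C. mv (t - E) (leader le f) \<in> alg_closure P S) \<and>
      (\<forall>w. snd w \<notin> led C \<longrightarrow> dord_var w \<le> dord_var z + (t - E) \<longrightarrow> w \<in> alg_closure P S)"
    proof (rule closure_exchange[OF J C T _ _ f0(1-3) refl f0(4) max least, folded E_def])
      show "total_order C \<le> t" "dord_var z \<le> t" by (simp_all add: t_def e_def)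
      show "v \<in> alg_closure P S" if "snd v \<notin> led C" "snd v \<noteq> snd z" "t < dord_var v"
        "dord_var v \<le> dord_var z + (t - E)" for v
      proof -
        have "v = (\<lambda>(j, k). mk j k) (snd v, dord_var v)" by simp
        moreover have "(snd v, dord_var v) \<in> (- led C - {snd z}) \<times> {t<..t + d}"
          using that td by simp
        ultimately have "v \<in> X" unfolding X_def by (rule image_eqI)
        then show ?thesis by (intro alg_closure.base) (simp add: S_def)
      qed
    qed simp_all
    have "below C \<union> free C (t + d) \<subseteq> alg_closure P S"
    proof
      fix v assume "v \<in> below C \<union> free C (t + d)"
      then show "v \<in> alg_closure P S"
      proof
        assume "v \<in> below C"
        then show ?thesis using below_order_le[of v C] by (intro T) (simp add: t_def e_def)
      next
        assume "v \<in> free C (t + d)"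
        then have "snd v \<notin> led C" "dord_var v \<le> dord_var z + (t - E)" using td by (simp_all add: free_def)
        with conjunct2[OF exch] show ?thesis by blast
      qed
    qed
    moreover have "finite S" unfolding S_def using finA finX by blast
    ultimately have "card (below C \<union> free C (t + d)) \<le> card S"
      using card_independent_le[OF P _ finC _ indC] by blast
    also have "\<dots> \<le> card (O.below A \<union> O.free A t) + card X" unfolding S_def by (rule card_Un_le)
    also have "\<dots> \<le> h + q * Suc t + (q - 1) * d" using cardX by (simp add: cardA qq)
    finally have "e + q * Suc (t + d) \<le> h + q * Suc t + (q - 1) * d" by (simp only: cardC)
    \<comment> \<open>The independent set gains \<open>q * d\<close> variables and the generating
      set only \<open>(q - 1) * d\<close>. The difference d must be absorbed by
      \<open>h - e\<close>.\<close>
    moreover have "q > 0" unfolding q_def using f0(3) by (auto simp: card_gt_0_iff)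
    then obtain q1 where "q = Suc q1" using gr0_implies_Suc by blast
    ultimately have "e + d \<le> h" by (simp add: algebra_simps)
    moreover have "dord_var z = E + d" using False by (simp add: d_def)
    ultimately show ?thesis using Ee by (simp add: h_def)
  qed
qed

text \<open>Since an orderly ranking and a characteristic set exist, the choice in
  \<open>ord_prime\<close> is realized by an actual pair, to which the bounds can be
  applied.\<close>

lemma ord_prime_witness:
  "\<exists>le' A. ranking le' \<and> orderly le' \<and> char_set le' P A \<and> ord_prime P = sum_list (map dord A)"
  for P :: "('d, 'l, 'k) dpoly set"
proof -
  obtain le' :: "('d, 'l) dvar \<Rightarrow> ('d, 'l) dvar \<Rightarrow> bool" where le': "ranking le'" "orderly le'"
    using orderly_ranking_exists by blast
  interpret O: ordinary D le'
    by unfold_locales (use le'(1) card_deriv in auto)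
  obtain A where "char_set le' P A" using O.char_set_exists[of P] by blast
  with le' have "\<exists>s le A. ranking le \<and> orderly le \<and> char_set le P A \<and> s = sum_list (map dord A)"
    by blast
  from someI_ex[OF this] show ?thesis unfolding ord_prime_def .
qed

end

context canonical
begin

lemma triangular_C:
  assumes P: "P \<in> minimal_primes D I"
  shows "triangular C P"
proof -
  have notin: "w \<notin> P" if "regular w" for w
    by (rule minimal_prime_regular[OF I P regularD[OF that]])
  have "I \<subseteq> P" using P by (simp add: minimal_primes_def)
  then have "set C \<subseteq> P" using C_subset by blast
  moreover have "initial le f \<notin> P \<and> separant le f \<notin> P" if "f \<in> set C" for f
  proof -
    from that obtain i where "i < length A" "f = C ! i" using length_C by (auto simp: in_set_conv_nth)
    then show ?thesis using notin initial_C_regular separant_C_regular by simp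
  qed
  moreover have "P \<inter> poly_in (nonleaders le C) \<subseteq> {0}"
    unfolding nonleaders_C using notin N_regular by blast
  ultimately show ?thesis using autoreduced_C by (simp add: triangular_def)
qed

lemma dord_C_le_ord_ideal:
  assumes f: "f \<in> set C"
  shows "dord f \<le> ord_ideal D I"
proof -
  \<comment> \<open>A crude bound on all orders occurring in C; what matters is that it does not
    depend on P.\<close>
  define s where "s = (\<Sum>g\<in>set C. dord g)"
  have s: "dord_var w \<le> s" if "g \<in> set C" "w \<in> vars g" for g w
  proof -
    have "dord_var w \<le> dord g" unfolding dord_def using that(2) by (intro Max_ge) auto
    also have "\<dots> \<le> s" unfolding s_def by (rule member_le_sum[OF that(1)]) auto
    finally show ?thesis .
  qed
  have prime: "prime_diff_ideal D P" if "P \<in> minimal_primes D I" for P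
    using that by (simp add: minimal_primes_def)
  have upper: "ord_prime P \<le> total_order C + card (- led C) * s" if P: "P \<in> minimal_primes D I" for P
    using ord_prime_witness[of P] order_bounds(2)[OF prime[OF P] triangular_C[OF P] _ _ _ s] by force
  \<comment> \<open>A uniform bound makes the set of orders finite, so that each one lies below the
    maximum \<open>ord_ideal D I\<close>.\<close>
  then have "ord_prime ` minimal_primes D I \<subseteq> {..total_order C + card (- led C) * s}" by auto
  then have "finite (ord_prime ` minimal_primes D I)" by (rule finite_subset) simp
  then have ord_le: "ord_prime P \<le> ord_ideal D I" if "P \<in> minimal_primes D I" for P
    unfolding ord_ideal_def using that by (intro Max_ge) auto
  have "dord_var w \<le> ord_ideal D I" if w: "w \<in> vars f" for w
  proof (cases "snd w \<in> led C")
    case True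
    have "dord_var w \<le> total_order C"
    proof (cases "w \<in> nonleaders le C")
      case True
      then show ?thesis using \<open>snd w \<in> led C\<close> by (intro below_order_le) (simp add: below_def)
    next
      case False
      then obtain j where "j < length A" "w = lead j" using C_vars_cases[OF f w] nonleaders_C by auto
      then show ?thesis using leader_order_le[OF C_in_set] leader_C by metis
    qed
    moreover obtain P where P: "P \<in> minimal_primes D I"
      using minimal_prime_avoiding[OF poly_in_1 proper] by blast
    moreover have "total_order C \<le> ord_prime P"
      using ord_prime_witness[of P] order_bounds(1)[OF prime[OF P] triangular_C[OF P] _ _ _ s] by force
    ultimately show ?thesis using ord_le[OF P] by linarith
  next
    case False
    \<comment> \<open>The parametric variables occurring in C. Those over the other indeterminates
      were bounded by the orders of the leaders, in any minimal prime.\<close>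
    define B where "B = {v. snd v \<notin> led C} \<inter> (\<Union>g\<in>set C. vars g)"
    have B: "finite B" "w \<in> B" using False f w by (auto simp: B_def)
    define m where "m = Max (dord_var ` B)"
    have m: "dord_var v \<le> m" if "v \<in> B" for v unfolding m_def using B(1) that by (intro Max_ge) auto
    have "m \<in> dord_var ` B" unfolding m_def using B by (intro Max_in) auto
    then obtain v where v: "v \<in> B" "dord_var v = m" by auto
    \<comment> \<open>Among the elements containing a variable of maximal order m, the one with
      lowest leader is wanted; the minimal prime P below is then chosen according to it.\<close>
    define X where "X = {leader le g | g. g \<in> set C \<and> (\<exists>u\<in>vars g. u \<in> B \<and> dord_var u = m)}"
    have "finite X" unfolding X_def by simp
    moreover have "X \<noteq> {}" using v unfolding X_def B_def by blast
    ultimately obtain u0 where u0: "u0 \<in> X" "\<forall>u\<in>X. le u0 u" using finite_has_least by blast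
    then obtain f0 z where f0: "f0 \<in> set C" "u0 = leader le f0" "z \<in> vars f0" "z \<in> B" "dord_var z = m"
      unfolding X_def by blast
    obtain i where i: "i < length A" "f0 = C ! i" using f0(1) length_C by (auto simp: in_set_conv_nth)
    have zl: "snd z \<notin> led C" using f0(4) by (simp add: B_def)
    then have "z \<in> free C (dord_var z)" by (simp add: free_def)
    then have "z \<in> N" using free_subset[of C "dord_var z"] nonleaders_C by blast
    then have "partial z f0 \<notin> I" using partial_C_notin[OF i(1)] f0(3) i(2) by simp
    moreover have "partial z f0 \<in> poly_in (W (length A))"
      using poly_in_partial[OF poly_in_mono[OF C_in_W[OF i(1)] W_mono[of "Suc i" "length A"]]] i by simp
    ultimately obtain P where P: "P \<in> minimal_primes D I" "partial z f0 \<notin> P"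
      using minimal_prime_avoiding by blast
    have maxB: "dord_var w \<le> dord_var z" if "g \<in> set C" "w \<in> vars g" "snd w \<notin> led C" for g w
      using m[of w] that f0(5) by (auto simp: B_def)
    have leastB: "dord_var w < dord_var z" if g: "g \<in> set C" "le (leader le g) (leader le f0)"
      "leader le g \<noteq> leader le f0" "w \<in> vars g" "snd w \<notin> led C" for g w
    proof (rule ccontr)
      assume "\<not> dord_var w < dord_var z"
      then have "dord_var w = m" using maxB[OF g(1,4,5)] f0(5) by simp
      moreover have "w \<in> B" using g by (auto simp: B_def)
      ultimately have "leader le g \<in> X" using g(1,4) unfolding X_def by blast
      then have "le (leader le f0) (leader le g)" using u0(2) f0(2) by blast
      with g(2,3) le_antisym show False by blast
    qed
    obtain le' A' where A': "ranking le'" "orderly le'" "char_set le' P A'"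
      "ord_prime P = sum_list (map dord A')" using ord_prime_witness by blast
    have "dord_var w \<le> dord_var z" using m[OF B(2)] f0(5) by simp
    also have "\<dots> \<le> sum_list (map dord A')"
      by (rule order_bounds(3)[OF prime[OF P(1)] triangular_C[OF P(1)] A'(1-3) s f0(1,3) zl P(2)
            maxB leastB])
    finally show ?thesis using A'(4) ord_le[OF P(1)] by simp
  qed
  then show ?thesis unfolding dord_def by (simp add: Max_le_iff)
qed

end

theorem theorem8:
  fixes D :: "'d::finite \<Rightarrow> 'k::field_char_0 \<Rightarrow> 'k"
    and le :: "('d, 'l::finite) dvar \<Rightarrow> ('d, 'l) dvar \<Rightarrow> bool"
    and I :: "('d, 'l, 'k) dpoly set"
    and C :: "('d, 'l, 'k) dpoly list"
  assumes "commuting_derivations D"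
    and "ranking le"
    and "characterizable D le I"
    and "canonical_char_set le I C"
  shows "(\<forall>C'. canonical_char_set le I C' \<longrightarrow> C' = C) \<and>
    (CARD('d) = 1 \<longrightarrow> (\<forall>i<length C. dord (C ! i) \<le> ord_ideal D I))"
proof (intro conjI allI impI)
  interpret R: ranked_differential_ring D le
    by unfold_locales (fact assms)+
  have I: "diff_ideal D I" using assms(3) by (simp add: characterizable_def)
  have proper: "1 \<notin> I" by (rule R.characterizable_proper[OF assms(3)])
  show "C' = C" if "canonical_char_set le I C'" for C'
    by (rule R.canonical_char_set_unique[OF I proper assms(4) that])
  fix i assume card: "CARD('d) = 1" and i: "i < length C"
  from assms(3) obtain A where A: "char_set le I A"
    and sat: "I = saturation (diff_ideal_gen D (set A)) (H le A)"
    unfolding characterizable_def by blast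
  \<comment> \<open>The additional factor \<open>H le A\<close> is absorbed into the exponent of the
    saturation.\<close>
  have cancel: "f \<in> I" if "H le A * f \<in> I" for f
  proof -
    from that obtain m where "H le A ^ m * (H le A * f) \<in> diff_ideal_gen D (set A)"
      by (subst (asm) sat) (auto simp: saturation_def)
    then have "H le A ^ Suc m * f \<in> diff_ideal_gen D (set A)" by (simp add: ac_simps)
    then show ?thesis by (subst sat) (unfold saturation_def mem_Collect_eq, rule exI)
  qed
  interpret canonical D le I A C
    by unfold_locales (use assms(4) card I proper A cancel in auto)
  show "dord (C ! i) \<le> ord_ideal D I" by (rule dord_C_le_ord_ideal) (use i in simp)
qed

end
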